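(* \textsc{Colorful Graph Motif} can be solved in $\mathcal{O}(\sqrt{2}^{\,\ell}+n)$ time if the input graph $G$ is a tree, where $n=|V|$ and $\ell=|V|-|M|$.
   Context: \textsc{Colorful Graph Motif}: the input is a set $M$ of colors from a color set $C$, an undirected graph $G=(V,E)$, and a coloring $\chi:V\to C$; the question is whether there is $S\subseteq V$ with $G[S]$ connected and a one-to-one mapping $f:S\to M$ with $f(v)=\chi(v)$ for all $v\in S$. *)

theory Defs
  imports Complex_Main "Graph_Theory.Graph_Theory"
begin

section \<open>Colorful Graph Motif\<close>

text \<open>
  An undirected graph is a \<^const>\<open>pair_graph\<close>: finite, loop-free, with a symmetric arc set.
  The library's \<^const>\<open>tree\<close> excludes all directed cycles, in particular the closed walk
  \<open>u, v, u\<close> along a single undirected edge, so on symmetric graphs it only admits one-vertex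
  graphs. For undirected graphs only cycles of length at least 3 count.
  \<^const>\<open>Digraph_Component.connected\<close> includes non-emptiness of the vertex set.
\<close>

definition undirected_tree :: "'v pair_pre_digraph \<Rightarrow> bool" where
  "undirected_tree G \<longleftrightarrow> pair_graph G \<and> Digraph_Component.connected (with_proj G) \<and>
     (\<nexists>p. pre_digraph.cycle (with_proj G) p \<and> length p \<ge> 3)"

record ('v, 'c) motif_instance =
  mgraph :: "'v pair_pre_digraph"
  palette :: "'c set"
  coloring :: "'v \<Rightarrow> 'c"
  motif :: "'c set"

definition valid_motif_instance :: "('v, 'c) motif_instance \<Rightarrow> bool" where
  "valid_motif_instance I \<longleftrightarrow> pair_graph (mgraph I) \<and> finite (palette I) \<and>
     coloring I ` pverts (mgraph I) \<subseteq> palette I \<and> motif I \<subseteq> palette I"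

definition colorful_graph_motif :: "('v, 'c) motif_instance \<Rightarrow> bool" where
  "colorful_graph_motif I \<longleftrightarrow>
     (\<exists>S \<subseteq> pverts (mgraph I). Digraph_Component.connected (with_proj (mgraph I) \<restriction> S) \<and>
        (\<exists>f. bij_betw f S (motif I) \<and> (\<forall>v\<in>S. f v = coloring I v)))"


section \<open>Word RAM\<close>

text \<open>
  A unit-cost random access machine on \<open>w\<close>-bit words. Registers are named by fixed numbers in the
  program; memory is addressed by register contents. Arithmetic is modulo \<open>2 ^ w\<close>, except that
  subtraction is truncated at 0; division by 0 yields 0.
\<close>

datatype instr =
    Const nat nat
  | Add nat nat nat
  | Sub nat nat nat
  | Mul nat nat nat
  | Div nat nat nat
  | Load nat nat
  | Store nat nat
  | Jump nat
  | JumpZero nat nat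

type_synonym config = "nat \<times> (nat \<Rightarrow> nat) \<times> (nat \<Rightarrow> nat)"

fun exec :: "nat \<Rightarrow> instr \<Rightarrow> config \<Rightarrow> config" where
  "exec w (Const d x) (pc, R, mem) = (Suc pc, R(d := x mod 2 ^ w), mem)"
| "exec w (Add d a b) (pc, R, mem) = (Suc pc, R(d := (R a + R b) mod 2 ^ w), mem)"
| "exec w (Sub d a b) (pc, R, mem) = (Suc pc, R(d := R a - R b), mem)"
| "exec w (Mul d a b) (pc, R, mem) = (Suc pc, R(d := (R a * R b) mod 2 ^ w), mem)"
| "exec w (Div d a b) (pc, R, mem) = (Suc pc, R(d := R a div R b), mem)"
| "exec w (Load d a) (pc, R, mem) = (Suc pc, R(d := mem (R a)), mem)"
| "exec w (Store a s) (pc, R, mem) = (Suc pc, R, mem(R a := R s))"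
| "exec w (Jump l) (pc, R, mem) = (l, R, mem)"
| "exec w (JumpZero a l) (pc, R, mem) = (if R a = 0 then l else Suc pc, R, mem)"

definition halted :: "instr list \<Rightarrow> config \<Rightarrow> bool" where
  "halted P cf \<longleftrightarrow> fst cf \<ge> length P"

definition step :: "nat \<Rightarrow> instr list \<Rightarrow> config \<Rightarrow> config" where
  "step w P cf = (if halted P cf then cf else exec w (P ! fst cf) cf)"

text \<open>
  The input occupies the memory cells from address 0 on and its length is in register 0; everything
  else is 0. The answer is read from register 0 (1 for yes, 0 for no).
\<close>

definition initial_config :: "nat list \<Rightarrow> config" where
  "initial_config xs =
     (0, (\<lambda>_. 0)(0 := length xs), (\<lambda>i. if i < length xs then xs ! i else 0))"

definition answers_within :: "nat \<Rightarrow> instr list \<Rightarrow> nat list \<Rightarrow> nat \<Rightarrow> bool \<Rightarrow> bool" where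
  "answers_within w P xs t b \<longleftrightarrow>
     (let cf = (step w P ^^ t) (initial_config xs)
      in halted P cf \<and> fst (snd cf) 0 = (if b then 1 else 0))"

text \<open>
  The problem with yes-instances \<open>yes\<close>, restricted to the inputs in \<open>A\<close>, is solvable in time
  \<open>O(T)\<close>: one program, independent of the word size, answers every encoding of every input
  within \<open>c * T\<close> steps, as soon as words have at least \<open>k * log 2 N\<close> bits, where \<open>N\<close> is the
  number of input words plus the largest input word. The constants \<open>c\<close> and \<open>k\<close> depend on the
  program only, so words of logarithmic length must suffice.
\<close>

definition solvable_in_time ::
    "('i \<Rightarrow> nat list \<Rightarrow> bool) \<Rightarrow> 'i set \<Rightarrow> ('i \<Rightarrow> bool) \<Rightarrow> ('i \<Rightarrow> real) \<Rightarrow> bool" where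
  "solvable_in_time encodes A yes T \<longleftrightarrow>
     (\<exists>(P :: instr list) (c :: real) (k :: nat). \<forall>I\<in>A. \<forall>xs w.
        encodes I xs \<longrightarrow> (length xs + Max (set xs)) ^ k \<le> 2 ^ w \<longrightarrow>
        (\<exists>t. real t \<le> c * T I \<and> answers_within w P xs t (yes I)))"


section \<open>Encoding of instances\<close>

text \<open>
  Vertices and colors are numbered from 0. The input consists of \<open>|V|\<close>, \<open>|E|\<close>, \<open>|C|\<close>, \<open>|M|\<close>,
  followed by the end points of the edges (each undirected edge once, in either direction and in
  any order), the colors of the vertices \<open>0, \<dots>, |V| - 1\<close>, and the elements of \<open>M\<close> in any order.
\<close>

definition encodes_motif_instance :: "(nat, nat) motif_instance \<Rightarrow> nat list \<Rightarrow> bool" where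
  "encodes_motif_instance I xs \<longleftrightarrow>
     (\<exists>n q es ms. pverts (mgraph I) = {..<n} \<and> palette I = {..<q} \<and>
        distinct es \<and> set es \<inter> (set es)\<inverse> = {} \<and> parcs (mgraph I) = set es \<union> (set es)\<inverse> \<and>
        distinct ms \<and> set ms = motif I \<and>
        xs = [n, length es, q, length ms] @ concat (map (\<lambda>(u, v). [u, v]) es)
               @ map (coloring I) [0..<n] @ ms)"

end

theory Submission
  imports Defs
begin

text \<open>
  Root the tree at a vertex that belongs to the solution: at the vertex of a motif color that occurs only
  once, or else, one after the other, at the vertices of one motif color. A solution is then a set of
  vertices that contains the root and is closed under parents. All ancestors of vertices whose motif color
  is unique belong to it; contracting them into the root and deleting the vertices with colors used up
  leaves at most \<open>2 l\<close> vertices, where \<open>l = |V| - |M|\<close>, because every other motif color occurs twice.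

  If a color of such a contracted instance is unique, the child of the root above its vertex is taken.
  Otherwise branch on a child \<open>v\<close> of the root that is not a leaf. Dropping \<open>v\<close> deletes \<open>v\<close> and its
  descendants and decreases \<open>l\<close> by at least 2. Taking \<open>v\<close> deletes the other vertices with the color of \<open>v\<close>
  and their descendants; it decreases \<open>l\<close> by at least 2 as well, unless only a single leaf is deleted, and in
  this case \<open>v\<close> may be taken without branching. Since no color is unique when the search branches, the size
  of the instance is at most \<open>2 l\<close>, so that the recurrence \<open>T(l) = 2 T(l - 2) + O(l\<^sup>2)\<close> gives
  \<open>O(sqrt 2 ^ l)\<close> without polynomial factors. With \<open>u\<close> roots of the same color \<open>l\<close> is smaller by \<open>u - 1\<close>, and
  \<open>u / sqrt 2 ^ (u - 1)\<close> is bounded.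
\<close>


section \<open>A while language with arrays\<close>

text \<open>The bound allows neither a polynomial factor next to \<open>sqrt 2 ^ l\<close> nor more
  than linear work in \<open>n\<close> elsewhere, and this shapes the program. The palette is not
  bounded in terms of \<open>n\<close>, so arrays indexed by colors are never cleared as a whole;
  invariants record which cells may be trusted. Recursion becomes a stack of explicit contracted
  instances, each a frame of \<open>n + 1\<close> cells. Several roots are prepared only if no motif
  color is unique; then \<open>2 |M| <= n\<close>, hence \<open>n <= 2 l\<close>, and the quadratic
  cost of preparing them is polynomial in \<open>l\<close> and vanishes in
  \<open>sqrt 2 ^ l\<close>. With a unique color there is a single preparation of linear cost. If
  \<open>|M| > n\<close>, the answer has to be given without reading \<open>M\<close>. The machine
  is kept apart from all this: a while language with exact arithmetic below a bound \<open>B\<close>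
  is compiled with a constant loss of time. Taking for \<open>B\<close> the cube of the input length
  plus the largest input word leaves room for all indices of the stack, and words of logarithmic
  length suffice for the addresses.\<close>

datatype exp =
    Cn nat
  | Vr nat
  | In exp
  | Ld nat exp
  | Plus exp exp
  | Minus exp exp
  | Times exp exp
  | Ne exp exp

datatype com =
    Skip
  | Assign nat exp  (\<open>_ ::= _\<close> [1000, 61] 61)
  | Put nat exp exp
  | Seq com com  (infixr \<open>;;\<close> 60)
  | Cond exp com com
  | Loop exp com

text \<open>The absolute difference: one of the two truncated subtractions is 0. As the value of
  \<open>Ne\<close> it is nonzero exactly on different operands, and it compiles to arithmetic
  without a comparison instruction.\<close>

definition tdist :: "nat \<Rightarrow> nat \<Rightarrow> nat" where
  "tdist x y = (x - y) + (y - x)"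

lemma tdist_eq_0 [simp]: "tdist x y = 0 \<longleftrightarrow> x = y"
  by (auto simp: tdist_def)

lemma tdist_pos [simp]: "0 < tdist x y \<longleftrightarrow> x \<noteq> y"
  by (auto simp: tdist_def)

type_synonym vars = "nat \<Rightarrow> nat"
type_synonym arrs = "nat \<Rightarrow> nat \<Rightarrow> nat"

text \<open>
  The number \<open>B\<close> bounds constants, indices, sums and products. Under this proviso the exact
  arithmetic used here agrees with the modular one of the machine.
\<close>

locale machine =
  fixes xs :: "nat list" and B :: nat
begin

fun val :: "exp \<Rightarrow> vars \<Rightarrow> arrs \<Rightarrow> nat" where
  "val (Cn n) v a = n"
| "val (Vr x) v a = v x"
| "val (In e) v a = xs ! val e v a"
| "val (Ld r e) v a = a r (val e v a)"
| "val (Plus e f) v a = val e v a + val f v a"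
| "val (Minus e f) v a = val e v a - val f v a"
| "val (Times e f) v a = val e v a * val f v a"
| "val (Ne e f) v a = tdist (val e v a) (val f v a)"

fun ok :: "exp \<Rightarrow> vars \<Rightarrow> arrs \<Rightarrow> bool" where
  "ok (Cn n) v a \<longleftrightarrow> n < B"
| "ok (Vr x) v a \<longleftrightarrow> True"
| "ok (In e) v a \<longleftrightarrow> ok e v a \<and> val e v a < length xs"
| "ok (Ld r e) v a \<longleftrightarrow> ok e v a \<and> val e v a < B \<and> r < 32"
| "ok (Plus e f) v a \<longleftrightarrow> ok e v a \<and> ok f v a \<and> val e v a + val f v a < B"
| "ok (Minus e f) v a \<longleftrightarrow> ok e v a \<and> ok f v a"
| "ok (Times e f) v a \<longleftrightarrow> ok e v a \<and> ok f v a \<and> val e v a * val f v a < B"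
| "ok (Ne e f) v a \<longleftrightarrow> ok e v a \<and> ok f v a"

text \<open>An assignment or a test costs 1 whatever the size of its expression. The expressions are
  fixed by the program, so the compiled code is slower by a constant factor.\<close>

inductive run :: "com \<Rightarrow> vars \<Rightarrow> arrs \<Rightarrow> nat \<Rightarrow> vars \<Rightarrow> arrs \<Rightarrow> bool" where
  run_Skip: "run Skip v a 0 v a"
| run_Assign: "ok e v a \<Longrightarrow> run (x ::= e) v a (Suc 0) (v(x := val e v a)) a"
| run_Put: "ok e v a \<Longrightarrow> ok f v a \<Longrightarrow> val e v a < B \<Longrightarrow> r < 32 \<Longrightarrow>
    run (Put r e f) v a (Suc 0) v (a(r := (a r)(val e v a := val f v a)))"
| run_Seq: "run c v a t v' a' \<Longrightarrow> run d v' a' t' v'' a'' \<Longrightarrow> run (c ;; d) v a (t + t') v'' a''"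
| run_Cond1: "ok e v a \<Longrightarrow> val e v a \<noteq> 0 \<Longrightarrow> run c v a t v' a' \<Longrightarrow> run (Cond e c d) v a (Suc t) v' a'"
| run_Cond0: "ok e v a \<Longrightarrow> val e v a = 0 \<Longrightarrow> run d v a t v' a' \<Longrightarrow> run (Cond e c d) v a (Suc t) v' a'"
| run_Loop0: "ok e v a \<Longrightarrow> val e v a = 0 \<Longrightarrow> run (Loop e c) v a (Suc 0) v a"
| run_Loop1: "ok e v a \<Longrightarrow> val e v a \<noteq> 0 \<Longrightarrow> run c v a t v' a' \<Longrightarrow> run (Loop e c) v' a' t' v'' a'' \<Longrightarrow>
    run (Loop e c) v a (Suc (t + t')) v'' a''"

end


section \<open>Compilation\<close>

text \<open>
  Variable \<open>x\<close> lives in register \<open>3x\<close> and the expression stack in the registers \<open>3d + 1\<close>. Register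
  2 holds the input length \<open>L\<close>, register 5 stays 0. Cell \<open>i\<close> of array \<open>r < 32\<close> has address
  \<open>L + 32 i + r\<close>, so that the arrays do not overlap although their lengths are not fixed.
\<close>

definition caddr :: "nat \<Rightarrow> nat \<Rightarrow> instr list" where
  "caddr d r = [Const (3 * d + 4) 32, Mul (3 * d + 1) (3 * d + 1) (3 * d + 4), Const (3 * d + 4) r,
     Add (3 * d + 1) (3 * d + 1) (3 * d + 4), Add (3 * d + 1) (3 * d + 1) 2]"

fun cexp :: "nat \<Rightarrow> exp \<Rightarrow> instr list" where
  "cexp d (Cn n) = [Const (3 * d + 1) n]"
| "cexp d (Vr x) = [Add (3 * d + 1) (3 * x) 5]"
| "cexp d (In e) = cexp d e @ [Load (3 * d + 1) (3 * d + 1)]"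
| "cexp d (Ld r e) = cexp d e @ caddr d r @ [Load (3 * d + 1) (3 * d + 1)]"
| "cexp d (Plus e f) = cexp d e @ cexp (Suc d) f @ [Add (3 * d + 1) (3 * d + 1) (3 * d + 4)]"
| "cexp d (Minus e f) = cexp d e @ cexp (Suc d) f @ [Sub (3 * d + 1) (3 * d + 1) (3 * d + 4)]"
| "cexp d (Times e f) = cexp d e @ cexp (Suc d) f @ [Mul (3 * d + 1) (3 * d + 1) (3 * d + 4)]"
| "cexp d (Ne e f) = cexp d e @ cexp (Suc d) f @
     [Sub (3 * d + 7) (3 * d + 1) (3 * d + 4), Sub (3 * d + 4) (3 * d + 4) (3 * d + 1),
      Add (3 * d + 1) (3 * d + 7) (3 * d + 4)]"

text \<open>The argument \<open>l\<close> is the address at which the code is going to start; it is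
  needed because jumps are absolute.\<close>

fun ccom :: "nat \<Rightarrow> com \<Rightarrow> instr list" where
  "ccom l Skip = []"
| "ccom l (x ::= e) = cexp 0 e @ [Add (3 * x) 1 5]"
| "ccom l (Put r e f) = cexp 0 e @ caddr 0 r @ cexp 1 f @ [Store 1 4]"
| "ccom l (c ;; d) = ccom l c @ ccom (l + length (ccom l c)) d"
| "ccom l (Cond e c d) =
     (let l1 = l + length (cexp 0 e) + 1; cc = ccom l1 c; l2 = l1 + length cc + 1; cd = ccom l2 d
      in cexp 0 e @ [JumpZero 1 l2] @ cc @ [Jump (l2 + length cd)] @ cd)"
| "ccom l (Loop e c) =
     (let l1 = l + length (cexp 0 e) + 1; cc = ccom l1 c
      in cexp 0 e @ [JumpZero 1 (l1 + length cc + 1)] @ cc @ [Jump l])"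

text \<open>Register 0 is variable 0, which receives the answer; the extra instruction saves the
  input length to register 2 before that happens.\<close>

definition program :: "com \<Rightarrow> instr list" where
  "program c = Add 2 0 5 # ccom 1 c"

definition code_at :: "instr list \<Rightarrow> nat \<Rightarrow> instr list \<Rightarrow> bool" where
  "code_at P l cs \<longleftrightarrow> (\<exists>us vs. P = us @ cs @ vs \<and> length us = l)"

section \<open>Placement of code in a program and execution with a step count\<close>

lemma code_at_append:
  "code_at P l (cs @ ds) \<longleftrightarrow> code_at P l cs \<and> code_at P (l + length cs) ds" (is "?A \<longleftrightarrow> ?B")
proof
  assume ?A
  then obtain us vs where "P = us @ cs @ ds @ vs" "length us = l" by (auto simp: code_at_def)
  then have "P = us @ cs @ (ds @ vs) \<and> length us = l"
    "P = (us @ cs) @ ds @ vs \<and> length (us @ cs) = l + length cs" by auto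
  then show ?B unfolding code_at_def by blast
next
  assume ?B
  then obtain us vs us' vs' where *: "P = us @ cs @ vs" "length us = l"
    "P = us' @ ds @ vs'" "length us' = l + length cs" unfolding code_at_def by blast
  then have "us' = us @ cs"
    by (metis append.assoc append_eq_append_conv length_append)
  with * show ?A by (auto simp: code_at_def)
qed

lemma code_at_Cons: "code_at P l (c # cs) \<longleftrightarrow> l < length P \<and> P ! l = c \<and> code_at P (Suc l) cs"
proof -
  have "code_at P l [c]" if "l < length P" "P ! l = c"
  proof -
    have "P = take l P @ [c] @ drop (Suc l) P" "length (take l P) = l"
      using that id_take_nth_drop[of l P] by simp_all
    then show ?thesis unfolding code_at_def by blast
  qed
  moreover have "l < length P \<and> P ! l = c" if "code_at P l [c]"
    using that by (auto simp: code_at_def nth_append)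
  ultimately have "code_at P l [c] \<longleftrightarrow> l < length P \<and> P ! l = c" by blast
  then show ?thesis using code_at_append[of P l "[c]" cs] by simp
qed

lemma code_at_Nil: "code_at P l [] \<longleftrightarrow> l \<le> length P"
proof
  assume "l \<le> length P"
  then have "P = take l P @ [] @ drop l P" "length (take l P) = l" by simp_all
  then show "code_at P l []" unfolding code_at_def by blast
qed (auto simp: code_at_def)

lemmas code_at_simps = code_at_append code_at_Cons code_at_Nil

definition reach :: "nat \<Rightarrow> instr list \<Rightarrow> config \<Rightarrow> nat \<Rightarrow> config \<Rightarrow> bool" where
  "reach w P s t s' \<longleftrightarrow> (step w P ^^ t) s = s'"

lemma reach_0 [simp]: "reach w P s 0 s' \<longleftrightarrow> s = s'"
  by (simp add: reach_def)

lemma reach_Suc: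
  "pc < length P \<Longrightarrow>
   reach w P (pc, R, mem) (Suc t) s' \<longleftrightarrow> reach w P (exec w (P ! pc) (pc, R, mem)) t s'"
  by (simp add: reach_def funpow_swap1 step_def halted_def)

lemma reach_trans: "reach w P s t s' \<Longrightarrow> reach w P s' t' s'' \<Longrightarrow> reach w P s (t + t') s''"
  by (simp add: reach_def add.commute[of t t'] funpow_add)

lemma reach_snoc:
  "reach w P s t (pc, R, mem) \<Longrightarrow> pc < length P \<Longrightarrow> reach w P (exec w (P ! pc) (pc, R, mem)) t' s'
   \<Longrightarrow> reach w P s (t + Suc t') s'"
  using reach_trans reach_Suc by blast

lemma address_inj:
  fixes r r' :: nat
  assumes "r' < 32" "r < 32" "32 * j + r' = 32 * i + r"
  shows "j = i \<and> r' = r"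
proof -
  have "(32 * j + r') div 32 = j" "(32 * i + r) div 32 = i" using assms(1,2) by simp_all
  then show ?thesis using assms(3) by auto
qed

text \<open>The last array cell has address \<open>length xs + 32 * (B - 1) + 31\<close>. The
  remaining slack covers the constant 32 that the address computation loads.\<close>

locale compiled = machine +
  fixes w :: nat
  assumes input_bound: "\<And>x. x \<in> set xs \<Longrightarrow> x < 2 ^ w"
    and address_bound: "length xs + 32 * B + 32 < 2 ^ w"
begin

definition sim_regs :: "vars \<Rightarrow> (nat \<Rightarrow> nat) \<Rightarrow> bool" where
  "sim_regs v R \<longleftrightarrow> (\<forall>x. R (3 * x) = v x \<and> v x < 2 ^ w) \<and> R 2 = length xs \<and> R 5 = 0"

definition sim_mem :: "arrs \<Rightarrow> (nat \<Rightarrow> nat) \<Rightarrow> bool" where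
  "sim_mem a mem \<longleftrightarrow> (\<forall>i<length xs. mem i = xs ! i) \<and>
     (\<forall>r<32. \<forall>i<B. mem (length xs + 32 * i + r) = a r i \<and> a r i < 2 ^ w)"

text \<open>Variables occupy the registers divisible by 3, the two special registers are 2 modulo 3,
  and the expression stack is 1 modulo 3; so no change on the stack is visible.\<close>

lemma sim_regs_agree:
  assumes "sim_regs v R" "\<And>r. (\<forall>j\<ge>d. r \<noteq> 3 * j + 1) \<Longrightarrow> R' r = R r"
  shows "sim_regs v R'"
proof -
  have "R' (3 * x) = R (3 * x)" for x by (rule assms(2)) presburger
  moreover have "R' 2 = R 2" "R' 5 = R 5" by (rule assms(2); presburger)+
  ultimately show ?thesis using assms(1) by (simp add: sim_regs_def)
qed

text \<open>A value need not be below \<open>B\<close>, because an input word may fill a whole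
  machine word. Below \<open>2 ^ w\<close> is what a register can hold; \<open>B\<close> limits
  constants, indices, sums and products.\<close>

lemma val_less: "ok e v a \<Longrightarrow> sim_regs v R \<Longrightarrow> sim_mem a mem \<Longrightarrow> val e v a < 2 ^ w"
proof (induction e)
  case (In e)
  then show ?case by (auto intro!: input_bound)
next
  case (Ld r e)
  then show ?case by (auto simp: sim_mem_def)
next
  case (Ne e f)
  have "tdist x y < k" if "x < k" "y < k" for x y k :: nat using that by (auto simp: tdist_def)
  with Ne show ?case by simp
qed (use address_bound in \<open>auto simp: sim_regs_def less_imp_diff_less\<close>)

lemma caddr_reach:
  assumes "code_at P pc (caddr d r)" "R (3 * d + 1) < B" "r < 32" "R 2 = length xs"
  shows "\<exists>R'. reach w P (pc, R, mem) (length (caddr d r)) (pc + length (caddr d r), R', mem) \<and>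
    R' (3 * d + 1) = length xs + 32 * R (3 * d + 1) + r \<and>
    (\<forall>s. (\<forall>j\<ge>d. s \<noteq> 3 * j + 1) \<longrightarrow> R' s = R s)"
proof -
  let ?x = "3 * d + 1" and ?y = "3 * d + 4"
  have bound: "R ?x * 32 < 2 ^ w" "R ?x * 32 + r < 2 ^ w" "R ?x * 32 + r + length xs < 2 ^ w"
    "32 < (2::nat) ^ w" "r < 2 ^ w"
    using address_bound assms(2,3) by linarith+
  have ne: "?x \<noteq> ?y" "?x \<noteq> 2" "?y \<noteq> 2" by presburger+
  define R' where "R' = R(?y := 32, ?x := R ?x * 32, ?y := r, ?x := R ?x * 32 + r,
    ?x := R ?x * 32 + r + length xs)"
  have "reach w P (pc, R, mem) (length (caddr d r)) (pc + length (caddr d r), R', mem)"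
    using assms(1,4) bound ne by (simp add: caddr_def code_at_simps reach_Suc R'_def)
  moreover have "R' ?x = length xs + 32 * R ?x + r" by (simp add: R'_def)
  moreover have "R' s = R s" if "\<forall>j\<ge>d. s \<noteq> 3 * j + 1" for s
    using that[rule_format, of d] that[rule_format, of "Suc d"] by (auto simp: R'_def)
  ultimately show ?thesis by blast
qed

text \<open>The frame condition is what makes the induction work: evaluation at depth
  \<open>d\<close> leaves the stack registers below \<open>d\<close> alone, so a left operand
  survives the evaluation of the right one.\<close>

lemma cexp_reach:
  assumes "ok e v a" "sim_regs v R" "sim_mem a mem" "code_at P pc (cexp d e)"
  shows "\<exists>R'. reach w P (pc, R, mem) (length (cexp d e)) (pc + length (cexp d e), R', mem) \<and>
    R' (3 * d + 1) = val e v a \<and> (\<forall>s. (\<forall>j\<ge>d. s \<noteq> 3 * j + 1) \<longrightarrow> R' s = R s)"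
  using assms
proof (induction e arbitrary: d pc R)
  case (Cn n)
  then show ?case using address_bound
    by (intro exI[of _ "R(3 * d + 1 := n)"]) (auto simp: code_at_simps reach_Suc)
next
  case (Vr x)
  then show ?case
    by (intro exI[of _ "R(3 * d + 1 := v x)"]) (auto simp: code_at_simps reach_Suc sim_regs_def)
next
  case (In e)
  obtain R1 where R1: "reach w P (pc, R, mem) (length (cexp d e)) (pc + length (cexp d e), R1, mem)"
    "R1 (3 * d + 1) = val e v a" "\<forall>s. (\<forall>j\<ge>d. s \<noteq> 3 * j + 1) \<longrightarrow> R1 s = R s"
    using In.IH[of R pc d] In.prems by (auto simp: code_at_simps)
  from reach_snoc[OF R1(1), of 0 "(pc + length (cexp d e) + 1, R1(3 * d + 1 := xs ! val e v a), mem)"]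
  show ?case using In.prems R1
    by (intro exI[of _ "R1(3 * d + 1 := xs ! val e v a)"]) (auto simp: code_at_simps sim_mem_def fun_upd_def)
next
  case (Ld r e)
  obtain R1 where R1: "reach w P (pc, R, mem) (length (cexp d e)) (pc + length (cexp d e), R1, mem)"
    "R1 (3 * d + 1) = val e v a" "\<forall>s. (\<forall>j\<ge>d. s \<noteq> 3 * j + 1) \<longrightarrow> R1 s = R s"
    using Ld.IH[of R pc d] Ld.prems by (auto simp: code_at_simps)
  have s1: "sim_regs v R1" using sim_regs_agree[OF Ld.prems(2)] R1(3) by blast
  obtain R2 where R2: "reach w P (pc + length (cexp d e), R1, mem) (length (caddr d r))
      (pc + length (cexp d e) + length (caddr d r), R2, mem)"
    "R2 (3 * d + 1) = length xs + 32 * val e v a + r"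
    "\<forall>s. (\<forall>j\<ge>d. s \<noteq> 3 * j + 1) \<longrightarrow> R2 s = R1 s"
    using caddr_reach[of P "pc + length (cexp d e)" d r R1 mem] Ld.prems R1 s1
    by (auto simp: code_at_simps sim_regs_def)
  let ?R = "R2(3 * d + 1 := a r (val e v a))"
  from reach_snoc[OF reach_trans[OF R1(1) R2(1)], of 0
      "(pc + length (cexp d e) + length (caddr d r) + 1, ?R, mem)"]
  show ?case using Ld.prems R1 R2
    by (intro exI[of _ ?R]) (auto simp: code_at_simps sim_mem_def add.assoc fun_upd_def)
next
  case (Plus e f)
  obtain R1 where R1: "reach w P (pc, R, mem) (length (cexp d e)) (pc + length (cexp d e), R1, mem)"
    "R1 (3 * d + 1) = val e v a" "\<forall>s. (\<forall>j\<ge>d. s \<noteq> 3 * j + 1) \<longrightarrow> R1 s = R s"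
    using Plus.IH(1)[of R pc d] Plus.prems by (auto simp: code_at_simps)
  have s1: "sim_regs v R1" using sim_regs_agree[OF Plus.prems(2)] R1(3) by blast
  obtain R2 where R2: "reach w P (pc + length (cexp d e), R1, mem) (length (cexp (Suc d) f))
      (pc + length (cexp d e) + length (cexp (Suc d) f), R2, mem)"
    "R2 (3 * d + 4) = val f v a" "\<forall>s. (\<forall>j\<ge>Suc d. s \<noteq> 3 * j + 1) \<longrightarrow> R2 s = R1 s"
    using Plus.IH(2)[of R1 "pc + length (cexp d e)" "Suc d"] Plus.prems s1
    by (auto simp: code_at_simps add.commute[of 4])
  have "R2 (3 * d + 1) = val e v a" using R1(2) R2(3) by auto
  moreover have "val e v a + val f v a < 2 ^ w" using Plus.prems address_bound by auto
  moreover have "R2 s = R s" if "\<forall>j\<ge>d. s \<noteq> 3 * j + 1" for s using R1(3) R2(3) that by auto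
  moreover let ?R = "R2(3 * d + 1 := val e v a + val f v a)"
  note reach_snoc[OF reach_trans[OF R1(1) R2(1)], of 0
      "(pc + length (cexp d e) + length (cexp (Suc d) f) + 1, ?R, mem)"]
  ultimately show ?case using Plus.prems R2(2)
    by (intro exI[of _ ?R]) (auto simp: code_at_simps add.assoc fun_upd_def)
next
  case (Minus e f)
  obtain R1 where R1: "reach w P (pc, R, mem) (length (cexp d e)) (pc + length (cexp d e), R1, mem)"
    "R1 (3 * d + 1) = val e v a" "\<forall>s. (\<forall>j\<ge>d. s \<noteq> 3 * j + 1) \<longrightarrow> R1 s = R s"
    using Minus.IH(1)[of R pc d] Minus.prems by (auto simp: code_at_simps)
  have s1: "sim_regs v R1" using sim_regs_agree[OF Minus.prems(2)] R1(3) by blast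
  obtain R2 where R2: "reach w P (pc + length (cexp d e), R1, mem) (length (cexp (Suc d) f))
      (pc + length (cexp d e) + length (cexp (Suc d) f), R2, mem)"
    "R2 (3 * d + 4) = val f v a" "\<forall>s. (\<forall>j\<ge>Suc d. s \<noteq> 3 * j + 1) \<longrightarrow> R2 s = R1 s"
    using Minus.IH(2)[of R1 "pc + length (cexp d e)" "Suc d"] Minus.prems s1
    by (auto simp: code_at_simps add.commute[of 4])
  have "R2 (3 * d + 1) = val e v a" using R1(2) R2(3) by auto
  moreover have "R2 s = R s" if "\<forall>j\<ge>d. s \<noteq> 3 * j + 1" for s using R1(3) R2(3) that by auto
  moreover let ?R = "R2(3 * d + 1 := val e v a - val f v a)"
  note reach_snoc[OF reach_trans[OF R1(1) R2(1)], of 0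
      "(pc + length (cexp d e) + length (cexp (Suc d) f) + 1, ?R, mem)"]
  ultimately show ?case using Minus.prems R2(2)
    by (intro exI[of _ ?R]) (auto simp: code_at_simps add.assoc fun_upd_def)
next
  case (Times e f)
  obtain R1 where R1: "reach w P (pc, R, mem) (length (cexp d e)) (pc + length (cexp d e), R1, mem)"
    "R1 (3 * d + 1) = val e v a" "\<forall>s. (\<forall>j\<ge>d. s \<noteq> 3 * j + 1) \<longrightarrow> R1 s = R s"
    using Times.IH(1)[of R pc d] Times.prems by (auto simp: code_at_simps)
  have s1: "sim_regs v R1" using sim_regs_agree[OF Times.prems(2)] R1(3) by blast
  obtain R2 where R2: "reach w P (pc + length (cexp d e), R1, mem) (length (cexp (Suc d) f))
      (pc + length (cexp d e) + length (cexp (Suc d) f), R2, mem)"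
    "R2 (3 * d + 4) = val f v a" "\<forall>s. (\<forall>j\<ge>Suc d. s \<noteq> 3 * j + 1) \<longrightarrow> R2 s = R1 s"
    using Times.IH(2)[of R1 "pc + length (cexp d e)" "Suc d"] Times.prems s1
    by (auto simp: code_at_simps add.commute[of 4])
  have "R2 (3 * d + 1) = val e v a" using R1(2) R2(3) by auto
  moreover have "val e v a * val f v a < 2 ^ w" using Times.prems address_bound by auto
  moreover have "R2 s = R s" if "\<forall>j\<ge>d. s \<noteq> 3 * j + 1" for s using R1(3) R2(3) that by auto
  moreover let ?R = "R2(3 * d + 1 := val e v a * val f v a)"
  note reach_snoc[OF reach_trans[OF R1(1) R2(1)], of 0
      "(pc + length (cexp d e) + length (cexp (Suc d) f) + 1, ?R, mem)"]
  ultimately show ?case using Times.prems R2(2)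
    by (intro exI[of _ ?R]) (auto simp: code_at_simps add.assoc fun_upd_def)
next
  case (Ne e f)
  obtain R1 where R1: "reach w P (pc, R, mem) (length (cexp d e)) (pc + length (cexp d e), R1, mem)"
    "R1 (3 * d + 1) = val e v a" "\<forall>s. (\<forall>j\<ge>d. s \<noteq> 3 * j + 1) \<longrightarrow> R1 s = R s"
    using Ne.IH(1)[of R pc d] Ne.prems by (auto simp: code_at_simps)
  have s1: "sim_regs v R1" using sim_regs_agree[OF Ne.prems(2)] R1(3) by blast
  obtain R2 where R2: "reach w P (pc + length (cexp d e), R1, mem) (length (cexp (Suc d) f))
      (pc + length (cexp d e) + length (cexp (Suc d) f), R2, mem)"
    "R2 (3 * d + 4) = val f v a" "\<forall>s. (\<forall>j\<ge>Suc d. s \<noteq> 3 * j + 1) \<longrightarrow> R2 s = R1 s"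
    using Ne.IH(2)[of R1 "pc + length (cexp d e)" "Suc d"] Ne.prems s1
    by (auto simp: code_at_simps add.commute[of 4])
  have x: "R2 (3 * d + 1) = val e v a" using R1(2) R2(3) by auto
  let ?x = "val e v a" and ?y = "val f v a"
  \<comment> \<open>A third stack register serves as scratch space: both differences need the two
    operands, and the second difference overwrites one of them.\<close>
  define R' where "R' = R2(3 * d + 7 := ?x - ?y, 3 * d + 4 := ?y - ?x, 3 * d + 1 := ?x - ?y + (?y - ?x))"
  have "?x - ?y + (?y - ?x) < 2 ^ w" using val_less[OF Ne.prems(1-3)] by (simp add: tdist_def)
  then have "reach w P (pc + length (cexp d e) + length (cexp (Suc d) f), R2, mem) (Suc (Suc (Suc 0)))
      (pc + length (cexp (d) (Ne e f)), R', mem)"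
    using Ne.prems(4) x R2(2) by (simp add: code_at_simps reach_Suc R'_def add.assoc)
  from reach_trans[OF reach_trans[OF R1(1) R2(1)] this]
  have "reach w P (pc, R, mem) (length (cexp d (Ne e f))) (pc + length (cexp d (Ne e f)), R', mem)"
    by (simp add: add.assoc)
  moreover have "R' s = R s" if s: "\<forall>j\<ge>d. s \<noteq> 3 * j + 1" for s
    using R1(3) R2(3) s s[rule_format, of d] s[rule_format, of "Suc d"] s[rule_format, of "Suc (Suc d)"]
    by (auto simp: R'_def)
  moreover have "R' (3 * d + 1) = val (Ne e f) v a" by (simp add: R'_def tdist_def)
  ultimately show ?case by blast
qed

text \<open>Each unit of time in \<open>run\<close> is charged \<open>K\<close> machine steps.
  Between two charges control passes at most once through the code of the command, so any bound
  \<open>K\<close> on the code length will do; in a loop every iteration brings its own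
  unit.\<close>

lemma ccom_reach:
  assumes "run c v a t v' a'" "sim_regs v R" "sim_mem a mem" "code_at P pc (ccom pc c)"
    "length (ccom pc c) \<le> K"
  shows "\<exists>t' R' mem'. t' \<le> K * t \<and> reach w P (pc, R, mem) t' (pc + length (ccom pc c), R', mem') \<and>
    sim_regs v' R' \<and> sim_mem a' mem'"
  using assms
proof (induction arbitrary: pc R mem rule: run.induct)
  case (run_Skip v a)
  then show ?case by (auto intro!: exI[of _ 0])
next
  case (run_Assign e v a x)
  obtain R1 where R1: "reach w P (pc, R, mem) (length (cexp 0 e)) (pc + length (cexp 0 e), R1, mem)"
    "R1 1 = val e v a" "\<forall>s. (\<forall>j\<ge>0. s \<noteq> 3 * j + 1) \<longrightarrow> R1 s = R s"
    using cexp_reach[OF run_Assign.hyps run_Assign.prems(1,2), of P pc 0] run_Assign.prems(3)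
    by (auto simp: code_at_simps)
  have s1: "sim_regs v R1" using sim_regs_agree[OF run_Assign.prems(1)] R1(3) by blast
  have less: "val e v a < 2 ^ w" using val_less[OF run_Assign.hyps run_Assign.prems(1,2)] .
  let ?R = "R1(3 * x := val e v a)"
  have "3 * x \<noteq> 2" "3 * x \<noteq> 5" by presburger+
  then have s2: "sim_regs (v(x := val e v a)) ?R" using s1 less by (simp add: sim_regs_def)
  have "reach w P (pc, R, mem) (length (ccom pc (x ::= e))) (pc + length (ccom pc (x ::= e)), ?R, mem)"
    using reach_snoc[OF R1(1), of 0 "(pc + length (cexp 0 e) + 1, ?R, mem)"] run_Assign.prems(3)
      R1(2) s1 less by (simp add: code_at_simps sim_regs_def)
  with s2 run_Assign.prems show ?case by (intro exI conjI) (assumption | simp)+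
next
  case (run_Put e v a f r)
  let ?i = "val e v a" and ?x = "val f v a"
  obtain R1 where R1: "reach w P (pc, R, mem) (length (cexp 0 e)) (pc + length (cexp 0 e), R1, mem)"
    "R1 1 = ?i" "\<forall>s. (\<forall>j\<ge>0. s \<noteq> 3 * j + 1) \<longrightarrow> R1 s = R s"
    using cexp_reach[OF run_Put.hyps(1) run_Put.prems(1,2), of P pc 0] run_Put.prems(3)
    by (auto simp: code_at_simps)
  have s1: "sim_regs v R1" using sim_regs_agree[OF run_Put.prems(1)] R1(3) by blast
  obtain R2 where R2: "reach w P (pc + length (cexp 0 e), R1, mem) (length (caddr 0 r))
      (pc + length (cexp 0 e) + length (caddr 0 r), R2, mem)"
    "R2 1 = length xs + 32 * ?i + r" "\<forall>s. (\<forall>j\<ge>0. s \<noteq> 3 * j + 1) \<longrightarrow> R2 s = R1 s"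
    using caddr_reach[of P "pc + length (cexp 0 e)" 0 r R1 mem] run_Put.hyps run_Put.prems R1 s1
    by (auto simp: code_at_simps sim_regs_def)
  have s2: "sim_regs v R2" using sim_regs_agree[OF s1] R2(3) by blast
  obtain R3 where R3: "reach w P (pc + length (cexp 0 e) + length (caddr 0 r), R2, mem)
      (length (cexp 1 f)) (pc + length (cexp 0 e) + length (caddr 0 r) + length (cexp 1 f), R3, mem)"
    "R3 4 = ?x" "\<forall>s. (\<forall>j\<ge>1. s \<noteq> 3 * j + 1) \<longrightarrow> R3 s = R2 s"
    using cexp_reach[OF run_Put.hyps(2) s2 run_Put.prems(2),
        of P "pc + length (cexp 0 e) + length (caddr 0 r)" 1] run_Put.prems(3)
    by (auto simp: code_at_simps add.assoc)
  have s3: "sim_regs v R3" using sim_regs_agree[OF s2] R3(3) by blast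
  have addr: "R3 1 = length xs + 32 * ?i + r" using R2(2) R3(3) by auto
  let ?mem = "mem(length xs + 32 * ?i + r := ?x)"
  have "?x < 2 ^ w" using val_less[OF run_Put.hyps(2) run_Put.prems(1,2)] .
  moreover have "length xs + 32 * j + r' = length xs + 32 * ?i + r \<longleftrightarrow> j = ?i \<and> r' = r"
    if "r' < 32" for j r' using address_inj[OF that run_Put.hyps(4), of j ?i] by auto
  ultimately have "sim_mem (a(r := (a r)(?i := ?x))) ?mem"
    using run_Put.prems(2) run_Put.hyps by (auto simp: sim_mem_def)
  moreover have "reach w P (pc, R, mem) (length (ccom pc (Put r e f))) (pc + length (ccom pc (Put r e f)), R3, ?mem)"
    using reach_snoc[OF reach_trans[OF reach_trans[OF R1(1) R2(1)] R3(1)], of 0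
        "(pc + length (cexp 0 e) + length (caddr 0 r) + length (cexp 1 f) + 1, R3, ?mem)"]
      run_Put.prems(3) R3(2) addr by (simp add: code_at_simps add.assoc)
  ultimately show ?case using s3 run_Put.prems by (intro exI conjI) (assumption | simp)+
next
  case (run_Seq c v a t v' a' d t' v'' a'')
  let ?l = "pc + length (ccom pc c)"
  obtain t1 R1 mem1 where 1: "t1 \<le> K * t" "reach w P (pc, R, mem) t1 (?l, R1, mem1)"
    "sim_regs v' R1" "sim_mem a' mem1"
    using run_Seq.IH(1)[of R mem pc] run_Seq.prems by (auto simp: code_at_simps)
  obtain t2 R2 mem2 where 2: "t2 \<le> K * t'" "reach w P (?l, R1, mem1) t2 (?l + length (ccom ?l d), R2, mem2)"
    "sim_regs v'' R2" "sim_mem a'' mem2"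
    using run_Seq.IH(2)[of R1 mem1 ?l] 1 run_Seq.prems by (auto simp: code_at_simps)
  show ?case using 1 2 reach_trans[OF 1(2) 2(2)]
    by (intro exI[of _ "t1 + t2"] exI[of _ R2] exI[of _ mem2]) (simp add: add_mult_distrib2 add.assoc)
next
  case (run_Cond1 e v a c t v' a' d)
  let ?l = "pc + length (cexp 0 e) + 1"
  let ?l2 = "?l + length (ccom ?l c) + 1"
  obtain R1 where R1: "reach w P (pc, R, mem) (length (cexp 0 e)) (pc + length (cexp 0 e), R1, mem)"
    "R1 1 = val e v a" "\<forall>s. (\<forall>j\<ge>0. s \<noteq> 3 * j + 1) \<longrightarrow> R1 s = R s"
    using cexp_reach[OF run_Cond1.hyps(1) run_Cond1.prems(1,2), of P pc 0] run_Cond1.prems(3)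
    by (auto simp: code_at_simps Let_def)
  have s1: "sim_regs v R1" using sim_regs_agree[OF run_Cond1.prems(1)] R1(3) by blast
  have 1: "reach w P (pc, R, mem) (length (cexp 0 e) + 1) (?l, R1, mem)"
    using reach_snoc[OF R1(1), of 0] run_Cond1.prems(3) R1(2) run_Cond1.hyps(2)
    by (simp add: code_at_simps Let_def)
  obtain t2 R2 mem2 where 2: "t2 \<le> K * t" "reach w P (?l, R1, mem) t2 (?l + length (ccom ?l c), R2, mem2)"
    "sim_regs v' R2" "sim_mem a' mem2"
    using run_Cond1.IH[of R1 mem ?l] s1 run_Cond1.prems by (auto simp: code_at_simps Let_def)
  have 3: "reach w P (pc, R, mem) (length (cexp 0 e) + 1 + t2 + 1) (?l2 + length (ccom ?l2 d), R2, mem2)"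
    using reach_snoc[OF reach_trans[OF 1 2(2)], of 0] run_Cond1.prems(3)
    by (simp add: code_at_simps Let_def add.assoc)
  then show ?case using 2 run_Cond1.prems(4)
    by (intro exI[of _ "length (cexp 0 e) + 1 + t2 + 1"] exI[of _ R2] exI[of _ mem2])
      (simp add: Let_def add.assoc)
next
  case (run_Cond0 e v a d t v' a' c)
  let ?l = "pc + length (cexp 0 e) + 1"
  let ?l2 = "?l + length (ccom ?l c) + 1"
  obtain R1 where R1: "reach w P (pc, R, mem) (length (cexp 0 e)) (pc + length (cexp 0 e), R1, mem)"
    "R1 1 = val e v a" "\<forall>s. (\<forall>j\<ge>0. s \<noteq> 3 * j + 1) \<longrightarrow> R1 s = R s"
    using cexp_reach[OF run_Cond0.hyps(1) run_Cond0.prems(1,2), of P pc 0] run_Cond0.prems(3)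
    by (auto simp: code_at_simps Let_def)
  have s1: "sim_regs v R1" using sim_regs_agree[OF run_Cond0.prems(1)] R1(3) by blast
  have 1: "reach w P (pc, R, mem) (length (cexp 0 e) + 1) (?l2, R1, mem)"
    using reach_snoc[OF R1(1), of 0] run_Cond0.prems(3) R1(2) run_Cond0.hyps(2)
    by (simp add: code_at_simps Let_def)
  obtain t2 R2 mem2 where 2: "t2 \<le> K * t" "reach w P (?l2, R1, mem) t2 (?l2 + length (ccom ?l2 d), R2, mem2)"
    "sim_regs v' R2" "sim_mem a' mem2"
    using run_Cond0.IH[of R1 mem ?l2] s1 run_Cond0.prems
    by (auto simp: code_at_simps Let_def)
  show ?case using 2 reach_trans[OF 1 2(2)] run_Cond0.prems(4)
    by (intro exI[of _ "length (cexp 0 e) + 1 + t2"] exI[of _ R2] exI[of _ mem2])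
      (simp add: Let_def add.assoc)
next
  case (run_Loop0 e v a c)
  let ?l = "pc + length (cexp 0 e) + 1"
  obtain R1 where R1: "reach w P (pc, R, mem) (length (cexp 0 e)) (pc + length (cexp 0 e), R1, mem)"
    "R1 1 = val e v a" "\<forall>s. (\<forall>j\<ge>0. s \<noteq> 3 * j + 1) \<longrightarrow> R1 s = R s"
    using cexp_reach[OF run_Loop0.hyps(1) run_Loop0.prems(1,2), of P pc 0] run_Loop0.prems(3)
    by (auto simp: code_at_simps Let_def)
  have s1: "sim_regs v R1" using sim_regs_agree[OF run_Loop0.prems(1)] R1(3) by blast
  have 1: "reach w P (pc, R, mem) (length (cexp 0 e) + 1) (?l + length (ccom ?l c) + 1, R1, mem)"
    using reach_snoc[OF R1(1), of 0] run_Loop0.prems(3) R1(2) run_Loop0.hyps(2)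
    by (simp add: code_at_simps Let_def)
  then show ?case using s1 run_Loop0.prems
    by (intro exI[of _ "length (cexp 0 e) + 1"] exI[of _ R1] exI[of _ mem])
      (simp add: Let_def add.assoc)
next
  case (run_Loop1 e v a c t v' a' t' v'' a'')
  let ?l = "pc + length (cexp 0 e) + 1"
  obtain R1 where R1: "reach w P (pc, R, mem) (length (cexp 0 e)) (pc + length (cexp 0 e), R1, mem)"
    "R1 1 = val e v a" "\<forall>s. (\<forall>j\<ge>0. s \<noteq> 3 * j + 1) \<longrightarrow> R1 s = R s"
    using cexp_reach[OF run_Loop1.hyps(1) run_Loop1.prems(1,2), of P pc 0] run_Loop1.prems(3)
    by (auto simp: code_at_simps Let_def)
  have s1: "sim_regs v R1" using sim_regs_agree[OF run_Loop1.prems(1)] R1(3) by blast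
  have 1: "reach w P (pc, R, mem) (length (cexp 0 e) + 1) (?l, R1, mem)"
    using reach_snoc[OF R1(1), of 0] run_Loop1.prems(3) R1(2) run_Loop1.hyps(2)
    by (simp add: code_at_simps Let_def)
  obtain t2 R2 mem2 where 2: "t2 \<le> K * t" "reach w P (?l, R1, mem) t2 (?l + length (ccom ?l c), R2, mem2)"
    "sim_regs v' R2" "sim_mem a' mem2"
    using run_Loop1.IH(1)[of R1 mem ?l] s1 run_Loop1.prems by (auto simp: code_at_simps Let_def)
  have 3: "reach w P (pc, R, mem) (length (cexp 0 e) + 1 + t2 + 1) (pc, R2, mem2)"
    using reach_snoc[OF reach_trans[OF 1 2(2)], of 0] run_Loop1.prems(3)
    by (simp add: code_at_simps Let_def add.assoc)
  obtain t3 R3 mem3 where 4: "t3 \<le> K * t'"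
    "reach w P (pc, R2, mem2) t3 (pc + length (ccom pc (Loop e c)), R3, mem3)"
    "sim_regs v'' R3" "sim_mem a'' mem3"
    using run_Loop1.IH(2)[OF 2(3,4) run_Loop1.prems(3,4)] by blast
  have "length (cexp 0 e) + 1 + t2 + 1 + t3 \<le> K * Suc (t + t')"
    using 2(1) 4(1) run_Loop1.prems(4) by (simp add: Let_def add_mult_distrib2)
  then show ?case using reach_trans[OF 3 4(2)] 4(3,4) by blast
qed

theorem program_answers:
  assumes "run c ((\<lambda>_. 0)(0 := length xs)) (\<lambda>_ _. 0) t v a" "v 0 = (if b then 1 else 0)"
  shows "\<exists>t'\<le>length (program c) * Suc t. answers_within w (program c) xs t' b"
proof -
  let ?v = "(\<lambda>_. 0)(0 := length xs) :: vars" and ?mem = "\<lambda>i. if i < length xs then xs ! i else 0"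
  let ?R = "?v(2 := length xs)"
  have "length xs < 2 ^ w" using address_bound by linarith
  moreover have "3 * x \<noteq> 2" for x :: nat by presburger
  ultimately have "sim_regs ?v ?R" "sim_mem (\<lambda>_ _. 0) ?mem"
    by (auto simp: sim_regs_def sim_mem_def)
  moreover have "code_at (program c) 1 (ccom 1 c)"
    unfolding code_at_def program_def by (intro exI[of _ "[Add 2 0 5]"] exI[of _ "[]"]) simp
  ultimately obtain t' R' mem' where *: "t' \<le> length (program c) * t"
    "reach w (program c) (1, ?R, ?mem) t' (1 + length (ccom 1 c), R', mem')" "sim_regs v R'"
    using ccom_reach[OF assms(1), of ?R ?mem "program c" 1 "length (program c)"]
    by (auto simp: program_def)
  have "reach w (program c) (initial_config xs) 1 (1, ?R, ?mem)"
    using \<open>length xs < 2 ^ w\<close> unfolding One_nat_def initial_config_def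
    by (subst reach_Suc) (simp_all add: program_def)
  from reach_trans[OF this *(2)]
  have "(step w (program c) ^^ (1 + t')) (initial_config xs) = (1 + length (ccom 1 c), R', mem')"
    by (simp only: reach_def)
  moreover have "R' 0 = v 0" using *(3)[unfolded sim_regs_def] by (metis mult_0_right)
  ultimately have "answers_within w (program c) xs (1 + t') b"
    using assms(2) by (simp add: answers_within_def halted_def program_def)
  moreover have "1 + t' \<le> length (program c) * Suc t" using *(1) by (simp add: program_def)
  ultimately show ?thesis by blast
qed

end


section \<open>Rooted trees\<close>

lemma (in pair_graph) awalk_avoiding:
  assumes "(x, u) \<in> (parcs G \<inter> (- {v}) \<times> (- {v}))\<^sup>*" "x \<in> pverts G"
  shows "\<exists>p. awalk x p u \<and> (\<forall>e\<in>set p. fst e \<noteq> v \<and> snd e \<noteq> v)"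
  using assms
proof (induction rule: rtrancl_induct)
  case base
  then show ?case by (intro exI[of _ "[]"]) (simp add: awalk_Nil_iff)
next
  case (step y z)
  then obtain p where "awalk x p y" "\<forall>e\<in>set p. fst e \<noteq> v \<and> snd e \<noteq> v" by blast
  with step.hyps show ?case
    by (intro exI[of _ "p @ [(y, z)]"]) (auto simp: awalk_simps in_arcsD2)
qed

text \<open>The connection from \<open>x\<close> to \<open>u\<close> is shortened to a path, which
  still avoids \<open>v\<close>, and closed through \<open>v\<close>. It is nonempty because
  \<open>x\<close> and \<open>u\<close> differ, so the cycle has at least three arcs.\<close>

lemma (in pair_graph) detour_gives_cycle:
  assumes "(v, x) \<in> parcs G" "(u, v) \<in> parcs G" "x \<noteq> u"
    and "(x, u) \<in> (parcs G \<inter> (- {v}) \<times> (- {v}))\<^sup>*"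
  shows "\<exists>p. cycle p \<and> length p \<ge> 3"
proof -
  have "x \<in> pverts G" "x \<noteq> v" using assms(1) in_arcsD2 no_loops' by auto
  then obtain p where p: "awalk x p u" "\<forall>e\<in>set p. fst e \<noteq> v \<and> snd e \<noteq> v"
    using awalk_avoiding[OF assms(4)] by blast
  let ?q = "awalk_to_apath p"
  have q: "apath x ?q u" by (rule apath_awalk_to_apath[OF p(1)])
  have "set ?q \<subseteq> set p" by (rule awalk_to_apath_subset[OF p(1)])
  then have av: "v \<notin> set (awalk_verts x ?q)"
    using q p(2) \<open>x \<noteq> v\<close> by (auto simp: set_awalk_verts[of x ?q u] apath_def)
  have "?q \<noteq> []" using q assms(3) by (auto simp: apath_def awalk_simps)
  have walk: "awalk x (?q @ [(u, v)]) v"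
    using q assms(2) by (auto simp: apath_def awalk_simps in_arcsD2)
  have "awalk_verts x (?q @ [(u, v)]) = awalk_verts x ?q @ [v]"
    using awalk_verts_append[OF walk] q by (auto simp: apath_def)
  then have "cycle ((v, x) # ?q @ [(u, v)])"
    using walk assms(1) av q by (auto simp: cycle_def awalk_simps in_arcsD1 apath_def)
  moreover have "length ((v, x) # ?q @ [(u, v)]) \<ge> 3" using \<open>?q \<noteq> []\<close> by (cases ?q) auto
  ultimately show ?thesis by blast
qed

text \<open>Connectedness is strong connectedness of the symmetric closure; on a symmetric arc set
  the closure adds nothing, so reachability is a plain reflexive transitive closure.\<close>

lemma (in pair_graph) connected_induce_iff:
  assumes "S \<subseteq> pverts G"
  shows "Digraph_Component.connected (with_proj G \<restriction> S) \<longleftrightarrow>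
    S \<noteq> {} \<and> (\<forall>u\<in>S. \<forall>v\<in>S. (u, v) \<in> (parcs G \<inter> S \<times> S)\<^sup>*)"
proof -
  let ?H = "mk_symmetric (with_proj G \<restriction> S)"
  have arcs: "parcs ?H = parcs G \<inter> S \<times> S"
    by (auto simp: mk_symmetric_def induce_subgraph_def arcs_symmetric)
  have verts: "pverts ?H = S" by (simp add: mk_symmetric_def)
  interpret H: pair_wf_digraph ?H
    by unfold_locales (auto simp: arcs verts)
  have "arcs_ends (with_proj ?H) = parcs G \<inter> S \<times> S"
    using arcs by (auto simp: arcs_ends_def arc_to_ends_def)
  then show ?thesis
    unfolding Digraph_Component.connected_def strongly_connected_def
    by (auto simp: H.reachable_conv verts)
qed

text \<open>A tree given by its parent function. That there are no further edges is
  \<open>edge_par\<close>; of \<open>depth\<close> the axioms demand a strict decrease towards the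
  root, which supports inductions.\<close>

locale rooted_tree =
  fixes V :: "'v set" and E :: "('v \<times> 'v) set" and r :: 'v and par :: "'v \<Rightarrow> 'v" and depth :: "'v \<Rightarrow> nat"
  assumes finite_V: "finite V" and root_in: "r \<in> V" and E_sub: "E \<subseteq> V \<times> V" and E_sym: "sym E"
    and par_in: "\<And>v. v \<in> V \<Longrightarrow> v \<noteq> r \<Longrightarrow> par v \<in> V"
    and par_depth: "\<And>v. v \<in> V \<Longrightarrow> v \<noteq> r \<Longrightarrow> depth (par v) < depth v"
    and par_edge: "\<And>v. v \<in> V \<Longrightarrow> v \<noteq> r \<Longrightarrow> (v, par v) \<in> E"
    and edge_par: "\<And>u v. (u, v) \<in> E \<Longrightarrow> (u \<noteq> r \<and> par u = v) \<or> (v \<noteq> r \<and> par v = u)"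
begin

lemma reach_root:
  assumes "v \<in> S" "S \<subseteq> V" "\<forall>v\<in>S - {r}. par v \<in> S"
  shows "(v, r) \<in> (E \<inter> S \<times> S)\<^sup>*"
  using assms(1)
proof (induction "depth v" arbitrary: v rule: less_induct)
  case less
  show ?case
  proof (cases "v = r")
    case False
    then have "(v, par v) \<in> E \<inter> S \<times> S" using less.prems assms(2,3) par_edge by auto
    moreover have "(par v, r) \<in> (E \<inter> S \<times> S)\<^sup>*"
      using less.hyps[of "par v"] less.prems assms(2,3) False par_depth by auto
    ultimately show ?thesis by (rule converse_rtrancl_into_rtrancl)
  qed simp
qed

text \<open>From right to left, all vertices climb to the root inside \<open>S\<close>. Conversely,
  a walk inside \<open>S\<close> from \<open>v\<close> to the root could leave the subtree of
  \<open>v\<close> only along the edge to \<open>par v\<close>, which is not in \<open>S\<close>; so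
  the root would be a descendant of \<open>v\<close>.\<close>

lemma connected_iff_parent_closed:
  assumes "S \<subseteq> V" "r \<in> S"
  shows "(\<forall>u\<in>S. \<forall>v\<in>S. (u, v) \<in> (E \<inter> S \<times> S)\<^sup>*) \<longleftrightarrow> (\<forall>v\<in>S - {r}. par v \<in> S)" (is "?A \<longleftrightarrow> ?B")
proof
  assume ?B
  have "sym ((E \<inter> S \<times> S)\<^sup>*)" using E_sym by (intro sym_rtrancl) (auto simp: sym_def)
  then show ?A using reach_root[OF _ assms(1) \<open>?B\<close>] by (meson rtrancl_trans symE)
next
  assume ?A
  show ?B
  proof (rule ballI, rule ccontr)
    fix v assume v: "v \<in> S - {r}" and "par v \<notin> S"
    \<comment> \<open>the descendants of \<open>v\<close> inside \<open>S\<close> cannot be left\<close>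
    define up where "up = {(x, par x) |x. x \<in> V \<and> x \<noteq> r}"
    have "(v, r) \<in> (E \<inter> S \<times> S)\<^sup>*" using \<open>?A\<close> v assms by auto
    then have "(r, v) \<in> up\<^sup>*"
    proof (induction rule: rtrancl_induct)
      case (step y z)
      show ?case
      proof (cases "y \<noteq> r \<and> par y = z")
        case True
        have "y \<noteq> v" using True \<open>par v \<notin> S\<close> step.hyps by auto
        with step.IH True show ?thesis
          by (auto simp: up_def elim: converse_rtranclE)
      next
        case False
        then have "z \<noteq> r" "par z = y" using edge_par step.hyps by auto
        then have "(z, y) \<in> up" using step.hyps E_sub by (auto simp: up_def)
        from this step.IH show ?thesis by (rule converse_rtrancl_into_rtrancl)
      qed
    qed simp
    then show False using v by (auto simp: up_def elim: converse_rtranclE)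
  qed
qed

end

text \<open>\<open>depth\<close> is the distance from the root and \<open>par\<close> a neighbor at
  smaller distance. What has to be shown is that no other edges exist.\<close>

lemma undirected_tree_rooted:
  assumes "undirected_tree G" "r \<in> pverts G"
  obtains par depth where "rooted_tree (pverts G) (parcs G) r par depth"
proof -
  interpret pair_graph G using assms(1) by (simp add: undirected_tree_def)
  let ?E = "parcs G"
  have acyclic: "\<not> (\<exists>p. cycle p \<and> length p \<ge> 3)"
    using assms(1) by (auto simp: undirected_tree_def)
  have ind: "with_proj G \<restriction> pverts G = with_proj G"
    by (auto simp: induce_subgraph_def with_proj_def intro: in_arcsD1 in_arcsD2)
  have EV: "?E \<subseteq> pverts G \<times> pverts G" using in_arcsD1 in_arcsD2 by auto
  then have "?E \<inter> pverts G \<times> pverts G = ?E" by blast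
  then have conn: "(u, v) \<in> ?E\<^sup>*" if "u \<in> pverts G" "v \<in> pverts G" for u v
    using connected_induce_iff[of "pverts G"] assms(1) that by (auto simp: undirected_tree_def ind)
  define depth where "depth v = (LEAST k. (r, v) \<in> ?E ^^ k)" for v
  have depth: "(r, v) \<in> ?E ^^ depth v" if "v \<in> pverts G" for v
    unfolding depth_def using conn[OF assms(2) that] by (metis LeastI rtrancl_imp_relpow)
  have depth_le: "depth v \<le> k" if "(r, v) \<in> ?E ^^ k" for v k
    unfolding depth_def using that by (rule Least_le)
  have "\<exists>y. (y, v) \<in> ?E \<and> depth y < depth v" if v: "v \<in> pverts G" "v \<noteq> r" for v
  proof -
    obtain k where k: "depth v = Suc k"
      using depth[OF v(1)] v(2) by (cases "depth v") auto
    then obtain y where "(r, y) \<in> ?E ^^ k" "(y, v) \<in> ?E" using depth[OF v(1)] by auto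
    with depth_le[of y k] k show ?thesis by (auto intro!: exI[of _ y])
  qed
  then obtain par where par: "\<And>v. v \<in> pverts G \<Longrightarrow> v \<noteq> r \<Longrightarrow> (par v, v) \<in> ?E \<and> depth (par v) < depth v"
    by metis
  have root: "(x, r) \<in> (?E \<inter> (- {v}) \<times> (- {v}))\<^sup>*" if "x \<in> pverts G" "depth x < depth v" for x v
    using that
  proof (induction "depth x" arbitrary: x rule: less_induct)
    case less
    show ?case
    proof (cases "x = r")
      case False
      note p = par[OF less.prems(1) False]
      then have "(par x, r) \<in> (?E \<inter> (- {v}) \<times> (- {v}))\<^sup>*"
        using less.hyps[of "par x"] less.prems in_arcsD1 by auto
      moreover have "(x, par x) \<in> ?E \<inter> (- {v}) \<times> (- {v})"
        using p less.prems arcs_symmetric by auto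
      ultimately show ?thesis by (rule converse_rtrancl_into_rtrancl[rotated])
    qed simp
  qed
  \<comment> \<open>Both \<open>u\<close> and \<open>par v\<close> reach the root by descending in
    depth, hence without meeting \<open>v\<close>. If they were different, the connection between
    them together with \<open>v\<close> would be a cycle.\<close>
  have edge: "v \<noteq> r \<and> par v = u" if "(u, v) \<in> ?E" "depth u \<le> depth v" for u v
  proof -
    have uv: "u \<in> pverts G" "v \<in> pverts G" "u \<noteq> v" using that(1) in_arcsD1 in_arcsD2 no_loops' by auto
    have "depth r = 0" using depth_le[of r 0] by simp
    then have "v \<noteq> r" using depth[OF uv(1)] that(2) uv(3) by auto
    note pv = par[OF uv(2) this]
    let ?R = "?E \<inter> (- {v}) \<times> (- {v})"
    have "(u, r) \<in> ?R\<^sup>*"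
    proof (cases "u = r")
      case False
      note pu = par[OF uv(1) False]
      then have "(u, par u) \<in> ?R" using that(2) uv(3) arcs_symmetric by auto
      moreover have "(par u, r) \<in> ?R\<^sup>*" using root[of "par u" v] pu that(2) in_arcsD1 by auto
      ultimately show ?thesis by (rule converse_rtrancl_into_rtrancl)
    qed simp
    moreover have "sym (?R\<^sup>*)" using arcs_symmetric by (intro sym_rtrancl) (auto simp: sym_def)
    ultimately have "(r, u) \<in> ?R\<^sup>*" by (meson symE)
    moreover have "(par v, r) \<in> ?R\<^sup>*" using root[of "par v" v] pv in_arcsD1 by auto
    ultimately have "(par v, u) \<in> ?R\<^sup>*" by simp
    then have "par v = u" using detour_gives_cycle[of v "par v" u] pv that(1) arcs_symmetric acyclic by blast
    with \<open>v \<noteq> r\<close> show ?thesis by simp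
  qed
  have "rooted_tree (pverts G) ?E r par depth"
  proof
    show "(u \<noteq> r \<and> par u = v) \<or> (v \<noteq> r \<and> par v = u)" if "(u, v) \<in> ?E" for u v
    proof (cases "depth u \<le> depth v")
      case False
      moreover have "(v, u) \<in> ?E" using that arcs_symmetric by auto
      ultimately show ?thesis using edge[of v u] by auto
    qed (use edge that in blast)
  qed (use assms(2) EV par arcs_symmetric in_arcsD1 in \<open>auto simp: sym_def\<close>)
  then show ?thesis by (rule that)
qed


section \<open>Contracted instances\<close>

text \<open>
  An instance of the search consists of the vertices \<open>1, \<dots>, N\<close> that are still undecided, where 0 stands
  for the contraction of the vertices already chosen and \<open>p j < j\<close> is the parent of \<open>j\<close>. In the
  instances considered at most \<open>k\<close> colors occur, so a solution has to use each of them exactly once.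
\<close>

definition up_closed :: "(nat \<Rightarrow> nat) \<Rightarrow> nat set \<Rightarrow> bool" where
  "up_closed p S \<longleftrightarrow> (\<forall>j\<in>S. p j = 0 \<or> p j \<in> S)"

definition is_sol :: "nat \<Rightarrow> nat \<Rightarrow> (nat \<Rightarrow> nat) \<Rightarrow> (nat \<Rightarrow> nat) \<Rightarrow> nat set \<Rightarrow> bool" where
  "is_sol N k p c S \<longleftrightarrow> S \<subseteq> {1..N} \<and> up_closed p S \<and> inj_on c S \<and> card S = k"

definition sol :: "nat \<Rightarrow> nat \<Rightarrow> (nat \<Rightarrow> nat) \<Rightarrow> (nat \<Rightarrow> nat) \<Rightarrow> bool" where
  "sol N k p c \<longleftrightarrow> (\<exists>S. is_sol N k p c S)"

definition rows :: "nat \<Rightarrow> (nat \<Rightarrow> nat) \<Rightarrow> bool" where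
  "rows N p \<longleftrightarrow> (\<forall>j\<in>{1..N}. p j < j)"

lemma sol_cong:
  assumes "\<And>j. j \<in> {1..N} \<Longrightarrow> p j = p' j" "\<And>j. j \<in> {1..N} \<Longrightarrow> c j = c' j"
  shows "sol N k p c \<longleftrightarrow> sol N k p' c'"
proof -
  have "is_sol N k p c S \<longleftrightarrow> is_sol N k p' c' S" for S
    using assms inj_on_cong[of S c c'] unfolding is_sol_def up_closed_def by (metis subset_eq)
  then show ?thesis by (simp add: sol_def)
qed

lemma rows_cong: "(\<And>j. j \<in> {1..N} \<Longrightarrow> p j = p' j) \<Longrightarrow> rows N p \<longleftrightarrow> rows N p'"
  by (simp add: rows_def)

text \<open>
  In the state \<open>st\<close> the value 1 marks vertices to be contracted into the root, 2 vertices to be deleted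
  and 0 the others; \<open>g\<close> is the set of admissible colors for the latter. The map \<open>ren\<close>
  renumbers the vertices that survive and is 0 on the others.
\<close>

locale emission =
  fixes N :: nat and p c st :: "nat \<Rightarrow> nat" and g :: "nat set" and ren :: "nat \<Rightarrow> nat"
    and N' :: nat and p' c' :: "nat \<Rightarrow> nat"
  assumes rows: "rows N p" and st_0: "st 0 = 1"
    and st_closed: "\<And>j. j \<in> {1..N} \<Longrightarrow> st j = 1 \<Longrightarrow> st (p j) = 1"
    and ren_0: "ren 0 = 0"
    and ren_iff: "\<And>j. j \<in> {1..N} \<Longrightarrow>
      ren j \<noteq> 0 \<longleftrightarrow> st j = 0 \<and> c j \<in> g \<and> (st (p j) = 1 \<or> ren (p j) \<noteq> 0)"
    and ren_card: "\<And>j. j \<in> {1..N} \<Longrightarrow> ren j \<noteq> 0 \<Longrightarrow> ren j = card {i \<in> {1..j}. ren i \<noteq> 0}"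
    and p': "\<And>j. j \<in> {1..N} \<Longrightarrow> ren j \<noteq> 0 \<Longrightarrow> p' (ren j) = ren (p j)"
    and c': "\<And>j. j \<in> {1..N} \<Longrightarrow> ren j \<noteq> 0 \<Longrightarrow> c' (ren j) = c j"
    and N': "N' = card {i \<in> {1..N}. ren i \<noteq> 0}"
begin

definition "K = {i \<in> {1..N}. ren i \<noteq> 0}"
definition "T = {i \<in> {1..N}. st i = 1}"

lemma p_less: "j \<in> {1..N} \<Longrightarrow> p j < j"
  using rows by (simp add: rows_def)

lemma K_sub: "K \<subseteq> {1..N}" and finite_K: "finite K" and card_K: "card K = N'"
  by (auto simp: K_def N')

lemma ren_strict: "i \<in> K \<Longrightarrow> j \<in> K \<Longrightarrow> i < j \<Longrightarrow> ren i < ren j"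
proof -
  assume *: "i \<in> K" "j \<in> K" "i < j"
  then have "{x \<in> {1..i}. ren x \<noteq> 0} \<subseteq> {x \<in> {1..j}. ren x \<noteq> 0}"
    "j \<in> {x \<in> {1..j}. ren x \<noteq> 0}" "j \<notin> {x \<in> {1..i}. ren x \<noteq> 0}" by (auto simp: K_def)
  then have "{x \<in> {1..i}. ren x \<noteq> 0} \<subset> {x \<in> {1..j}. ren x \<noteq> 0}" by blast
  from psubset_card_mono[OF _ this] show "ren i < ren j"
    using * ren_card[of i] ren_card[of j] by (simp add: K_def)
qed

lemma ren_inj: "inj_on ren K"
  by (rule linorder_inj_onI') (metis ren_strict less_irrefl)

lemma ren_image: "ren ` K = {1..N'}"
proof (rule card_subset_eq)
  show "ren ` K \<subseteq> {1..N'}"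
  proof
    fix x assume "x \<in> ren ` K"
    then obtain j where j: "j \<in> K" "x = ren j" by auto
    then have "{i \<in> {1..j}. ren i \<noteq> 0} \<subseteq> K" by (auto simp: K_def)
    from card_mono[OF finite_K this] j ren_card show "x \<in> {1..N'}" by (auto simp: K_def N')
  qed
  show "card (ren ` K) = card {1..N'}" using card_image[OF ren_inj] card_K by simp
qed simp

lemma emitted_rows: "rows N' p'"
  unfolding rows_def
proof
  fix j' assume "j' \<in> {1..N'}"
  then obtain j where j: "j \<in> K" "j' = ren j" using ren_image by (metis imageE)
  then have "p' j' = ren (p j)" "p j < j" "j \<in> {1..N}" "ren j \<noteq> 0" using p' p_less by (auto simp: K_def)
  moreover have "ren (p j) < ren j"
  proof (cases "ren (p j) = 0")
    case False
    then have "p j \<noteq> 0" using ren_0 by metis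
    then have "p j \<in> K" using \<open>p j < j\<close> \<open>j \<in> {1..N}\<close> False by (auto simp: K_def)
    then show ?thesis using ren_strict j \<open>p j < j\<close> by simp
  qed (use \<open>ren j \<noteq> 0\<close> in simp)
  ultimately show "p' j' < j'" using j by simp
qed

lemma emitted_colors: "c' ` {1..N'} = c ` K"
proof -
  have "c' ` ren ` K = c ` K" unfolding image_image by (rule image_cong) (auto simp: K_def c')
  then show ?thesis by (simp only: ren_image)
qed

lemma emitted_sol:
  assumes inj: "inj_on c T" and bad: "\<And>j. j \<in> T \<Longrightarrow> c j \<notin> g"
  shows "sol N' k p' c' \<longleftrightarrow>
    (\<exists>S. is_sol N (k + card T) p c S \<and> T \<subseteq> S \<and> (\<forall>j\<in>S - T. st j = 0 \<and> c j \<in> g))" (is "?A \<longleftrightarrow> ?B")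
proof
  assume ?B
  then obtain S where S: "S \<subseteq> {1..N}" "up_closed p S" "inj_on c S" "card S = k + card T" "T \<subseteq> S"
    "\<And>j. j \<in> S - T \<Longrightarrow> st j = 0 \<and> c j \<in> g" by (auto simp: is_sol_def)
  have SK: "j \<in> K" if "j \<in> S - T" for j
    using that
  proof (induction j rule: less_induct)
    case (less j)
    then have j: "j \<in> {1..N}" "st j = 0" "c j \<in> g" using S by auto
    have "st (p j) = 1 \<or> ren (p j) \<noteq> 0"
    proof (cases "p j = 0 \<or> p j \<in> T")
      case False
      then have "p j \<in> S - T" using S(2) less.prems by (auto simp: up_closed_def)
      from less.IH[OF p_less[OF j(1)] this] show ?thesis by (simp add: K_def)
    qed (auto simp: st_0 T_def)
    then show ?case using ren_iff[OF j(1)] j by (simp add: K_def)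
  qed
  let ?S = "ren ` (S - T)"
  have "is_sol N' k p' c' ?S"
    unfolding is_sol_def up_closed_def
  proof (intro conjI ballI)
    show "?S \<subseteq> {1..N'}" using SK ren_image by blast
    have inj': "inj_on ren (S - T)" using SK inj_on_subset[OF ren_inj] by blast
    have "card ?S = card (S - T)" by (rule card_image[OF inj'])
    also have "\<dots> = k" using S(4,5) card_Diff_subset[OF finite_subset[OF S(5)]] finite_subset[OF S(1)] by simp
    finally show "card ?S = k" .
    show "inj_on c' ?S"
    proof (rule inj_onI)
      fix x y assume "x \<in> ?S" "y \<in> ?S" "c' x = c' y"
      then obtain i j where "i \<in> S - T" "j \<in> S - T" "x = ren i" "y = ren j" by auto
      moreover from this have "c i = c j" using SK c' \<open>c' x = c' y\<close> unfolding K_def by auto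
      ultimately show "x = y" using inj_onD[OF S(3)] by auto
    qed
    fix x assume "x \<in> ?S"
    then obtain j where j: "j \<in> S - T" "x = ren j" by auto
    then have px: "p' x = ren (p j)" "j \<in> {1..N}" using SK p' by (auto simp: K_def)
    have "p j = 0 \<or> p j \<in> S" using S(2) j(1) by (simp add: up_closed_def)
    then have "p j = 0 \<or> p j \<in> T \<or> p j \<in> S - T" by auto
    then consider "p j = 0" | "p j \<in> T" | "p j \<in> S - T" by (elim disjE)
    then show "p' x = 0 \<or> p' x \<in> ?S"
    proof cases
      case 2
      then show ?thesis using px ren_iff[of "p j"] by (auto simp: T_def)
    qed (use px ren_0 in auto)
  qed
  then show ?A by (auto simp: sol_def)
next
  assume ?A
  then obtain S' where S': "S' \<subseteq> {1..N'}" "up_closed p' S'" "inj_on c' S'" "card S' = k"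
    by (auto simp: sol_def is_sol_def)
  define U where "U = {j \<in> K. ren j \<in> S'}"
  have U: "U \<subseteq> K" "ren ` U = S'" using S'(1) ren_image by (auto simp: U_def)
  have finite_T: "finite T" by (simp add: T_def)
  have UT: "U \<inter> T = {}" using ren_iff by (auto simp: U_def T_def K_def)
  have Ug: "st j = 0 \<and> c j \<in> g" if "j \<in> U" for j using that ren_iff[of j] by (auto simp: U_def K_def)
  have up: "p j = 0 \<or> p j \<in> {1..N}" if "j \<in> {1..N}" for j using p_less[OF that] that by auto
  have "card U = k" using card_image[OF inj_on_subset[OF ren_inj U(1)]] U(2) S'(4) by simp
  then have "card (T \<union> U) = k + card T"
    using card_Un_disjoint[of T U] UT finite_subset[OF U(1) finite_K] finite_T by (simp add: Int_commute)
  moreover have "up_closed p (T \<union> U)"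
    unfolding up_closed_def
  proof
    fix j assume "j \<in> T \<union> U"
    then show "p j = 0 \<or> p j \<in> T \<union> U"
    proof
      assume "j \<in> T"
      then show ?thesis using st_closed[of j] up[of j] by (auto simp: T_def)
    next
      assume j: "j \<in> U"
      then have jN: "j \<in> {1..N}" "ren j \<noteq> 0" by (auto simp: U_def K_def)
      show ?thesis
      proof (cases "st (p j) = 1")
        case True
        then show ?thesis using up[OF jN(1)] by (auto simp: T_def)
      next
        case False
        then have r: "ren (p j) \<noteq> 0" using ren_iff[OF jN(1)] jN by blast
        then have "p j \<noteq> 0" using ren_0 by metis
        moreover have "ren (p j) \<in> S'" using S'(2) j p'[OF jN] r by (auto simp: up_closed_def U_def)
        ultimately show ?thesis using up[OF jN(1)] r by (auto simp: U_def K_def)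
      qed
    qed
  qed
  moreover have "inj_on c U"
  proof (rule inj_onI)
    fix i j assume ij: "i \<in> U" "j \<in> U" "c i = c j"
    then have "c' (ren i) = c' (ren j)" using c' by (auto simp: U_def K_def)
    then have "ren i = ren j" using inj_onD[OF S'(3)] ij by (auto simp: U_def)
    then show "i = j" using inj_onD[OF ren_inj] ij U(1) by blast
  qed
  moreover have "c ` (T - U) \<inter> c ` (U - T) = {}"
  proof -
    have "c i \<noteq> c j" if "i \<in> T" "j \<in> U" for i j using bad[OF that(1)] Ug[OF that(2)] by metis
    then show ?thesis by blast
  qed
  ultimately have "is_sol N (k + card T) p c (T \<union> U)"
    using inj U(1) K_sub by (auto simp: is_sol_def inj_on_Un T_def)
  then show ?B using Ug by (intro exI[of _ "T \<union> U"]) auto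
qed

text \<open>All decreases in size are obtained from this: it is enough to exhibit a set of vertices
  that do not survive.\<close>

lemma emitted_le: "A \<subseteq> {1..N} \<Longrightarrow> A \<inter> K = {} \<Longrightarrow> N' + card A \<le> N"
  using card_mono[of "{1..N}" "K \<union> A"] card_Un_disjoint[of K A] K_sub finite_K card_K
    finite_subset[of A "{1..N}"] by (auto simp: Int_commute)

end

section \<open>Instances with few colors, and the two branches of the search\<close>

lemma two_card_image_le:
  assumes "finite A" "\<And>a. a \<in> A \<Longrightarrow> \<exists>b\<in>A. b \<noteq> a \<and> f b = f a"
  shows "2 * card (f ` A) \<le> card A"
proof -
  have "card {a \<in> A. f a = y} \<ge> 2" if y: "y \<in> f ` A" for y
  proof -
    obtain a b where "a \<in> A" "b \<in> A" "b \<noteq> a" "f a = y" "f b = y"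
      using assms(2) y by (metis imageE)
    then have "{a, b} \<subseteq> {a \<in> A. f a = y}" "card {a, b} = 2" by auto
    then show ?thesis using card_mono[of "{a \<in> A. f a = y}" "{a, b}"] assms(1) by auto
  qed
  then have "(\<Sum>y\<in>f ` A. 2) \<le> (\<Sum>y\<in>f ` A. card {a \<in> A. f a = y})" by (rule sum_mono)
  also have "\<dots> = (\<Sum>y\<in>f ` A. \<Sum>a\<in>{a \<in> A. f a = y}. 1)" by simp
  also have "\<dots> = card A" using sum.image_gen[OF assms(1), of "\<lambda>_. 1::nat" f] by simp
  finally show ?thesis by simp
qed

locale instance_rows =
  fixes N k :: nat and p c :: "nat \<Rightarrow> nat"
  assumes rows: "rows N p" and few: "card (c ` {1..N}) \<le> k"
begin

lemma sol_colors: "is_sol N k p c S \<Longrightarrow> c ` S = c ` {1..N}"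
proof -
  assume S: "is_sol N k p c S"
  then have "card (c ` S) = k" by (auto simp: is_sol_def card_image)
  moreover have "c ` S \<subseteq> c ` {1..N}" using S by (auto simp: is_sol_def)
  ultimately show "c ` S = c ` {1..N}" using few by (intro card_seteq) auto
qed

lemma too_few: "card (c ` {1..N}) < k \<Longrightarrow> \<not> sol N k p c"
  unfolding sol_def using sol_colors card_image by (metis is_sol_def less_irrefl)

text \<open>When all vertices are children of the root, closure under parents is void and any choice
  of one vertex per color is a solution.\<close>

lemma sol_flat:
  assumes "card (c ` {1..N}) = k" "\<And>j. j \<in> {1..N} \<Longrightarrow> p j = 0"
  shows "sol N k p c"
proof -
  obtain S where "S \<subseteq> {1..N}" "inj_on c S" "c ` {1..N} = c ` S"
    using subset_image_inj[of "c ` {1..N}" c "{1..N}"] by auto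
  then have "is_sol N k p c S" using assms by (auto simp: is_sol_def up_closed_def card_image)
  then show ?thesis by (auto simp: sol_def)
qed

lemma sol_unique:
  assumes "is_sol N k p c S" "u \<in> {1..N}" "\<And>i. i \<in> {1..N} \<Longrightarrow> c i = c u \<Longrightarrow> i = u"
  shows "u \<in> S"
proof -
  have "c u \<in> c ` S" using sol_colors[OF assms(1)] assms(2) by auto
  then obtain i where i: "i \<in> S" "c i = c u" by auto
  then have "i = u" using assms(1) by (intro assms(3)) (auto simp: is_sol_def)
  with i show ?thesis by simp
qed

lemma two_few: "(\<And>j. j \<in> {1..N} \<Longrightarrow> \<exists>i\<in>{1..N}. i \<noteq> j \<and> c i = c j) \<Longrightarrow> 2 * card (c ` {1..N}) \<le> N"
  using two_card_image_le[of "{1..N}" c] by simp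

end

locale taken = instance_rows N k p c + emission N p c st g ren N' p' c'
  for N k p c st g ren N' p' c' +
  fixes v :: nat
  assumes v: "v \<in> {1..N}" "p v = 0"
    and st: "\<And>j. j \<le> N \<Longrightarrow> st j = (if j = 0 \<or> j = v then 1 else 0)"
    and g: "\<And>j. j \<in> {1..N} \<Longrightarrow> c j \<in> g \<longleftrightarrow> c j \<noteq> c v"
begin

lemma T_eq: "T = {v}"
proof -
  have "st i = 1 \<longleftrightarrow> i = v" if "i \<in> {1..N}" for i using st[of i] that by auto
  then show ?thesis using v(1) unfolding T_def by blast
qed

lemma v_notin: "v \<notin> K"
  using ren_iff[OF v(1)] st[of v] v by (auto simp: K_def)

lemma few': "card (c' ` {1..N'}) \<le> k - 1"
proof -
  have "c' ` {1..N'} \<subseteq> c ` {1..N} - {c v}"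
    using emitted_colors ren_iff g K_sub by (auto simp: K_def)
  then have "card (c' ` {1..N'}) \<le> card (c ` {1..N} - {c v})" by (intro card_mono) auto
  also have "\<dots> = card (c ` {1..N}) - 1" using v by simp
  finally show ?thesis using few by linarith
qed

lemma instance': "instance_rows N' (k - 1) p' c'"
  by unfold_locales (rule emitted_rows few')+

lemma sol_taken: "1 \<le> k \<Longrightarrow> sol N' (k - 1) p' c' \<longleftrightarrow> (\<exists>S. is_sol N k p c S \<and> v \<in> S)"
proof -
  assume k: "1 \<le> k"
  have "st j = 0 \<and> c j \<in> g" if S: "is_sol N k p c S" and v: "v \<in> S" and j: "j \<in> S - {v}" for S j
  proof -
    have "j \<in> {1..N}" "j \<noteq> v" using S j by (auto simp: is_sol_def)
    moreover have "c j \<noteq> c v" using S v j by (auto simp: is_sol_def dest: inj_onD)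
    ultimately show ?thesis using st[of j] g[of j] by auto
  qed
  then show ?thesis using emitted_sol[of "k - 1"] k g v by (auto simp: T_eq)
qed

lemma le1: "N' + 1 \<le> N"
  using emitted_le[of "{v}"] v v_notin by auto

text \<open>
  If taking \<open>v\<close> removes at most one further vertex, then the vertex that a solution without \<open>v\<close> uses for
  the color of \<open>v\<close> has no child in the solution and can be exchanged for \<open>v\<close>.
\<close>

lemma dominated:
  assumes "N < N' + 3" "is_sol N k p c S"
  shows "\<exists>S. is_sol N k p c S \<and> v \<in> S"
proof (cases "v \<in> S")
  case False
  have S: "S \<subseteq> {1..N}" "up_closed p S" "inj_on c S" "card S = k" using assms(2) by (auto simp: is_sol_def)
  have "c v \<in> c ` S" using sol_colors[OF assms(2)] v by auto
  then obtain w where w: "w \<in> S" "c w = c v" by auto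
  have wN: "w \<in> {1..N}" "w \<noteq> v" using w S False by auto
  then have wK: "w \<notin> K" using ren_iff[OF wN(1)] g[OF wN(1)] w by (auto simp: K_def)
  \<comment> \<open>A child \<open>y\<close> of \<open>w\<close> in \<open>S\<close> would be lost
    along with \<open>v\<close> and \<open>w\<close>, and \<open>N < N' + 3\<close> leaves room for
    two losses only.\<close>
  have leaf: "p y \<noteq> w" if y: "y \<in> S" for y
  proof
    assume "p y = w"
    have yN: "y \<in> {1..N}" using y S by auto
    have "y \<noteq> v" "y \<noteq> w" using \<open>p y = w\<close> v wN p_less[OF yN] by auto
    moreover have "y \<notin> K"
      using ren_iff[OF yN] wK wN \<open>p y = w\<close> st[of w] by (auto simp: K_def)
    ultimately have "N' + card {v, w, y} \<le> N"
      using emitted_le[of "{v, w, y}"] v wN yN wK v_notin by auto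
    then show False using assms(1) wN(2) \<open>y \<noteq> v\<close> \<open>y \<noteq> w\<close> by auto
  qed
  let ?S = "insert v (S - {w})"
  have fin: "finite S" using S(1) finite_subset by blast
  have "is_sol N k p c ?S"
    unfolding is_sol_def
  proof (intro conjI)
    show "?S \<subseteq> {1..N}" using S v by auto
    show "up_closed p ?S" using S(2) leaf v by (auto simp: up_closed_def)
    show "inj_on c ?S"
      unfolding inj_on_insert
    proof
      show "inj_on c (S - {w})" using S(3) by (rule inj_on_diff)
      show "c v \<notin> c ` (S - {w} - {v})" 
      proof
        assume "c v \<in> c ` (S - {w} - {v})"
        then obtain y where y: "c v = c y" "y \<in> S - {w} - {v}" by (rule imageE)
        have "y = w" using inj_onD[OF S(3) trans[OF y(1)[symmetric] w(2)[symmetric]]] y(2) w(1) by blast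
        with y(2) show False by blast
      qed
    qed
    show "card ?S = k" 
      using S(4) w False fin card_gt_0_iff[of S] by (auto simp: card_Diff_singleton)
  qed
  then show ?thesis by blast
qed (use assms in blast)

end

locale dropped = instance_rows N k p c + emission N p c st g ren N' p' c'
  for N k p c st g ren N' p' c' +
  fixes v :: nat
  assumes v: "v \<in> {1..N}" "p v = 0"
    and st: "\<And>j. j \<le> N \<Longrightarrow> st j = (if j = 0 then 1 else if j = v then 2 else 0)"
    and g: "\<And>j. j \<in> {1..N} \<Longrightarrow> c j \<in> g"
begin

lemma T_eq: "T = {}"
proof -
  have "st i \<noteq> 1" if "i \<in> {1..N}" for i using st[of i] that by auto
  then show ?thesis unfolding T_def by blast
qed

lemma instance': "instance_rows N' k p' c'"
proof
  have "card (c' ` {1..N'}) \<le> card (c ` {1..N})"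
    unfolding emitted_colors using K_sub by (intro card_mono) auto
  then show "card (c' ` {1..N'}) \<le> k" using few by simp
qed (rule emitted_rows)

lemma sol_dropped: "sol N' k p' c' \<longleftrightarrow> (\<exists>S. is_sol N k p c S \<and> v \<notin> S)"
proof -
  have "(\<forall>j\<in>S. st j = 0 \<and> c j \<in> g) \<longleftrightarrow> v \<notin> S" if "is_sol N k p c S" for S
    using that st g v by (auto simp: is_sol_def)
  then show ?thesis using emitted_sol[of k] by (auto simp: T_eq)
qed

lemma le2:
  assumes "y \<in> {1..N}" "p y = v"
  shows "N' + 2 \<le> N"
proof -
  have "v \<notin> K" using ren_iff[OF v(1)] st[of v] v by (auto simp: K_def)
  moreover have "y \<notin> K"
    using ren_iff[OF assms(1)] st[of v] v assms \<open>v \<notin> K\<close> by (auto simp: K_def)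
  moreover have "v \<noteq> y" using assms v p_less[OF assms(1)] by auto
  ultimately show ?thesis using emitted_le[of "{v, y}"] v assms by auto
qed

end

text \<open>
  When the search branches, both branches decrease \<open>l = N - k\<close> by at least 2, and \<open>N \<le> 2 l\<close> because every
  color occurs at least twice; so the polynomial amount of work per step is paid for by \<open>l\<close>.
\<close>

fun hpot :: "nat \<Rightarrow> nat" where
  "hpot 0 = 0"
| "hpot (Suc 0) = 0"
| "hpot (Suc (Suc l)) = 2 * hpot l + (2 * l + 5)\<^sup>2"

text \<open>The square pays for steps that push at most one frame, since
  \<open>(N + 1)^2 - N^2\<close> already exceeds the work \<open>N + 1\<close>; \<open>hpot\<close>
  pays for branching.\<close>

definition pot :: "nat \<Rightarrow> nat \<Rightarrow> nat" where
  "pot N k = (N + 1)\<^sup>2 + hpot (N - k)"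

lemma hpot_Suc: "hpot l \<le> hpot (Suc l)"
proof (induction l rule: hpot.induct)
  case (3 l)
  moreover have "(2 * l + 5)\<^sup>2 \<le> (2 * Suc l + 5)\<^sup>2" by (rule power_mono) auto
  ultimately show ?case unfolding hpot.simps by linarith
qed auto

lemma hpot_mono: "l \<le> m \<Longrightarrow> hpot l \<le> hpot m"
  using lift_Suc_mono_le[of hpot] hpot_Suc by blast

lemma pot_ge: "N + 1 \<le> pot N k"
  by (simp add: pot_def power2_eq_square)

lemma pot_single:
  assumes "N' + 1 \<le> N"
  shows "pot N' (k - 1) + (N + 1) \<le> pot N k"
proof -
  have "hpot (N' - (k - 1)) \<le> hpot (N - k)" using assms by (intro hpot_mono) linarith
  moreover have "(N' + 1)\<^sup>2 \<le> N\<^sup>2" using assms by (intro power_mono) auto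
  ultimately show ?thesis by (simp add: pot_def power2_eq_square algebra_simps)
qed

text \<open>After branching the square is needed for two frames, and the increment of
  \<open>hpot\<close> supplies the second one: from \<open>2 * k <= N\<close> and
  \<open>N - k = l + 2\<close> follows \<open>N + 1 <= 2 * l + 5\<close>.\<close>

lemma pot_branch:
  assumes "2 * k \<le> N" "N1 + 3 \<le> N" "N2 + 2 \<le> N"
  shows "pot N1 (k - 1) + pot N2 k + (N + 1) \<le> pot N k"
proof -
  obtain l where l: "N - k = Suc (Suc l)"
  proof -
    have "N - k = Suc (Suc (N - k - 2))" using assms by linarith
    then show thesis by (rule that)
  qed
  have "hpot (N1 - (k - 1)) \<le> hpot l" "hpot (N2 - k) \<le> hpot l"
    using assms l by (intro hpot_mono; linarith)+
  moreover have "(N1 + 1)\<^sup>2 \<le> (N - 2)\<^sup>2" "(N2 + 1)\<^sup>2 \<le> (N - 1)\<^sup>2" using assms by (intro power_mono; linarith)+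
  moreover have "(N + 1)\<^sup>2 \<le> (2 * l + 5)\<^sup>2" using assms l by (intro power_mono; linarith)
  moreover have "(N - 2)\<^sup>2 + (N - 1)\<^sup>2 + (N + 1) \<le> 2 * (N + 1)\<^sup>2"
  proof -
    obtain m where "N = m + 3" using assms(2) by (metis add.commute add_leD2 le_Suc_ex)
    then show ?thesis by (simp add: power2_eq_square algebra_simps)
  qed
  ultimately show ?thesis unfolding pot_def l hpot.simps by linarith
qed


section \<open>Verification calculus\<close>

definition For :: "nat \<Rightarrow> exp \<Rightarrow> com \<Rightarrow> com" where
  "For i e c = Loop (Minus e (Vr i)) (c ;; i ::= Plus (Vr i) (Cn (Suc 0)))"

context machine
begin

text \<open>A total correctness statement with a time budget for one given initial state. In this
  form the equations below let the simplifier execute straight-line code symbolically.\<close>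

definition runs :: "com \<Rightarrow> vars \<Rightarrow> arrs \<Rightarrow> nat \<Rightarrow> (vars \<Rightarrow> arrs \<Rightarrow> bool) \<Rightarrow> bool" where
  "runs c v a T Q \<longleftrightarrow> (\<exists>t v' a'. run c v a t v' a' \<and> t \<le> T \<and> Q v' a')"

inductive_simps run_Skip_iff: "run Skip v a t v' a'"
inductive_simps run_Assign_iff: "run (x ::= e) v a t v' a'"
inductive_simps run_Put_iff: "run (Put r e f) v a t v' a'"
inductive_simps run_Seq_iff: "run (c ;; d) v a t v' a'"
inductive_simps run_Cond_iff: "run (Cond e c d) v a t v' a'"

lemma runs_Skip [simp]: "runs Skip v a T Q \<longleftrightarrow> Q v a"
  by (auto simp: runs_def run_Skip_iff)

lemma runs_Assign [simp]:
  "runs (x ::= e) v a T Q \<longleftrightarrow> ok e v a \<and> 0 < T \<and> Q (v(x := val e v a)) a"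
  by (auto simp: runs_def run_Assign_iff Suc_le_eq)

lemma runs_Put [simp]:
  "runs (Put r e f) v a T Q \<longleftrightarrow> ok e v a \<and> ok f v a \<and> val e v a < B \<and> r < 32 \<and> 0 < T \<and>
     Q v (a(r := (a r)(val e v a := val f v a)))"
  by (auto simp: runs_def run_Put_iff Suc_le_eq)

lemma runs_Skip_Seq [simp]: "runs (Skip ;; c) v a T Q \<longleftrightarrow> runs c v a T Q"
  by (auto simp: runs_def run_Seq_iff run_Skip_iff)

text \<open>The common pattern behind the symbolic execution rules: \<open>d\<close> spends one unit
  under the side condition \<open>G\<close> and then behaves like \<open>c\<close> from the updated
  state.\<close>

lemma runs_Suc:
  assumes "\<And>t v' a'. run d v a t v' a' \<longleftrightarrow> (\<exists>t'. t = Suc t' \<and> G \<and> run c v1 a1 t' v' a')"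
  shows "runs d v a T Q \<longleftrightarrow> G \<and> 0 < T \<and> runs c v1 a1 (T - 1) Q"
proof
  assume "runs d v a T Q"
  then obtain t v' a' where "G" "run c v1 a1 t v' a'" "Suc t \<le> T" "Q v' a'"
    unfolding runs_def assms by blast
  moreover from this have "t \<le> T - 1" "0 < T" by simp_all
  ultimately show "G \<and> 0 < T \<and> runs c v1 a1 (T - 1) Q" unfolding runs_def by blast
next
  assume "G \<and> 0 < T \<and> runs c v1 a1 (T - 1) Q"
  then obtain t v' a' where *: "G" "run c v1 a1 t v' a'" "t \<le> T - 1" "Q v' a'" "0 < T"
    unfolding runs_def by blast
  moreover from *(3,5) have "Suc t \<le> T" by simp
  ultimately show "runs d v a T Q" unfolding runs_def assms by blast
qed

lemma runs_Assign_Seq [simp]: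
  "runs (x ::= e ;; c) v a T Q \<longleftrightarrow> ok e v a \<and> 0 < T \<and> runs c (v(x := val e v a)) a (T - 1) Q"
  by (rule runs_Suc) (auto simp: run_Seq_iff run_Assign_iff)

lemma runs_Put_Seq [simp]:
  "runs (Put r e f ;; c) v a T Q \<longleftrightarrow> (ok e v a \<and> ok f v a \<and> val e v a < B \<and> r < 32) \<and> 0 < T \<and>
     runs c v (a(r := (a r)(val e v a := val f v a))) (T - 1) Q"
  by (rule runs_Suc) (auto simp: run_Seq_iff run_Put_iff)

lemma runs_Cond [simp]:
  "runs (Cond e c d) v a T Q \<longleftrightarrow> ok e v a \<and> 0 < T \<and>
     (if val e v a \<noteq> 0 then runs c v a (T - 1) Q else runs d v a (T - 1) Q)"
proof -
  have "runs (Cond e c d) v a T Q \<longleftrightarrow>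
      ok e v a \<and> 0 < T \<and> runs (if val e v a \<noteq> 0 then c else d) v a (T - 1) Q"
    by (rule runs_Suc) (auto simp: run_Cond_iff)
  then show ?thesis by simp
qed

lemma runs_Seq_assoc [simp]: "runs ((c ;; d) ;; e) v a T Q \<longleftrightarrow> runs (c ;; (d ;; e)) v a T Q"
  unfolding runs_def run_Seq_iff by (metis (no_types, opaque_lifting) add.assoc)

lemma runs_Cond_Seq [simp]:
  "runs (Cond e c d ;; f) v a T Q \<longleftrightarrow> ok e v a \<and> 0 < T \<and>
     (if val e v a \<noteq> 0 then runs (c ;; f) v a (T - 1) Q else runs (d ;; f) v a (T - 1) Q)"
proof -
  have "runs (Cond e c d ;; f) v a T Q \<longleftrightarrow> runs (Cond e (c ;; f) (d ;; f)) v a T Q"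
    unfolding runs_def run_Seq_iff run_Cond_iff by fastforce
  then show ?thesis by simp
qed

lemma runs_Seq:
  assumes "runs c v a T1 (\<lambda>v' a'. runs d v' a' T2 Q)" "T1 + T2 \<le> T"
  shows "runs (c ;; d) v a T Q"
  using assms unfolding runs_def by (meson add_mono le_trans run_Seq)

lemma runs_weaken:
  assumes "runs c v a T Q" "T \<le> T'" "\<And>v' a'. Q v' a' \<Longrightarrow> Q' v' a'"
  shows "runs c v a T' Q'"
  using assms unfolding runs_def by (meson le_trans)

lemma runs_Loop:
  assumes "I k v a"
    and "\<And>k v a. I k v a \<Longrightarrow> ok e v a"
    and "\<And>k v a. I k v a \<Longrightarrow> val e v a \<noteq> 0 \<Longrightarrow> 0 < k \<and> runs c v a T (I (k - 1))"
    and "\<And>k v a. I k v a \<Longrightarrow> val e v a = 0 \<Longrightarrow> Q v a"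
    and "(T + 1) * k + 1 \<le> T'"
  shows "runs (Loop e c) v a T' Q"
proof -
  have "runs (Loop e c) v a ((T + 1) * k + 1) Q"
    using assms(1)
  proof (induction k arbitrary: v a)
    case 0
    then have "val e v a = 0" using assms(3)[OF 0] by auto
    from run_Loop0[OF assms(2)[OF 0] this] assms(4)[OF 0 this] show ?case
      unfolding runs_def by (intro exI conjI) (assumption | simp)+
  next
    case (Suc k)
    show ?case
    proof (cases "val e v a = 0")
      case True
      from run_Loop0[OF assms(2)[OF Suc.prems] this] assms(4)[OF Suc.prems this] show ?thesis
        unfolding runs_def by (intro exI conjI) (assumption | simp)+
    next
      case False
      then obtain t v1 a1 where 1: "run c v a t v1 a1" "t \<le> T" "I k v1 a1"
        using assms(3)[OF Suc.prems] by (auto simp: runs_def)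
      then obtain t' v2 a2 where 2: "run (Loop e c) v1 a1 t' v2 a2" "t' \<le> (T + 1) * k + 1" "Q v2 a2"
        using Suc.IH[OF 1(3)] by (auto simp: runs_def)
      have "run (Loop e c) v a (Suc (t + t')) v2 a2" using run_Loop1[OF assms(2)[OF Suc.prems] False 1(1) 2(1)] .
      moreover have "Suc (t + t') \<le> (T + 1) * Suc k + 1" using 1(2) 2(2) by simp
      ultimately show ?thesis using 2(3) unfolding runs_def by blast
    qed
  qed
  then show ?thesis using assms(5) by (rule runs_weaken)
qed

text \<open>Amortised analysis: an iteration may take any time \<open>T\<close> that is paid for,
  together with the loop test, by the fall of \<open>\<phi>\<close>. The decrease of
  \<open>\<phi>\<close> also gives termination.\<close>

lemma runs_Loop_pot:
  fixes \<phi> :: "vars \<Rightarrow> arrs \<Rightarrow> nat"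
  assumes "I v a"
    and "\<And>v a. I v a \<Longrightarrow> ok e v a"
    and "\<And>v a. I v a \<Longrightarrow> val e v a \<noteq> 0 \<Longrightarrow> \<exists>T. runs c v a T (\<lambda>v' a'. I v' a' \<and> \<phi> v' a' + T + 1 \<le> \<phi> v a)"
    and "\<And>v a. I v a \<Longrightarrow> val e v a = 0 \<Longrightarrow> Q v a"
  shows "runs (Loop e c) v a (\<phi> v a + 1) Q"
  using assms(1)
proof (induction "\<phi> v a" arbitrary: v a rule: less_induct)
  case less
  show ?case
  proof (cases "val e v a = 0")
    case True
    from run_Loop0[OF assms(2)[OF less.prems] True] assms(4)[OF less.prems True] show ?thesis
      unfolding runs_def by (intro exI conjI) (assumption | simp)+
  next
    case False
    from assms(3)[OF less.prems False] obtain T t v1 a1 where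
      1: "run c v a t v1 a1" "t \<le> T" "I v1 a1" "\<phi> v1 a1 + T + 1 \<le> \<phi> v a"
      by (auto simp: runs_def)
    then have "\<phi> v1 a1 < \<phi> v a" by simp
    from less.hyps[OF this 1(3)] obtain t' v2 a2 where
      2: "run (Loop e c) v1 a1 t' v2 a2" "t' \<le> \<phi> v1 a1 + 1" "Q v2 a2"
      by (auto simp: runs_def)
    have "run (Loop e c) v a (Suc (t + t')) v2 a2"
      using run_Loop1[OF assms(2)[OF less.prems] False 1(1) 2(1)] .
    moreover have "Suc (t + t') \<le> \<phi> v a + 1" using 1(2,4) 2(2) by simp
    ultimately show ?thesis using 2(3) unfolding runs_def by blast
  qed
qed

text \<open>Each round costs 2 in addition to the body, for the loop test and the increment of the
  counter.\<close>

lemma runs_For: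
  assumes "I (v i) v a" "v i \<le> hi" "hi < B"
    and "\<And>k v a. I k v a \<Longrightarrow> v i = k \<Longrightarrow> k \<le> hi \<Longrightarrow> ok e v a \<and> val e v a = hi"
    and "\<And>k v a. I k v a \<Longrightarrow> v i = k \<Longrightarrow> k < hi \<Longrightarrow>
      runs c v a T (\<lambda>v' a'. v' i = k \<and> I (Suc k) (v'(i := Suc k)) a')"
    and "\<And>v a. I hi v a \<Longrightarrow> v i = hi \<Longrightarrow> Q v a"
    and "(T + 2) * (hi - v i) + 1 \<le> T'"
  shows "runs (For i e c) v a T' Q"
  unfolding For_def
proof (rule runs_Loop[where I = "\<lambda>k v a. v i + k = hi \<and> I (v i) v a" and k = "hi - v i" and T = "T + 1"])
  fix k v a assume I: "v i + k = hi \<and> I (v i) v a"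
  then have e: "ok e v a" "val e v a = hi" using assms(4)[of "v i" v a] by auto
  then show "ok (Minus e (Vr i)) v a" by simp
  show "0 < k \<and> runs (c ;; i ::= Plus (Vr i) (Cn (Suc 0))) v a (T + 1) (\<lambda>v a. v i + (k - 1) = hi \<and> I (v i) v a)"
    if "val (Minus e (Vr i)) v a \<noteq> 0"
  proof
    show k: "0 < k" using that e I by simp
    have "runs c v a T (\<lambda>v' a'. v' i = v i \<and> I (Suc (v i)) (v'(i := Suc (v i))) a')"
      using assms(5)[of "v i" v a] I k by simp
    then have "runs c v a T (\<lambda>v' a'. runs (i ::= Plus (Vr i) (Cn (Suc 0))) v' a' 1
        (\<lambda>v a. v i + (k - 1) = hi \<and> I (v i) v a))"
      by (rule runs_weaken) (use I k assms(3) in auto)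
    then show "runs (c ;; i ::= Plus (Vr i) (Cn (Suc 0))) v a (T + 1) (\<lambda>v a. v i + (k - 1) = hi \<and> I (v i) v a)"
      by (rule runs_Seq) simp
  qed
  show "Q v a" if "val (Minus e (Vr i)) v a = 0"
  proof -
    have "v i = hi" using that I e by simp
    then show ?thesis using I assms(6)[of v a] by simp
  qed
qed (use assms in auto)

end


section \<open>Emitting a contracted instance\<close>

text \<open>
  Variables: 0 answer, 5 stack height, 6 distance of two frames on the stack, 13 and 14 the parameters
  \<open>N\<close> and \<open>k\<close> of the current instance, 21 the parameter \<open>k\<close> of the instance to be pushed. Arrays: 2 parents,
  3 colors, 4 vertex states, 5 admissible colors, 6 renumbering; 7 to 10 are the stack, with the parents
  and colors of frame \<open>i\<close> from index \<open>i * s\<close> on.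
\<close>

definition Emit_row :: com where
  "Emit_row =
     Put 6 (Vr 10) (Cn 0) ;;
     Cond (Ld 4 (Vr 10)) Skip
       (Cond (Ld 5 (Ld 3 (Vr 10)))
         (19 ::= Ld 6 (Ld 2 (Vr 10)) ;;
          Cond (Ne (Ld 4 (Ld 2 (Vr 10))) (Cn (Suc 0))) Skip (19 ::= Cn (Suc 0)) ;;
          Cond (Vr 19)
            (11 ::= Plus (Vr 11) (Cn (Suc 0)) ;;
             Put 6 (Vr 10) (Vr 11) ;;
             Put 9 (Plus (Vr 12) (Vr 11)) (Ld 6 (Ld 2 (Vr 10))) ;;
             Put 10 (Plus (Vr 12) (Vr 11)) (Ld 3 (Vr 10)))
            Skip)
         Skip)"

definition Emit :: com where
  "Emit =
     11 ::= Cn 0 ;;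
     12 ::= Times (Vr 5) (Vr 6) ;;
     10 ::= Cn (Suc 0) ;;
     Put 6 (Cn 0) (Cn 0) ;;
     For 10 (Plus (Vr 13) (Cn (Suc 0))) Emit_row ;;
     Put 7 (Vr 5) (Vr 11) ;;
     Put 8 (Vr 5) (Vr 21) ;;
     5 ::= Plus (Vr 5) (Cn (Suc 0))"

text \<open>The guard makes the recursion well founded. For \<open>rows\<close> it holds at every
  vertex; at 0 it makes the predicate false, as desired for the root.\<close>

function kept :: "(nat \<Rightarrow> nat) \<Rightarrow> (nat \<Rightarrow> nat) \<Rightarrow> (nat \<Rightarrow> nat) \<Rightarrow> nat set \<Rightarrow> nat \<Rightarrow> bool" where
  "kept p c st g j \<longleftrightarrow>
     (if p j < j then st j = 0 \<and> c j \<in> g \<and> (st (p j) = 1 \<or> kept p c st g (p j)) else False)"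
  by pat_completeness auto
termination by (relation "measure (\<lambda>(p, c, st, g, j). j)") auto

declare kept.simps [simp del]

text \<open>Row \<open>j\<close> itself is not counted, so that this is the content of the counter
  when the loop is about to treat row \<open>j\<close>.\<close>

definition nkept :: "(nat \<Rightarrow> nat) \<Rightarrow> (nat \<Rightarrow> nat) \<Rightarrow> (nat \<Rightarrow> nat) \<Rightarrow> nat set \<Rightarrow> nat \<Rightarrow> nat" where
  "nkept p c st g j = card {i \<in> {1..<j}. kept p c st g i}"

definition rank :: "(nat \<Rightarrow> nat) \<Rightarrow> (nat \<Rightarrow> nat) \<Rightarrow> (nat \<Rightarrow> nat) \<Rightarrow> nat set \<Rightarrow> nat \<Rightarrow> nat" where
  "rank p c st g j = (if kept p c st g j then nkept p c st g (Suc j) else 0)"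

lemma kept_0 [simp]: "\<not> kept p c st g 0"
  by (subst kept.simps) simp

lemma rank_0 [simp]: "rank p c st g 0 = 0"
  by (simp add: rank_def)

lemma nkept_1 [simp]: "nkept p c st g (Suc 0) = 0"
  by (simp add: nkept_def)

lemma nkept_Suc: "1 \<le> j \<Longrightarrow> nkept p c st g (Suc j) = nkept p c st g j + (if kept p c st g j then 1 else 0)"
proof -
  assume "1 \<le> j"
  then have "{i \<in> {1..<Suc j}. kept p c st g i} =
      (if kept p c st g j then insert j {i \<in> {1..<j}. kept p c st g i} else {i \<in> {1..<j}. kept p c st g i})"
    by (auto simp: less_Suc_eq)
  then show ?thesis by (simp add: nkept_def)
qed

lemma nkept_mono: "i \<le> j \<Longrightarrow> nkept p c st g i \<le> nkept p c st g j"
  unfolding nkept_def by (intro card_mono) auto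

lemma nkept_less: "nkept p c st g j \<le> j - 1"
proof -
  have "{i \<in> {1..<j}. kept p c st g i} \<subseteq> {1..<j}" by blast
  from card_mono[OF _ this] show ?thesis by (simp add: nkept_def)
qed

lemma rank_eq_0: "1 \<le> j \<Longrightarrow> rank p c st g j = 0 \<longleftrightarrow> \<not> kept p c st g j"
  by (simp add: rank_def nkept_Suc)

lemma rank_le: "i < j \<Longrightarrow> rank p c st g i \<le> nkept p c st g j"
  by (simp add: rank_def nkept_mono)

lemma rank_emission:
  assumes "rows N p" "st 0 = 1" "\<And>j. j \<in> {1..N} \<Longrightarrow> st j = 1 \<Longrightarrow> st (p j) = 1"
    and ren: "\<And>j. j \<le> N \<Longrightarrow> ren j = rank p c st g j"
    and "\<And>j. j \<in> {1..N} \<Longrightarrow> kept p c st g j \<Longrightarrow> p' (rank p c st g j) = rank p c st g (p j)"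
    and "\<And>j. j \<in> {1..N} \<Longrightarrow> kept p c st g j \<Longrightarrow> c' (rank p c st g j) = c j"
    and "N' = nkept p c st g (Suc N)"
  shows "emission N p c st g ren N' p' c'"
proof
  have p: "p j < j" if "j \<in> {1..N}" for j using assms(1) that by (auto simp: rows_def)
  have k: "ren j \<noteq> 0 \<longleftrightarrow> kept p c st g j" if "j \<in> {1..N}" for j using that ren[of j] rank_eq_0[of j] by auto
  fix j assume j: "j \<in> {1..N}"
  have pj: "ren (p j) = rank p c st g (p j)" using p[OF j] j by (intro ren) auto
  have "rank p c st g (p j) \<noteq> 0 \<longleftrightarrow> kept p c st g (p j)"
    by (cases "p j = 0") (auto simp: rank_eq_0)
  then show "ren j \<noteq> 0 \<longleftrightarrow> st j = 0 \<and> c j \<in> g \<and> (st (p j) = 1 \<or> ren (p j) \<noteq> 0)"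
    unfolding k[OF j] pj using p[OF j] by (subst kept.simps) simp
  assume r: "ren j \<noteq> 0"
  then have kj: "kept p c st g j" using k[OF j] by simp
  have "{i \<in> {1..j}. ren i \<noteq> 0} = {i \<in> {1..<Suc j}. kept p c st g i}" using k j by auto
  then show "ren j = card {i \<in> {1..j}. ren i \<noteq> 0}" using ren[of j] j kj by (simp add: rank_def nkept_def)
  show "p' (ren j) = ren (p j)" "c' (ren j) = c j" using assms(5,6)[OF j kj] ren[of j] j pj by auto
next
  have "{i \<in> {1..N}. ren i \<noteq> 0} = {i \<in> {1..<Suc N}. kept p c st g i}"
    using ren rank_eq_0[of _ p c st g] by fastforce
  then show "N' = card {i \<in> {1..N}. ren i \<noteq> 0}" using assms(7) by (simp add: nkept_def)
qed (use assms in auto)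

context machine
begin

text \<open>The pair \<open>v a\<close> is the state at the start of \<open>Emit\<close>, and
  \<open>v' a'\<close> the state before row \<open>j\<close> is treated. Rows are numbered from 1,
  so all frames below the new one lie in cells up to \<open>b\<close> and are preserved.\<close>

definition emit_inv :: "vars \<Rightarrow> arrs \<Rightarrow> nat \<Rightarrow> vars \<Rightarrow> arrs \<Rightarrow> bool" where
  "emit_inv v a j v' a' \<longleftrightarrow>
     (let R = rank (a 2) (a 3) (a 4) {x. a 5 x \<noteq> 0}; K = kept (a 2) (a 3) (a 4) {x. a 5 x \<noteq> 0}; b = v 5 * v 6
      in 1 \<le> j \<and> v' 11 = nkept (a 2) (a 3) (a 4) {x. a 5 x \<noteq> 0} j \<and> v' 12 = b \<and>
        (\<forall>x. x \<notin> {10, 11, 12, 19} \<longrightarrow> v' x = v x) \<and>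
        (\<forall>r. r \<notin> {6, 9, 10} \<longrightarrow> a' r = a r) \<and>
        (\<forall>x\<le>b. a' 9 x = a 9 x \<and> a' 10 x = a 10 x) \<and>
        (\<forall>i<j. a' 6 i = R i) \<and>
        (\<forall>i<j. K i \<longrightarrow> a' 9 (b + R i) = R (a 2 i) \<and> a' 10 (b + R i) = a 3 i))"

text \<open>As \<open>a 2 j < j\<close>, the new number of the parent is already in array 6. The new
  row gets a larger number than all earlier ones, so the cells written before stay as they
  are.\<close>

lemma emit_row:
  assumes N: "rows (v 13) (a 2)" "v 13 < v 6" "Suc (v 5) * v 6 < B" "1 < B"
    and c: "\<And>j. j \<in> {1..v 13} \<Longrightarrow> a 3 j < B"
    and I: "emit_inv v a j v' a'" "v' 10 = j" "j < Suc (v 13)"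
  shows "runs Emit_row v' a' 12 (\<lambda>v' a'. v' 10 = j \<and> emit_inv v a (Suc j) (v'(10 := Suc j)) a')"
proof -
  let ?g = "{x. a 5 x \<noteq> 0}"
  define R where "R = rank (a 2) (a 3) (a 4) ?g"
  define K where "K = kept (a 2) (a 3) (a 4) ?g"
  define q where "q = nkept (a 2) (a 3) (a 4) ?g"
  define b where "b = v 5 * v 6"
  have inv: "1 \<le> j" "v' 11 = q j" "v' 12 = b" "\<And>x. x \<notin> {10, 11, 12, 19} \<Longrightarrow> v' x = v x"
    "\<And>r. r \<notin> {6, 9, 10} \<Longrightarrow> a' r = a r" "\<And>x. x \<le> b \<Longrightarrow> a' 9 x = a 9 x \<and> a' 10 x = a 10 x"
    "\<And>i. i < j \<Longrightarrow> a' 6 i = R i"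
    "\<And>i. i < j \<Longrightarrow> K i \<Longrightarrow> a' 9 (b + R i) = R (a 2 i) \<and> a' 10 (b + R i) = a 3 i"
    using I(1) by (auto simp: emit_inv_def Let_def R_def K_def q_def b_def)
  have arr: "a' 2 = a 2" "a' 3 = a 3" "a' 4 = a 4" "a' 5 = a 5" using inv(5) by auto
  have pj: "a 2 j < j" using N(1) inv(1) I(3) by (auto simp: rows_def)
  have bs: "b + v 6 < B" using N(3) by (simp add: b_def algebra_simps)
  have qj: "q j < j" using nkept_less[of _ _ _ _ j] inv(1) by (simp add: q_def less_eq_Suc_le le_diff_conv2)
  have bounds: "j < B" "a 2 j < B" "a 3 j < B" "b + Suc (q j) < B" "Suc (q j) < B" "0 < B" "Suc 0 < B" "b < B"
    using pj c[of j] inv(1) I(3) bs N(2,4) qj by auto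
  have Kj: "K j \<longleftrightarrow> a 4 j = 0 \<and> a 5 (a 3 j) \<noteq> 0 \<and> (a 4 (a 2 j) = 1 \<or> R (a 2 j) \<noteq> 0)"
  proof -
    have "R (a 2 j) \<noteq> 0 \<longleftrightarrow> K (a 2 j)"
      by (cases "a 2 j = 0") (auto simp: R_def K_def rank_eq_0)
    then show ?thesis unfolding K_def using pj by (subst kept.simps) simp
  qed
  have qS: "q (Suc j) = q j + (if K j then 1 else 0)" unfolding q_def K_def by (rule nkept_Suc[OF inv(1)])
  have Rj: "R j = (if K j then Suc (q j) else 0)" using qS by (simp add: R_def K_def q_def rank_def)
  have Rle: "R i \<le> q j" if "i < j" for i using rank_le[OF that] by (simp add: R_def q_def)
  have old: "a' 6 (a 2 j) = R (a 2 j)" using inv(7)[OF pj] .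
  have goal: "emit_inv v a (Suc j) (v''(10 := Suc j)) a''"
    if "\<And>x. x \<notin> {10, 11, 19} \<Longrightarrow> v'' x = v' x" "v'' 11 = q (Suc j)" "\<And>r. r \<notin> {6, 9, 10} \<Longrightarrow> a'' r = a' r" "a'' 6 = (a' 6)(j := R j)"
      "a'' 9 = (if K j then (a' 9)(b + Suc (q j) := R (a 2 j)) else a' 9)"
      "a'' 10 = (if K j then (a' 10)(b + Suc (q j) := a 3 j) else a' 10)" for v'' a''
    unfolding emit_inv_def Let_def R_def[symmetric] K_def[symmetric] q_def[symmetric] b_def[symmetric]
  proof (intro conjI allI impI)
    fix i assume i: "i < Suc j"
    show "a'' 6 i = R i" using that(4) inv(7) i by (auto simp: less_Suc_eq)
    assume Ki: "K i"
    show "a'' 9 (b + R i) = R (a 2 i)" "a'' 10 (b + R i) = a 3 i"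
      using that(5,6) inv(8)[of i] Ki i Rle[of i] Rj by (auto simp: less_Suc_eq)
  next
    fix x assume "x \<le> b"
    then show "a'' 9 x = a 9 x" "a'' 10 x = a 10 x" using that(5,6) inv(6)[of x] by auto
  next
    fix r assume "r \<notin> {6, 9, 10::nat}"
    then show "a'' r = a r" using that(3) inv(5) by metis
  qed (use inv that(1,2) in auto)
  consider "a 4 j \<noteq> 0" | "a 4 j = 0" "a 5 (a 3 j) = 0"
    | "a 4 j = 0" "a 5 (a 3 j) \<noteq> 0" "\<not> K j" | "a 4 j = 0" "a 5 (a 3 j) \<noteq> 0" "K j" by blast
  then show ?thesis
  proof cases
    case 1
    then have "\<not> K j" using Kj by simp
    then show ?thesis unfolding Emit_row_def
      using 1 bounds I(2) inv(2) by (simp add: arr) (rule goal; simp add: Rj qS)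
  next
    case 2
    then have "\<not> K j" using Kj by simp
    then show ?thesis unfolding Emit_row_def
      using 2 bounds I(2) inv(2) by (simp add: arr) (rule goal; simp add: Rj qS)
  next
    case 3
    then have "a 4 (a 2 j) \<noteq> 1" "R (a 2 j) = 0" using Kj by auto
    then show ?thesis unfolding Emit_row_def
      using 3 bounds I(2) inv(2) pj old by (simp add: arr) (rule goal; simp add: Rj qS)
  next
    case 4
    then show ?thesis unfolding Emit_row_def
      using bounds I(2) inv(2,3) pj old Kj
      by (simp add: arr) (intro conjI impI; rule goal; simp add: Rj qS)
  qed
qed

lemma emit_pushes:
  assumes rows: "rows (v 13) (a 2)" and N: "v 13 < v 6" "Suc (v 5) * v 6 < B" "1 < B"
    and c: "\<And>j. j \<in> {1..v 13} \<Longrightarrow> a 3 j < B"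
    and st: "a 4 0 = 1" "\<And>j. j \<in> {1..v 13} \<Longrightarrow> a 4 j = 1 \<Longrightarrow> a 4 (a 2 j) = 1"
  shows "runs Emit v a (14 * v 13 + 8) (\<lambda>v' a'.
    emission (v 13) (a 2) (a 3) (a 4) {x. a 5 x \<noteq> 0} (a' 6) (a' 7 (v 5))
      (\<lambda>j. a' 9 (v 5 * v 6 + j)) (\<lambda>j. a' 10 (v 5 * v 6 + j)) \<and>
    v' 5 = Suc (v 5) \<and> a' 8 (v 5) = v 21 \<and>
    (\<forall>x. x \<notin> {5, 10, 11, 12, 19} \<longrightarrow> v' x = v x) \<and>
    (\<forall>r. r \<notin> {6, 7, 8, 9, 10} \<longrightarrow> a' r = a r) \<and>
    (\<forall>i. i \<noteq> v 5 \<longrightarrow> a' 7 i = a 7 i \<and> a' 8 i = a 8 i) \<and>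
    (\<forall>x\<le>v 5 * v 6. a' 9 x = a 9 x \<and> a' 10 x = a 10 x))" (is "runs _ _ _ _ ?Q")
proof -
  let ?b = "v 5 * v 6" and ?g = "{x. a 5 x \<noteq> 0}"
  have b: "?b < B" "Suc (v 13) < B" "v 5 < B" "Suc (v 5) < B" "0 < B" "Suc 0 < B"
  proof -
    have "?b + v 6 < B" using N(2) by simp
    moreover have "v 5 \<le> ?b" using N(1) by simp
    ultimately show "?b < B" "Suc (v 13) < B" "v 5 < B" "Suc (v 5) < B" "0 < B" "Suc 0 < B"
      using N by linarith+
  qed
  let ?v = "v(11 := 0, 12 := ?b, 10 := Suc 0)" and ?a = "a(6 := (a 6)(0 := 0))"
  have fin: "runs (Put 7 (Vr 5) (Vr 11) ;; Put 8 (Vr 5) (Vr 21) ;; 5 ::= Plus (Vr 5) (Cn (Suc 0))) v' a' 3 ?Q"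
    if I: "emit_inv v a (Suc (v 13)) v' a'" for v' a'
  proof -
    have v': "v' 5 = v 5" "v' 21 = v 21" "v' 11 = nkept (a 2) (a 3) (a 4) ?g (Suc (v 13))"
      and a': "a' 7 = a 7" "a' 8 = a 8" using I by (auto simp: emit_inv_def Let_def)
    have "emission (v 13) (a 2) (a 3) (a 4) ?g (a' 6) (nkept (a 2) (a 3) (a 4) ?g (Suc (v 13)))
      (\<lambda>j. a' 9 (?b + j)) (\<lambda>j. a' 10 (?b + j))"
      by (rule rank_emission) (use I rows st in \<open>auto simp: emit_inv_def Let_def\<close>)
    then show ?thesis using I b by (simp add: v' a') (auto simp: emit_inv_def Let_def)
  qed
  have loop: "runs (For 10 (Plus (Vr 13) (Cn (Suc 0))) Emit_row) ?v ?a (14 * v 13 + 1)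
      (\<lambda>v' a'. runs (Put 7 (Vr 5) (Vr 11) ;; Put 8 (Vr 5) (Vr 21) ;; 5 ::= Plus (Vr 5) (Cn (Suc 0))) v' a' 3 ?Q)"
  proof (rule runs_For[where I = "emit_inv v a" and hi = "Suc (v 13)" and T = 12])
    show "emit_inv v a (?v 10) ?v ?a" by (auto simp: emit_inv_def Let_def less_Suc_eq)
    show "ok (Plus (Vr 13) (Cn (Suc 0))) v' a' \<and> val (Plus (Vr 13) (Cn (Suc 0))) v' a' = Suc (v 13)"
      if "emit_inv v a k v' a'" for k v' a' using that b by (auto simp: emit_inv_def Let_def)
    show "runs Emit_row v' a' 12 (\<lambda>v' a'. v' 10 = k \<and> emit_inv v a (Suc k) (v'(10 := Suc k)) a')"
      if "emit_inv v a k v' a'" "v' 10 = k" "k < Suc (v 13)" for k v' a'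
      by (rule emit_row[OF rows N c that])
    show "runs (Put 7 (Vr 5) (Vr 11) ;; Put 8 (Vr 5) (Vr 21) ;; 5 ::= Plus (Vr 5) (Cn (Suc 0))) v' a' 3 ?Q"
      if "emit_inv v a (Suc (v 13)) v' a'" for v' a' by (rule fin[OF that])
  qed (use b in simp_all)
  have "runs (For 10 (Plus (Vr 13) (Cn (Suc 0))) Emit_row ;;
      Put 7 (Vr 5) (Vr 11) ;; Put 8 (Vr 5) (Vr 21) ;; 5 ::= Plus (Vr 5) (Cn (Suc 0))) ?v ?a (14 * v 13 + 4) ?Q"
    by (rule runs_Seq[OF loop]) simp
  then show ?thesis unfolding Emit_def using b by (simp add: add.commute)
qed

end


section \<open>The search\<close>

text \<open>
  Variables: 15 number of colors, 16 a vertex whose color is unique, 17 a vertex that is not a child of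
  the root (0 if there is none), 18 the vertex to branch on. Array 11 counts the colors.
\<close>

definition Load_rows :: com where
  "Load_rows = For 10 (Plus (Vr 13) (Cn (Suc 0)))
     (Put 2 (Vr 10) (Ld 9 (Plus (Vr 12) (Vr 10))) ;;
      Put 3 (Vr 10) (Ld 10 (Plus (Vr 12) (Vr 10))) ;;
      Put 4 (Vr 10) (Cn 0) ;;
      Put 5 (Ld 3 (Vr 10)) (Cn (Suc 0)) ;;
      Put 11 (Ld 3 (Vr 10)) (Cn 0))"

definition Count_colors :: com where
  "Count_colors = For 10 (Plus (Vr 13) (Cn (Suc 0)))
     (Cond (Ld 11 (Ld 3 (Vr 10))) Skip (15 ::= Plus (Vr 15) (Cn (Suc 0))) ;;
      Put 11 (Ld 3 (Vr 10)) (Plus (Ld 11 (Ld 3 (Vr 10))) (Cn (Suc 0))))"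

definition Find_rows :: com where
  "Find_rows = For 10 (Plus (Vr 13) (Cn (Suc 0)))
     (Cond (Ne (Ld 11 (Ld 3 (Vr 10))) (Cn (Suc 0))) Skip (16 ::= Vr 10) ;;
      Cond (Ld 2 (Vr 10)) (17 ::= Vr 10) Skip)"

definition Climb :: com where
  "Climb = Loop (Ld 2 (Vr 18)) (18 ::= Ld 2 (Vr 18))"

text \<open>The frame for taking vertex 18 is pushed in every case, and its size decides whether
  dropping the vertex has to be tried: the difference is positive iff at least three rows were lost.
  For the second frame the marks of the first are overwritten in two cells instead of being
  rebuilt.\<close>

definition Branch :: com where
  "Branch =
     Cond (Vr 16) (18 ::= Vr 16) (18 ::= Vr 17) ;;
     Climb ;;
     Put 4 (Cn 0) (Cn (Suc 0)) ;;
     Put 4 (Vr 18) (Cn (Suc 0)) ;;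
     Put 5 (Ld 3 (Vr 18)) (Cn 0) ;;
     21 ::= Minus (Vr 14) (Cn (Suc 0)) ;;
     Emit ;;
     Cond (Vr 16) Skip
       (Cond (Minus (Vr 13) (Plus (Ld 7 (Minus (Vr 5) (Cn (Suc 0)))) (Cn 2)))
         (Put 4 (Vr 18) (Cn 2) ;;
          Put 5 (Ld 3 (Vr 18)) (Cn (Suc 0)) ;;
          21 ::= Vr 14 ;;
          Emit)
         Skip)"

text \<open>The popped frame is copied to the arrays 2 and 3 because new frames are written over its
  slot. A frame with too few colors is simply discarded; success empties the stack, which ends the
  search.\<close>

definition Search_step :: com where
  "Search_step =
     5 ::= Minus (Vr 5) (Cn (Suc 0)) ;;
     13 ::= Ld 7 (Vr 5) ;;
     14 ::= Ld 8 (Vr 5) ;;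
     12 ::= Times (Vr 5) (Vr 6) ;;
     10 ::= Cn (Suc 0) ;;
     Load_rows ;;
     15 ::= Cn 0 ;;
     10 ::= Cn (Suc 0) ;;
     Count_colors ;;
     16 ::= Cn 0 ;;
     17 ::= Cn 0 ;;
     10 ::= Cn (Suc 0) ;;
     Find_rows ;;
     Cond (Minus (Vr 14) (Vr 15)) Skip
       (Cond (Vr 17) Branch (0 ::= Cn (Suc 0) ;; 5 ::= Cn 0))"

definition Search :: com where
  "Search = Loop (Vr 5) Search_step"

section \<open>Effect of the loops that scan a frame\<close>

lemma ball_less_Suc: "1 \<le> k \<Longrightarrow> (\<forall>j\<in>{1..<Suc k}. P j) \<longleftrightarrow> (\<forall>j\<in>{1..<k}. P j) \<and> P k"
  by (auto simp: less_Suc_eq)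

lemma card_filter_less: "card {i \<in> {1..<k}. P i} \<le> k - 1"
  using card_mono[OF _ Collect_restrict, of "{1..<k}"] by simp

lemma card_filter_less_Suc:
  "1 \<le> k \<Longrightarrow> card {i \<in> {1..<Suc k}. P i} = card {i \<in> {1..<k}. P i} + (if P k then 1 else 0)"
proof -
  assume "1 \<le> k"
  then have "{i \<in> {1..<Suc k}. P i} = (if P k then insert k {i \<in> {1..<k}. P i} else {i \<in> {1..<k}. P i})"
    by (auto simp: less_Suc_eq)
  then show ?thesis by simp
qed

lemma card_image_less_Suc:
  assumes "1 \<le> k"
  shows "card (c ` {1..<Suc k}) = card (c ` {1..<k}) + (if card {i \<in> {1..<k}. c i = c k} = 0 then 1 else 0)"
proof -
  have "c ` {1..<Suc k} = insert (c k) (c ` {1..<k})" using assms by (auto simp: less_Suc_eq)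
  moreover have "card {i \<in> {1..<k}. c i = c k} = 0 \<longleftrightarrow> c k \<notin> c ` {1..<k}"
    by (auto simp: image_iff) (metis atLeastLessThan_iff One_nat_def)
  ultimately show ?thesis by (simp add: card_insert_if)
qed

context machine
begin

text \<open>The arrays 5 and 11 are indexed by colors and reset only at the colors of this frame;
  elsewhere they may hold remnants of other frames, and nothing is claimed there.\<close>

lemma load_rows:
  assumes "v 10 = 1" "v 12 + v 13 < B" "v 13 + 1 < B"
    and "\<And>j. j \<in> {1..v 13} \<Longrightarrow> a 10 (v 12 + j) < B"
  shows "runs Load_rows v a (7 * v 13 + 1) (\<lambda>v' a'. (\<forall>x. x \<noteq> 10 \<longrightarrow> v' x = v x) \<and>
    (\<forall>r. r \<notin> {2, 3, 4, 5, 11} \<longrightarrow> a' r = a r) \<and>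
    (\<forall>j\<in>{1..v 13}. a' 2 j = a 9 (v 12 + j) \<and> a' 3 j = a 10 (v 12 + j) \<and> a' 4 j = 0 \<and>
       a' 5 (a 10 (v 12 + j)) = 1 \<and> a' 11 (a 10 (v 12 + j)) = 0))"
  unfolding Load_rows_def
proof (rule runs_For[where hi = "Suc (v 13)" and T = 5 and I = "\<lambda>k v' a'. 1 \<le> k \<and> (\<forall>x. x \<noteq> 10 \<longrightarrow> v' x = v x) \<and>
    (\<forall>r. r \<notin> {2, 3, 4, 5, 11} \<longrightarrow> a' r = a r) \<and>
    (\<forall>j\<in>{1..<k}. a' 2 j = a 9 (v 12 + j) \<and> a' 3 j = a 10 (v 12 + j) \<and> a' 4 j = 0 \<and>
       a' 5 (a 10 (v 12 + j)) = 1 \<and> a' 11 (a 10 (v 12 + j)) = 0)"])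
  fix k v' a' assume I: "1 \<le> k \<and> (\<forall>x. x \<noteq> 10 \<longrightarrow> v' x = v x) \<and>
    (\<forall>r. r \<notin> {2, 3, 4, 5, 11} \<longrightarrow> a' r = a r) \<and>
    (\<forall>j\<in>{1..<k}. a' 2 j = a 9 (v 12 + j) \<and> a' 3 j = a 10 (v 12 + j) \<and> a' 4 j = 0 \<and>
       a' 5 (a 10 (v 12 + j)) = 1 \<and> a' 11 (a 10 (v 12 + j)) = 0)" and k: "v' 10 = k" "k < Suc (v 13)"
  have v': "v' 12 = v 12" "v' 13 = v 13" and a': "a' 9 = a 9" "a' 10 = a 10" using I by auto
  have b: "k < B" "v 12 + k < B" "a 10 (v 12 + k) < B" "Suc 0 < B" "0 < B" using assms(2-4) I k by auto
  show "runs (Put 2 (Vr 10) (Ld 9 (Plus (Vr 12) (Vr 10))) ;;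
      Put 3 (Vr 10) (Ld 10 (Plus (Vr 12) (Vr 10))) ;;
      Put 4 (Vr 10) (Cn 0) ;;
      Put 5 (Ld 3 (Vr 10)) (Cn (Suc 0)) ;;
      Put 11 (Ld 3 (Vr 10)) (Cn 0)) v' a' 5
     (\<lambda>v' a'. v' 10 = k \<and> 1 \<le> Suc k \<and> (\<forall>x. x \<noteq> 10 \<longrightarrow> (v'(10 := Suc k)) x = v x) \<and>
    (\<forall>r. r \<notin> {2, 3, 4, 5, 11} \<longrightarrow> a' r = a r) \<and>
    (\<forall>j\<in>{1..<Suc k}. a' 2 j = a 9 (v 12 + j) \<and> a' 3 j = a 10 (v 12 + j) \<and> a' 4 j = 0 \<and>
       a' 5 (a 10 (v 12 + j)) = 1 \<and> a' 11 (a 10 (v 12 + j)) = 0))"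
    using I k b by (auto simp: v' a' less_Suc_eq)
qed (use assms in \<open>auto simp: less_Suc_eq_le\<close>)

lemma count_colors:
  assumes "v 10 = 1" "v 15 = 0" "v 13 + 1 < B"
    and "\<And>j. j \<in> {1..v 13} \<Longrightarrow> a 3 j < B \<and> a 11 (a 3 j) = 0"
  shows "runs Count_colors v a (5 * v 13 + 1) (\<lambda>v' a'. (\<forall>x. x \<notin> {10, 15} \<longrightarrow> v' x = v x) \<and>
    (\<forall>r. r \<noteq> 11 \<longrightarrow> a' r = a r) \<and> v' 15 = card (a 3 ` {1..v 13}) \<and>
    (\<forall>j\<in>{1..v 13}. a' 11 (a 3 j) = card {i \<in> {1..v 13}. a 3 i = a 3 j}))"
  unfolding Count_colors_def
proof (rule runs_For[where hi = "Suc (v 13)" and T = 3 and I = "\<lambda>k v' a'. 1 \<le> k \<and>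
    (\<forall>x. x \<notin> {10, 15} \<longrightarrow> v' x = v x) \<and> (\<forall>r. r \<noteq> 11 \<longrightarrow> a' r = a r) \<and> v' 15 = card (a 3 ` {1..<k}) \<and>
    (\<forall>j\<in>{1..v 13}. a' 11 (a 3 j) = card {i \<in> {1..<k}. a 3 i = a 3 j})"])
  fix k v' a' assume I: "1 \<le> k \<and>
    (\<forall>x. x \<notin> {10, 15} \<longrightarrow> v' x = v x) \<and> (\<forall>r. r \<noteq> 11 \<longrightarrow> a' r = a r) \<and> v' 15 = card (a 3 ` {1..<k}) \<and>
    (\<forall>j\<in>{1..v 13}. a' 11 (a 3 j) = card {i \<in> {1..<k}. a 3 i = a 3 j})" and k: "v' 10 = k" "k < Suc (v 13)"
  have a': "a' 3 = a 3" and v15: "v' 15 = card (a 3 ` {1..<k})" using I by auto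
  have k1: "1 \<le> k" and cnt: "a' 11 (a 3 k) = card {i \<in> {1..<k}. a 3 i = a 3 k}" using I k by auto
  have le: "card (a 3 ` {1..<k}) \<le> k - 1" "card {i \<in> {1..<k}. a 3 i = a 3 k} \<le> k - 1"
    using card_image_le[of "{1..<k}" "a 3"] card_filter_less[of k "\<lambda>i. a 3 i = a 3 k"] by auto
  have b: "k < B" "a 3 k < B" "Suc 0 < B" "Suc (card (a 3 ` {1..<k})) < B"
    "Suc (card {i \<in> {1..<k}. a 3 i = a 3 k}) < B"
    using assms(3,4) I k le by auto
  have new: "((a' 11)(a 3 k := Suc (card {i \<in> {1..<k}. a 3 i = a 3 k}))) (a 3 j) =
      card {i \<in> {1..<Suc k}. a 3 i = a 3 j}" if "j \<in> {1..v 13}" for j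
    using I that card_filter_less_Suc[OF k1, of "\<lambda>i. a 3 i = a 3 j"] by (auto simp: eq_commute[of "a 3 k"])
  show "runs (Cond (Ld 11 (Ld 3 (Vr 10))) Skip (15 ::= Plus (Vr 15) (Cn (Suc 0))) ;;
      Put 11 (Ld 3 (Vr 10)) (Plus (Ld 11 (Ld 3 (Vr 10))) (Cn (Suc 0)))) v' a' 3
    (\<lambda>v' a'. v' 10 = k \<and> 1 \<le> Suc k \<and>
    (\<forall>x. x \<notin> {10, 15} \<longrightarrow> (v'(10 := Suc k)) x = v x) \<and> (\<forall>r. r \<noteq> 11 \<longrightarrow> a' r = a r) \<and>
    (v'(10 := Suc k)) 15 = card (a 3 ` {1..<Suc k}) \<and>
    (\<forall>j\<in>{1..v 13}. a' 11 (a 3 j) = card {i \<in> {1..<Suc k}. a 3 i = a 3 j}))"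
    unfolding card_image_less_Suc[OF k1]
    using I k b new unfolding cnt[symmetric] by (simp add: a' v15)
qed (use assms in \<open>auto simp: atLeastLessThanSuc_atLeastAtMost\<close>)

lemma find_rows:
  assumes "v 10 = 1" "v 16 = 0" "v 17 = 0" "v 13 + 1 < B" "\<And>j. j \<in> {1..v 13} \<Longrightarrow> a 3 j < B"
  shows "runs Find_rows v a (6 * v 13 + 1) (\<lambda>v' a'. (\<forall>x. x \<notin> {10, 16, 17} \<longrightarrow> v' x = v x) \<and> a' = a \<and>
    (v' 16 \<noteq> 0 \<longrightarrow> v' 16 \<in> {1..v 13} \<and> a 11 (a 3 (v' 16)) = 1) \<and>
    (v' 16 = 0 \<longrightarrow> (\<forall>j\<in>{1..v 13}. a 11 (a 3 j) \<noteq> 1)) \<and>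
    (v' 17 \<noteq> 0 \<longrightarrow> v' 17 \<in> {1..v 13} \<and> a 2 (v' 17) \<noteq> 0) \<and>
    (v' 17 = 0 \<longrightarrow> (\<forall>j\<in>{1..v 13}. a 2 j = 0)))"
  unfolding Find_rows_def
proof (rule runs_For[where hi = "Suc (v 13)" and T = 4 and I = "\<lambda>k v' a'. 1 \<le> k \<and>
    (\<forall>x. x \<notin> {10, 16, 17} \<longrightarrow> v' x = v x) \<and> a' = a \<and>
    (v' 16 \<noteq> 0 \<longrightarrow> v' 16 \<in> {1..v 13} \<and> a 11 (a 3 (v' 16)) = 1) \<and>
    (v' 16 = 0 \<longrightarrow> (\<forall>j\<in>{1..<k}. a 11 (a 3 j) \<noteq> 1)) \<and>
    (v' 17 \<noteq> 0 \<longrightarrow> v' 17 \<in> {1..v 13} \<and> a 2 (v' 17) \<noteq> 0) \<and>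
    (v' 17 = 0 \<longrightarrow> (\<forall>j\<in>{1..<k}. a 2 j = 0))"])
  fix k v' a' assume I: "1 \<le> k \<and>
    (\<forall>x. x \<notin> {10, 16, 17} \<longrightarrow> v' x = v x) \<and> a' = a \<and>
    (v' 16 \<noteq> 0 \<longrightarrow> v' 16 \<in> {1..v 13} \<and> a 11 (a 3 (v' 16)) = 1) \<and>
    (v' 16 = 0 \<longrightarrow> (\<forall>j\<in>{1..<k}. a 11 (a 3 j) \<noteq> 1)) \<and>
    (v' 17 \<noteq> 0 \<longrightarrow> v' 17 \<in> {1..v 13} \<and> a 2 (v' 17) \<noteq> 0) \<and>
    (v' 17 = 0 \<longrightarrow> (\<forall>j\<in>{1..<k}. a 2 j = 0))" and k: "v' 10 = k" "k < Suc (v 13)"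
  have b: "k < B" "a 3 k < B" "Suc 0 < B" using assms(4,5) I k by auto
  have a': "a' = a" and k1: "1 \<le> k" using I by simp_all
  show "runs (Cond (Ne (Ld 11 (Ld 3 (Vr 10))) (Cn (Suc 0))) Skip (16 ::= Vr 10) ;;
      Cond (Ld 2 (Vr 10)) (17 ::= Vr 10) Skip) v' a' 4
    (\<lambda>v' a'. v' 10 = k \<and> 1 \<le> Suc k \<and>
    (\<forall>x. x \<notin> {10, 16, 17} \<longrightarrow> (v'(10 := Suc k)) x = v x) \<and> a' = a \<and>
    ((v'(10 := Suc k)) 16 \<noteq> 0 \<longrightarrow> (v'(10 := Suc k)) 16 \<in> {1..v 13} \<and> a 11 (a 3 ((v'(10 := Suc k)) 16)) = 1) \<and>
    ((v'(10 := Suc k)) 16 = 0 \<longrightarrow> (\<forall>j\<in>{1..<Suc k}. a 11 (a 3 j) \<noteq> 1)) \<and>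
    ((v'(10 := Suc k)) 17 \<noteq> 0 \<longrightarrow> (v'(10 := Suc k)) 17 \<in> {1..v 13} \<and> a 2 ((v'(10 := Suc k)) 17) \<noteq> 0) \<and>
    ((v'(10 := Suc k)) 17 = 0 \<longrightarrow> (\<forall>j\<in>{1..<Suc k}. a 2 j = 0)))"
    unfolding ball_less_Suc[OF k1]
    using I k b by (cases "a 11 (a 3 k) = Suc 0"; cases "a 2 k = 0"; simp add: a')
qed (use assms in \<open>auto simp: less_Suc_eq_le\<close>)

text \<open>Every set closed under parents that contains the start contains all vertices passed, so
  the child of the root that is reached lies in each solution containing the start. The final
  disjunction serves the start at a vertex that is not a child of the root: the vertex reached then
  has a child.\<close>

lemma climb:
  assumes "rows N (a 2)" "v 18 \<in> {1..N}" "N < B"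
  shows "runs Climb v a (2 * N + 1) (\<lambda>v' a'. (\<forall>x. x \<noteq> 18 \<longrightarrow> v' x = v x) \<and> a' = a \<and>
    v' 18 \<in> {1..N} \<and> a 2 (v' 18) = 0 \<and> (\<forall>S. up_closed (a 2) S \<longrightarrow> v 18 \<in> S \<longrightarrow> v' 18 \<in> S) \<and>
    (v' 18 = v 18 \<or> (\<exists>y\<in>{1..N}. a 2 y = v' 18)))"
  unfolding Climb_def
proof (rule runs_Loop[where k = "v 18" and T = 1 and I = "\<lambda>k v' a'. (\<forall>x. x \<noteq> 18 \<longrightarrow> v' x = v x) \<and> a' = a \<and>
    v' 18 \<in> {1..N} \<and> v' 18 \<le> k \<and> (\<forall>S. up_closed (a 2) S \<longrightarrow> v 18 \<in> S \<longrightarrow> v' 18 \<in> S) \<and>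
    (v' 18 = v 18 \<or> (\<exists>y\<in>{1..N}. a 2 y = v' 18))"])
  fix k v' a' assume I: "(\<forall>x. x \<noteq> 18 \<longrightarrow> v' x = v x) \<and> a' = a \<and>
    v' 18 \<in> {1..N} \<and> v' 18 \<le> k \<and> (\<forall>S. up_closed (a 2) S \<longrightarrow> v 18 \<in> S \<longrightarrow> v' 18 \<in> S) \<and>
    (v' 18 = v 18 \<or> (\<exists>y\<in>{1..N}. a 2 y = v' 18))"
  then show "ok (Ld 2 (Vr 18)) v' a'" using assms by auto
  assume nz: "val (Ld 2 (Vr 18)) v' a' \<noteq> 0"
  have less: "a 2 (v' 18) < v' 18" using assms(1) I by (auto simp: rows_def)
  moreover have "\<forall>S. up_closed (a 2) S \<longrightarrow> v 18 \<in> S \<longrightarrow> a 2 (v' 18) \<in> S"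
  proof (intro allI impI)
    fix S assume S: "up_closed (a 2) S" "v 18 \<in> S"
    then have "v' 18 \<in> S" using I by blast
    then show "a 2 (v' 18) \<in> S" using S(1) nz I unfolding up_closed_def by auto
  qed
  ultimately show "0 < k \<and> runs (18 ::= Ld 2 (Vr 18)) v' a' 1 (\<lambda>v' a'. (\<forall>x. x \<noteq> 18 \<longrightarrow> v' x = v x) \<and> a' = a \<and>
    v' 18 \<in> {1..N} \<and> v' 18 \<le> k - 1 \<and> (\<forall>S. up_closed (a 2) S \<longrightarrow> v 18 \<in> S \<longrightarrow> v' 18 \<in> S) \<and>
    (v' 18 = v 18 \<or> (\<exists>y\<in>{1..N}. a 2 y = v' 18)))"
    using I nz assms(3) by (intro conjI) (simp, simp, fastforce)
qed (use assms in auto)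

section \<open>Frames on the stack and the invariant of the search\<close>

definition fsol :: "nat \<Rightarrow> arrs \<Rightarrow> nat \<Rightarrow> bool" where
  "fsol s a i \<longleftrightarrow> sol (a 7 i) (a 8 i) (\<lambda>j. a 9 (i * s + j)) (\<lambda>j. a 10 (i * s + j))"

text \<open>The sum of slot number and row count is what bounds the stack. The frame pushed into the
  slot of the popped one has at least one row less and the frame above it at least two less, so the
  sum never grows; it limits all indices to \<open>(2 * s + 2) * s\<close>.\<close>

definition fok :: "nat \<Rightarrow> arrs \<Rightarrow> nat \<Rightarrow> bool" where
  "fok s a i \<longleftrightarrow> a 7 i < s \<and> i + a 7 i \<le> 2 * s \<and>
     instance_rows (a 7 i) (a 8 i) (\<lambda>j. a 9 (i * s + j)) (\<lambda>j. a 10 (i * s + j)) \<and>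
     (\<forall>j\<in>{1..a 7 i}. a 10 (i * s + j) < B)"

definition fpot :: "arrs \<Rightarrow> nat \<Rightarrow> nat" where
  "fpot a i = pot (a 7 i) (a 8 i)"

definition below :: "nat \<Rightarrow> nat \<Rightarrow> arrs \<Rightarrow> arrs \<Rightarrow> bool" where
  "below q s a a' \<longleftrightarrow> (\<forall>i<q. a' 7 i = a 7 i \<and> a' 8 i = a 8 i) \<and>
     (\<forall>x\<le>q * s. a' 9 x = a 9 x \<and> a' 10 x = a 10 x)"

lemma below_trans: "below q s a a' \<Longrightarrow> below q' s a' a'' \<Longrightarrow> q \<le> q' \<Longrightarrow> below q s a a''"
  unfolding below_def by (smt (verit) le_trans less_le_trans mult_le_mono1)

lemma frame_below:
  assumes "below q s a a'" "i < q" "a 7 i < s"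
  shows "fsol s a' i \<longleftrightarrow> fsol s a i" "fok s a' i \<longleftrightarrow> fok s a i" "fpot a' i = fpot a i"
proof -
  have hd: "a' 7 i = a 7 i" "a' 8 i = a 8 i" using assms by (auto simp: below_def)
  have "Suc i * s \<le> q * s" using assms(2) by (intro mult_le_mono1) simp
  then have "i * s + j \<le> q * s" if "j \<in> {1..a 7 i}" for j using that assms(3) by auto
  then have eq: "a' 9 (i * s + j) = a 9 (i * s + j)" "a' 10 (i * s + j) = a 10 (i * s + j)"
    if "j \<in> {1..a 7 i}" for j using that assms(1) by (auto simp: below_def)
  show "fpot a' i = fpot a i" by (simp add: fpot_def hd)
  show "fsol s a' i \<longleftrightarrow> fsol s a i" unfolding fsol_def hd by (rule sol_cong[OF eq])
  have "(\<lambda>j. a' 10 (i * s + j)) ` {1..a 7 i} = (\<lambda>j. a 10 (i * s + j)) ` {1..a 7 i}"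
    using eq by (intro image_cong) auto
  moreover have "rows (a 7 i) (\<lambda>j. a' 9 (i * s + j)) \<longleftrightarrow> rows (a 7 i) (\<lambda>j. a 9 (i * s + j))"
    using eq by (intro rows_cong) auto
  ultimately show "fok s a' i \<longleftrightarrow> fok s a i"
    using eq unfolding fok_def hd instance_rows_def by auto
qed

lemma fok_emitted:
  assumes "emission N p c st g ren (a 7 i) (\<lambda>j. a 9 (i * s + j)) (\<lambda>j. a 10 (i * s + j))"
    and "instance_rows (a 7 i) (a 8 i) (\<lambda>j. a 9 (i * s + j)) (\<lambda>j. a 10 (i * s + j))"
    and "\<And>j. j \<in> {1..N} \<Longrightarrow> c j < B" "N < s" "i + a 7 i \<le> 2 * s" "a 7 i \<le> N"
  shows "fok s a i"
proof -
  interpret emission N p c st g ren "a 7 i" "\<lambda>j. a 9 (i * s + j)" "\<lambda>j. a 10 (i * s + j)" by fact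
  have "a 10 (i * s + j) < B" if "j \<in> {1..a 7 i}" for j
  proof -
    have "a 10 (i * s + j) \<in> c ` K" using emitted_colors that by blast
    then show ?thesis using K_sub assms(3) by auto
  qed
  then show ?thesis using assms by (simp add: fok_def)
qed

text \<open>The contract for replacing the popped frame \<open>q\<close> by the frames from
  \<open>q\<close> on: together they have the answer \<open>b\<close>, and their potentials leave
  \<open>N + 1\<close> units to pay for the step.\<close>

definition branch_post :: "nat \<Rightarrow> nat \<Rightarrow> arrs \<Rightarrow> bool \<Rightarrow> nat \<Rightarrow> nat \<Rightarrow> vars \<Rightarrow> arrs \<Rightarrow> bool" where
  "branch_post q s a b N k v' a' \<longleftrightarrow> q \<le> v' 5 \<and> v' 6 = s \<and> v' 0 = 0 \<and> below q s a a' \<and>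
     (\<forall>i\<in>{q..<v' 5}. fok s a' i) \<and> ((\<exists>i\<in>{q..<v' 5}. fsol s a' i) \<longleftrightarrow> b) \<and>
     (\<Sum>i\<in>{q..<v' 5}. fpot a' i) + (N + 1) \<le> pot N k"

context
  fixes s q N k :: nat and p c :: "nat \<Rightarrow> nat"
  assumes inst: "instance_rows N k p c" and colors: "card (c ` {1..N}) = k"
    and Ns: "N < s" "q + N \<le> 2 * s" and Bs: "(2 * s + 2) * s < B" "4 < B"
    and cB: "\<And>j. j \<in> {1..N} \<Longrightarrow> c j < B"
begin

interpretation instance_rows N k p c by (rule inst)

lemma take_step:
  assumes vals: "v 5 = q" "v 6 = s" "v 13 = N" "v 14 = k" and a: "a 2 = p" "a 3 = c"
    and marks: "\<And>j. j \<in> {1..N} \<Longrightarrow> a 4 j = 0" "\<And>j. j \<in> {1..N} \<Longrightarrow> a 5 (c j) = 1"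
    and w: "v 18 = w" "w \<in> {1..N}" "p w = 0"
  shows "runs (Put 4 (Cn 0) (Cn (Suc 0)) ;; Put 4 (Vr 18) (Cn (Suc 0)) ;; Put 5 (Ld 3 (Vr 18)) (Cn 0) ;;
      21 ::= Minus (Vr 14) (Cn (Suc 0)) ;; Emit) v a (14 * N + 12)
    (\<lambda>v' a'. v' 5 = Suc q \<and> (\<forall>x. x \<notin> {5, 10, 11, 12, 19, 21} \<longrightarrow> v' x = v x) \<and>
      a' 2 = p \<and> a' 3 = c \<and> a' 4 = (a 4)(0 := 1, w := 1) \<and> a' 5 = (a 5)(c w := 0) \<and>
      below q s a a' \<and> fok s a' q \<and> a' 7 q + 1 \<le> N \<and> a' 8 q = k - 1 \<and>
      (fsol s a' q \<longleftrightarrow> (\<exists>S. is_sol N k p c S \<and> w \<in> S)) \<and>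
      (N < a' 7 q + 3 \<longrightarrow> (fsol s a' q \<longleftrightarrow> sol N k p c)))" (is "runs _ _ _ _ ?Q")
proof -
  let ?v = "v(21 := k - 1)" and ?a = "a(4 := (a 4)(0 := 1, w := 1), 5 := (a 5)(c w := 0))"
  have k1: "1 \<le> k" using colors w(2) by (auto simp: card_gt_0_iff Suc_le_eq)
  have sB: "Suc (?v 5) * ?v 6 < B"
  proof -
    have "Suc q * s \<le> (2 * s + 2) * s" using Ns by (intro mult_le_mono1) linarith
    also note Bs(1)
    finally show ?thesis using vals by simp
  qed
  have wB: "w < B" "c w < B"
  proof -
    have "N \<le> (2 * s + 2) * s" using Ns(1) by simp
    then show "w < B" "c w < B" using Bs(1) w(2) cB by auto
  qed
  have "runs Emit ?v ?a (14 * ?v 13 + 8) ?Q"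
  proof (rule runs_weaken[OF emit_pushes])
    show "rows (?v 13) (?a 2)" using rows vals a by simp
    show "?v 13 < ?v 6" using vals Ns by simp
    show "Suc (?v 5) * ?v 6 < B" by (rule sB)
    show "1 < B" using Bs by simp
    show "?a 3 j < B" if "j \<in> {1..?v 13}" for j using that cB vals a by simp
    show "?a 4 0 = 1" by simp
    show "?a 4 (?a 2 j) = 1" if "j \<in> {1..?v 13}" "?a 4 j = 1" for j
      using that marks(1)[of j] vals a w by (auto split: if_splits)
    fix v' a'
    assume E: "emission (?v 13) (?a 2) (?a 3) (?a 4) {x. ?a 5 x \<noteq> 0} (a' 6) (a' 7 (?v 5))
      (\<lambda>j. a' 9 (?v 5 * ?v 6 + j)) (\<lambda>j. a' 10 (?v 5 * ?v 6 + j)) \<and>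
      v' 5 = Suc (?v 5) \<and> a' 8 (?v 5) = ?v 21 \<and>
      (\<forall>x. x \<notin> {5, 10, 11, 12, 19} \<longrightarrow> v' x = ?v x) \<and>
      (\<forall>r. r \<notin> {6, 7, 8, 9, 10} \<longrightarrow> a' r = ?a r) \<and>
      (\<forall>i. i \<noteq> ?v 5 \<longrightarrow> a' 7 i = ?a 7 i \<and> a' 8 i = ?a 8 i) \<and>
      (\<forall>x\<le>?v 5 * ?v 6. a' 9 x = ?a 9 x \<and> a' 10 x = ?a 10 x)"
    then have em: "emission N p c ((a 4)(0 := 1, w := 1)) {x. ((a 5)(c w := 0)) x \<noteq> 0} (a' 6) (a' 7 q)
      (\<lambda>j. a' 9 (q * s + j)) (\<lambda>j. a' 10 (q * s + j))" using vals a by simp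
    interpret taken N k p c "(a 4)(0 := 1, w := 1)" "{x. ((a 5)(c w := 0)) x \<noteq> 0}" "a' 6" "a' 7 q"
      "\<lambda>j. a' 9 (q * s + j)" "\<lambda>j. a' 10 (q * s + j)" w
      by (intro taken.intro inst em taken_axioms.intro) (use w marks in auto)
    have kq: "a' 8 q = k - 1" using E vals by simp
    have "fok s a' q"
      using fok_emitted[OF em _ cB] instance' le1 Ns kq by simp
    moreover have sol: "fsol s a' q \<longleftrightarrow> (\<exists>S. is_sol N k p c S \<and> w \<in> S)"
      unfolding fsol_def kq by (rule sol_taken[OF k1])
    moreover have "fsol s a' q \<longleftrightarrow> sol N k p c" if "N < a' 7 q + 3"
      unfolding sol using dominated[OF that] by (auto simp: sol_def)
    moreover have "below q s a a'" using E vals by (simp add: below_def)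
    moreover have "a' 2 = p" "a' 3 = c" "a' 4 = (a 4)(0 := 1, w := 1)" "a' 5 = (a 5)(c w := 0)" "v' 5 = Suc q"
      using E vals a by auto
    ultimately show "?Q v' a'" using le1 kq E by simp
  qed simp
  then show ?thesis using Bs wB vals a w(1) by (simp add: add.commute)
qed

text \<open>The assumptions on the marks exempt \<open>w\<close> and its color because they describe
  the state that \<open>take_step\<close> leaves behind. The child \<open>y\<close> is lost together
  with \<open>w\<close>, hence the decrease by 2.\<close>

lemma drop_step:
  assumes vals: "v 5 = Suc q" "v 6 = s" "v 13 = N" "v 14 = k" and a: "a 2 = p" "a 3 = c"
    and marks: "a 4 0 = 1" "\<And>j. j \<in> {1..N} \<Longrightarrow> j \<noteq> w \<Longrightarrow> a 4 j = 0"
      "\<And>j. j \<in> {1..N} \<Longrightarrow> c j \<noteq> c w \<Longrightarrow> a 5 (c j) = 1"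
    and w: "v 18 = w" "w \<in> {1..N}" "p w = 0" and y: "y \<in> {1..N}" "p y = w"
  shows "runs (Put 4 (Vr 18) (Cn 2) ;; Put 5 (Ld 3 (Vr 18)) (Cn (Suc 0)) ;; 21 ::= Vr 14 ;; Emit) v a (14 * N + 11)
    (\<lambda>v' a'. v' 5 = Suc (Suc q) \<and> (\<forall>x. x \<notin> {5, 10, 11, 12, 19, 21} \<longrightarrow> v' x = v x) \<and>
      below (Suc q) s a a' \<and> fok s a' (Suc q) \<and> a' 7 (Suc q) + 2 \<le> N \<and> a' 8 (Suc q) = k \<and>
      (fsol s a' (Suc q) \<longleftrightarrow> (\<exists>S. is_sol N k p c S \<and> w \<notin> S)))" (is "runs _ _ _ _ ?Q")
proof -
  let ?v = "v(21 := k)" and ?a = "a(4 := (a 4)(w := 2), 5 := (a 5)(c w := 1))"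
  have w0: "w \<noteq> 0" using w by simp
  have sB: "Suc (?v 5) * ?v 6 < B"
  proof -
    have "N \<noteq> 0" using w by auto
    then have "Suc (Suc q) * s \<le> (2 * s + 2) * s" using Ns by (intro mult_le_mono1) linarith
    also note Bs(1)
    finally show ?thesis using vals by simp
  qed
  have wB: "w < B" "c w < B"
  proof -
    have "N \<le> (2 * s + 2) * s" using Ns(1) by simp
    then show "w < B" "c w < B" using Bs(1) w(2) cB by auto
  qed
  have "runs Emit ?v ?a (14 * ?v 13 + 8) ?Q"
  proof (rule runs_weaken[OF emit_pushes])
    show "rows (?v 13) (?a 2)" using rows vals a by simp
    show "?v 13 < ?v 6" using vals Ns by simp
    show "Suc (?v 5) * ?v 6 < B" by (rule sB)
    show "1 < B" using Bs by simp
    show "?a 3 j < B" if "j \<in> {1..?v 13}" for j using that cB vals a by simp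
    show "?a 4 0 = 1" using marks w0 by simp
    show "?a 4 (?a 2 j) = 1" if "j \<in> {1..?v 13}" "?a 4 j = 1" for j
      using that marks(2)[of j] vals a w by (auto split: if_splits)
    fix v' a'
    assume E: "emission (?v 13) (?a 2) (?a 3) (?a 4) {x. ?a 5 x \<noteq> 0} (a' 6) (a' 7 (?v 5))
      (\<lambda>j. a' 9 (?v 5 * ?v 6 + j)) (\<lambda>j. a' 10 (?v 5 * ?v 6 + j)) \<and>
      v' 5 = Suc (?v 5) \<and> a' 8 (?v 5) = ?v 21 \<and>
      (\<forall>x. x \<notin> {5, 10, 11, 12, 19} \<longrightarrow> v' x = ?v x) \<and>
      (\<forall>r. r \<notin> {6, 7, 8, 9, 10} \<longrightarrow> a' r = ?a r) \<and>
      (\<forall>i. i \<noteq> ?v 5 \<longrightarrow> a' 7 i = ?a 7 i \<and> a' 8 i = ?a 8 i) \<and>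
      (\<forall>x\<le>?v 5 * ?v 6. a' 9 x = ?a 9 x \<and> a' 10 x = ?a 10 x)"
    then have em: "emission N p c ((a 4)(w := 2)) {x. ((a 5)(c w := 1)) x \<noteq> 0} (a' 6) (a' 7 (Suc q))
      (\<lambda>j. a' 9 (Suc q * s + j)) (\<lambda>j. a' 10 (Suc q * s + j))" using vals a by simp
    interpret dropped N k p c "(a 4)(w := 2)" "{x. ((a 5)(c w := 1)) x \<noteq> 0}" "a' 6" "a' 7 (Suc q)"
      "\<lambda>j. a' 9 (Suc q * s + j)" "\<lambda>j. a' 10 (Suc q * s + j)" w
      by (intro dropped.intro inst em dropped_axioms.intro) (use w marks w0 in auto)
    have kq: "a' 8 (Suc q) = k" using E vals by simp
    have "fok s a' (Suc q)"
      using fok_emitted[OF em _ cB] instance' le2[OF y] Ns kq by simp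
    moreover have "fsol s a' (Suc q) \<longleftrightarrow> (\<exists>S. is_sol N k p c S \<and> w \<notin> S)"
      unfolding fsol_def kq by (rule sol_dropped)
    moreover have "below (Suc q) s a a'" using E vals by (simp add: below_def)
    moreover have "v' 5 = Suc (Suc q)" using E vals by auto
    ultimately show "?Q v' a'" using le2[OF y] kq E by simp
  qed simp
  then show ?thesis using Bs wB vals a w(1) by (simp add: add.commute)
qed

text \<open>A vertex of unique color, and with it \<open>w\<close>, lies in every solution, so one
  frame suffices. Otherwise every color occurs twice, which gives \<open>2 * k <= N\<close> as
  demanded by \<open>pot_branch\<close>. The factor 30 is 2 for the climb and 14 for each of two
  emissions.\<close>

lemma branch:
  assumes v: "v 5 = q" "v 6 = s" "v 13 = N" "v 14 = k" "v 0 = 0" and a: "a 2 = p" "a 3 = c"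
    and st: "\<And>j. j \<in> {1..N} \<Longrightarrow> a 4 j = 0" "\<And>j. j \<in> {1..N} \<Longrightarrow> a 5 (c j) = 1"
    and uq: "v 16 \<noteq> 0 \<Longrightarrow> v 16 \<in> {1..N} \<and> card {i \<in> {1..N}. c i = c (v 16)} = 1"
      "\<And>j. v 16 = 0 \<Longrightarrow> j \<in> {1..N} \<Longrightarrow> card {i \<in> {1..N}. c i = c j} \<noteq> 1"
    and nl: "v 17 \<in> {1..N}" "p (v 17) \<noteq> 0"
  shows "runs Branch v a (30 * N + 28) (branch_post q s a (sol N k p c) N k)"
proof -
  let ?Q = "branch_post q s a (sol N k p c) N k"
  let ?u = "if v 16 \<noteq> 0 then v 16 else v 17"
  let ?D = "Put 4 (Vr 18) (Cn 2) ;; Put 5 (Ld 3 (Vr 18)) (Cn (Suc 0)) ;; 21 ::= Vr 14 ;; Emit"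
  let ?C = "Cond (Vr 16) Skip
       (Cond (Minus (Vr 13) (Plus (Ld 7 (Minus (Vr 5) (Cn (Suc 0)))) (Cn 2))) (?D) Skip)"
  have NB: "N + 2 < B" "Suc q < B"
  proof -
    have "(2 * s + 2) * 1 \<le> (2 * s + 2) * s" using Ns by (intro mult_le_mono) auto
    from le_less_trans[OF this Bs(1)] have "2 * s + 2 < B" by simp
    then show "N + 2 < B" "Suc q < B" using Ns by linarith+
  qed
  have two: "2 * k \<le> N" if "v 16 = 0"
  proof -
    have "\<exists>i\<in>{1..N}. i \<noteq> j \<and> c i = c j" if j: "j \<in> {1..N}" for j
    proof (rule ccontr)
      assume "\<not> (\<exists>i\<in>{1..N}. i \<noteq> j \<and> c i = c j)"
      then have "{i \<in> {1..N}. c i = c j} = {j}" using j by auto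
      then show False using uq(2)[OF \<open>v 16 = 0\<close> j] by simp
    qed
    then show ?thesis using two_few colors by simp
  qed
  have uni: "v 16 \<in> S" if u: "v 16 \<noteq> 0" and S: "is_sol N k p c S" for S
  proof (rule sol_unique[OF S])
    obtain x where x: "{i \<in> {1..N}. c i = c (v 16)} = {x}" using uq(1)[OF u] by (auto simp: card_1_singleton_iff)
    show "i = v 16" if "i \<in> {1..N}" "c i = c (v 16)" for i
    proof -
      have "i \<in> {x}" "v 16 \<in> {x}" unfolding x[symmetric] using that uq(1)[OF u] by auto
      then show ?thesis by simp
    qed
  qed (use uq(1)[OF u] in simp)
  have "runs (Climb ;; Put 4 (Cn 0) (Cn (Suc 0)) ;; Put 4 (Vr 18) (Cn (Suc 0)) ;; Put 5 (Ld 3 (Vr 18)) (Cn 0) ;;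
      21 ::= Minus (Vr 14) (Cn (Suc 0)) ;; Emit ;; ?C) (v(18 := ?u)) a (30 * N + 26) ?Q"
  proof (rule runs_Seq[OF runs_weaken[OF climb[of N a "v(18 := ?u)"] order_refl]])
    show "rows N (a 2)" using rows a by simp
    show "(v(18 := ?u)) 18 \<in> {1..N}" using uq(1) nl by auto
    show "N < B" using NB by simp
    fix v1 a1
    assume C: "(\<forall>x. x \<noteq> 18 \<longrightarrow> v1 x = (v(18 := ?u)) x) \<and> a1 = a \<and>
      v1 18 \<in> {1..N} \<and> a 2 (v1 18) = 0 \<and> (\<forall>S. up_closed (a 2) S \<longrightarrow> (v(18 := ?u)) 18 \<in> S \<longrightarrow> v1 18 \<in> S) \<and>
      (v1 18 = (v(18 := ?u)) 18 \<or> (\<exists>y\<in>{1..N}. a 2 y = v1 18))"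
    define w where "w = v1 18"
    have a1: "a1 = a" and w: "w \<in> {1..N}" "p w = 0" using C a by (auto simp: w_def)
    have v1: "v1 5 = q" "v1 6 = s" "v1 13 = N" "v1 14 = k" "v1 0 = 0" "v1 16 = v 16"
      using C v by auto
    have uw: "w \<in> S" if "v 16 \<noteq> 0" "is_sol N k p c S" for S
      using C a that uni[OF that] by (auto simp: w_def is_sol_def)
    have child: "\<exists>y\<in>{1..N}. p y = w" if "v 16 = 0" using C a that nl by (auto simp: w_def)
    have "runs (Put 4 (Cn 0) (Cn (Suc 0)) ;; Put 4 (Vr 18) (Cn (Suc 0)) ;; Put 5 (Ld 3 (Vr 18)) (Cn 0) ;;
      21 ::= Minus (Vr 14) (Cn (Suc 0)) ;; Emit) v1 a (14 * N + 12) (\<lambda>v' a'. runs ?C v' a' (14 * N + 13) ?Q)"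
    proof (rule runs_weaken[OF take_step[of v1 a w] order_refl])
      show "v1 18 = w" by (simp add: w_def)
      fix v2 a2
      assume T: "v2 5 = Suc q \<and> (\<forall>x. x \<notin> {5, 10, 11, 12, 19, 21} \<longrightarrow> v2 x = v1 x) \<and>
        a2 2 = p \<and> a2 3 = c \<and> a2 4 = (a 4)(0 := 1, w := 1) \<and> a2 5 = (a 5)(c w := 0) \<and>
        below q s a a2 \<and> fok s a2 q \<and> a2 7 q + 1 \<le> N \<and> a2 8 q = k - 1 \<and>
        (fsol s a2 q \<longleftrightarrow> (\<exists>S. is_sol N k p c S \<and> w \<in> S)) \<and>
        (N < a2 7 q + 3 \<longrightarrow> (fsol s a2 q \<longleftrightarrow> sol N k p c))"
      have v2: "v2 5 = Suc q" "v2 6 = s" "v2 13 = N" "v2 14 = k" "v2 0 = 0" "v2 16 = v 16" "v2 18 = w"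
        using T v1 by (auto simp: w_def)
      have single: "?Q v2 a2" if "fsol s a2 q \<longleftrightarrow> sol N k p c"
        using T v2 that pot_single[of "a2 7 q" N k] by (simp add: branch_post_def fpot_def)
      show "runs ?C v2 a2 (14 * N + 13) ?Q"
      proof (cases "v 16 = 0")
        case False
        then have "fsol s a2 q \<longleftrightarrow> sol N k p c" using T uw by (auto simp: sol_def)
        then show ?thesis using single v2 False by simp
      next
        case True
        obtain y where y: "y \<in> {1..N}" "p y = w" using child[OF True] by blast
        have cond: "ok (Minus (Vr 13) (Plus (Ld 7 (Minus (Vr 5) (Cn (Suc 0)))) (Cn 2))) v2 a2"
          "val (Minus (Vr 13) (Plus (Ld 7 (Minus (Vr 5) (Cn (Suc 0)))) (Cn 2))) v2 a2 = N - (a2 7 q + 2)"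
          using T NB v2 by auto
        show ?thesis
        proof (cases "N < a2 7 q + 3")
          case short: True
          then have "?Q v2 a2" using T by (intro single) blast
          then show ?thesis using True v2 cond short by simp
        next
          case long: False
          have "runs (?D) v2 a2 (14 * N + 11) ?Q"
          proof (rule runs_weaken[OF drop_step[of v2 a2 w y] order_refl])
            fix v3 a3
            assume D: "v3 5 = Suc (Suc q) \<and> (\<forall>x. x \<notin> {5, 10, 11, 12, 19, 21} \<longrightarrow> v3 x = v2 x) \<and>
              below (Suc q) s a2 a3 \<and> fok s a3 (Suc q) \<and> a3 7 (Suc q) + 2 \<le> N \<and> a3 8 (Suc q) = k \<and>
              (fsol s a3 (Suc q) \<longleftrightarrow> (\<exists>S. is_sol N k p c S \<and> w \<notin> S))"
            have "a2 7 q < s" using T Ns by simp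
            note fb = frame_below[of "Suc q" s a2 a3 q, OF _ _ this]
            have set: "{q..<v3 5} = {q, Suc q}" using D by auto
            have "below q s a a3" using T D below_trans[of q s a a2 "Suc q" a3] by simp
            moreover have "fok s a3 q" "fsol s a3 q \<longleftrightarrow> (\<exists>S. is_sol N k p c S \<and> w \<in> S)" "fpot a3 q = pot (a2 7 q) (k - 1)"
              using T D fb by (auto simp: fpot_def)
            moreover have "pot (a2 7 q) (k - 1) + pot (a3 7 (Suc q)) k + (N + 1) \<le> pot N k"
              using pot_branch[of k N "a2 7 q" "a3 7 (Suc q)"] two[OF True] long D by simp
            ultimately show "?Q v3 a3"
              unfolding branch_post_def set using D v2 by (auto simp: sol_def fpot_def)
          qed (use T v2 w y st in auto)
          then show ?thesis using True v2 cond long by simp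
        qed
      qed
    qed (use v1 a st w in auto)
    from runs_Seq[OF this, of "28 * N + 25"]
    show "runs (Put 4 (Cn 0) (Cn (Suc 0)) ;; Put 4 (Vr 18) (Cn (Suc 0)) ;; Put 5 (Ld 3 (Vr 18)) (Cn 0) ;;
      21 ::= Minus (Vr 14) (Cn (Suc 0)) ;; Emit ;; ?C) v1 a1 (28 * N + 25) ?Q"
      by (simp add: a1)
  qed simp
  then show ?thesis unfolding Branch_def by (auto simp: add.commute split: if_splits)
qed

end

text \<open>The linear terms of loading, counting, finding and branching are
  \<open>7 + 5 + 6 + 30 = 48\<close> times the number of rows; 50 also covers the constants.\<close>

lemma search_step:
  assumes v: "v 5 = Suc q" "v 6 = s" "v 0 = 0" and ok: "fok s a q" and Bs: "(2 * s + 2) * s < B" "4 < B"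
  shows "runs Search_step v a (50 * (a 7 q + 1)) (\<lambda>v' a'. v' 6 = s \<and>
    (v' 0 = 1 \<and> v' 5 = 0 \<and> fsol s a q \<or> branch_post q s a (fsol s a q) (a 7 q) (a 8 q) v' a'))"
    (is "runs _ _ _ _ ?Q")
proof -
  let ?B = "Cond (Minus (Vr 14) (Vr 15)) Skip
       (Cond (Vr 17) Branch (0 ::= Cn (Suc 0) ;; 5 ::= Cn 0))"
  let ?F = "16 ::= Cn 0 ;; 17 ::= Cn 0 ;; 10 ::= Cn (Suc 0) ;; Find_rows ;; ?B"
  let ?C = "15 ::= Cn 0 ;; 10 ::= Cn (Suc 0) ;; Count_colors ;; ?F"
  define N where "N = a 7 q"
  define k where "k = a 8 q"
  define b where "b = q * s"
  have ok': "N < s" "q + N \<le> 2 * s" "instance_rows N k (\<lambda>j. a 9 (b + j)) (\<lambda>j. a 10 (b + j))"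
    "\<And>j. j \<in> {1..N} \<Longrightarrow> a 10 (b + j) < B" using ok by (auto simp: fok_def N_def k_def b_def)
  have NB: "N + 1 < B" "q < B" "b + N < B" "b < B" "Suc 0 < B" "0 < B"
  proof -
    have "(2 * s + 2) * 1 \<le> (2 * s + 2) * s" using ok'(1) by (intro mult_le_mono) auto
    from le_less_trans[OF this Bs(1)] have "2 * s + 2 < B" by simp
    moreover have "Suc q * s \<le> (2 * s + 2) * s" using ok'(2) by (intro mult_le_mono1) linarith
    from le_less_trans[OF this Bs(1)] have "b + s < B" by (simp add: b_def)
    ultimately show "N + 1 < B" "q < B" "b + N < B" "b < B" "Suc 0 < B" "0 < B"
      using ok'(1,2) Bs(2) by linarith+
  qed
  let ?v0 = "v(5 := q, 13 := N, 14 := k, 12 := b, 10 := Suc 0)"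
  have load: "runs (Load_rows ;; ?C) ?v0 a (48 * N + 38) ?Q"
  proof (rule runs_Seq[OF runs_weaken[OF load_rows[of ?v0 a] order_refl], where ?T2.0 = "41 * N + 37"])
    fix v1 a1
    assume L: "(\<forall>x. x \<noteq> 10 \<longrightarrow> v1 x = ?v0 x) \<and> (\<forall>r. r \<notin> {2, 3, 4, 5, 11} \<longrightarrow> a1 r = a r) \<and>
      (\<forall>j\<in>{1..?v0 13}. a1 2 j = a 9 (?v0 12 + j) \<and> a1 3 j = a 10 (?v0 12 + j) \<and> a1 4 j = 0 \<and>
       a1 5 (a 10 (?v0 12 + j)) = 1 \<and> a1 11 (a 10 (?v0 12 + j)) = 0)"
    define p where "p = a1 2"
    define c where "c = a1 3"
    have pc: "p j = a 9 (b + j)" "c j = a 10 (b + j)" if "j \<in> {1..N}" for j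
      using L that by (auto simp: p_def c_def)
    have c: "c j < B" "a1 4 j = 0" "a1 5 (c j) = 1" "a1 11 (c j) = 0" if "j \<in> {1..N}" for j
      using L that pc[OF that] ok'(4) by auto
    have sol: "fsol s a q \<longleftrightarrow> sol N k p c"
      unfolding fsol_def N_def[symmetric] k_def[symmetric] b_def[symmetric] by (rule sol_cong) (simp_all add: pc)
    have inst: "instance_rows N k p c"
      using ok'(3) rows_cong[of N p "\<lambda>j. a 9 (b + j)"] image_cong[of "{1..N}" "{1..N}" c "\<lambda>j. a 10 (b + j)"] pc
      by (simp add: instance_rows_def)
    interpret instance_rows N k p c by (rule inst)
    have a1: "below q s a a1" using L by (simp add: below_def)
    have v1: "v1 5 = q" "v1 6 = s" "v1 13 = N" "v1 14 = k" "v1 0 = 0" using L v by auto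
    let ?v1 = "v1(15 := 0, 10 := Suc 0)"
    have "runs (Count_colors ;; ?F) ?v1 a1 (41 * N + 35) ?Q"
    proof (rule runs_Seq[OF runs_weaken[OF count_colors[of ?v1 a1] order_refl], where ?T2.0 = "36 * N + 34"])
      show "a1 3 j < B \<and> a1 11 (a1 3 j) = 0" if "j \<in> {1..?v1 13}" for j
        using that c v1 by (simp add: c_def)
      fix v2 a2
      assume C: "(\<forall>x. x \<notin> {10, 15} \<longrightarrow> v2 x = ?v1 x) \<and> (\<forall>r. r \<noteq> 11 \<longrightarrow> a2 r = a1 r) \<and>
        v2 15 = card (a1 3 ` {1..?v1 13}) \<and>
        (\<forall>j\<in>{1..?v1 13}. a2 11 (a1 3 j) = card {i \<in> {1..?v1 13}. a1 3 i = a1 3 j})"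
      have v2: "v2 5 = q" "v2 6 = s" "v2 13 = N" "v2 14 = k" "v2 0 = 0" "v2 15 = card (c ` {1..N})"
        using C v1 by (auto simp: c_def)
      have cnt: "a2 11 (c j) = card {i \<in> {1..N}. c i = c j}" if "j \<in> {1..N}" for j
        using C v1 that by (auto simp: c_def)
      have a2: "below q s a a2" using a1 C by (simp add: below_def)
      have arr: "a2 2 = p" "a2 3 = c" "a2 4 = a1 4" "a2 5 = a1 5" using C by (auto simp: p_def c_def)
      let ?v2 = "v2(16 := 0, 17 := 0, 10 := Suc 0)"
      have "runs (Find_rows ;; ?B) ?v2 a2 (36 * N + 31) ?Q"
      proof (rule runs_Seq[OF runs_weaken[OF find_rows[of ?v2 a2] order_refl], where ?T2.0 = "30 * N + 30"])
        show "a2 3 j < B" if "j \<in> {1..?v2 13}" for j using that c v2 arr by simp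
        fix v3 a3
        assume F: "(\<forall>x. x \<notin> {10, 16, 17} \<longrightarrow> v3 x = ?v2 x) \<and> a3 = a2 \<and>
          (v3 16 \<noteq> 0 \<longrightarrow> v3 16 \<in> {1..?v2 13} \<and> a2 11 (a2 3 (v3 16)) = 1) \<and>
          (v3 16 = 0 \<longrightarrow> (\<forall>j\<in>{1..?v2 13}. a2 11 (a2 3 j) \<noteq> 1)) \<and>
          (v3 17 \<noteq> 0 \<longrightarrow> v3 17 \<in> {1..?v2 13} \<and> a2 2 (v3 17) \<noteq> 0) \<and>
          (v3 17 = 0 \<longrightarrow> (\<forall>j\<in>{1..?v2 13}. a2 2 j = 0))"
        have v3: "v3 5 = q" "v3 6 = s" "v3 13 = N" "v3 14 = k" "v3 0 = 0" "v3 15 = card (c ` {1..N})"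
          using F v2 by auto
        show "runs ?B v3 a3 (30 * N + 30) ?Q"
        proof (cases "card (c ` {1..N}) < k")
          case True
          then have "\<not> fsol s a q" using too_few sol by simp
          then have "?Q v3 a2" using v3 a2 pot_ge[of N k]
            by (simp add: branch_post_def N_def[symmetric] k_def[symmetric])
          then show ?thesis using True v3 F by simp
        next
          case False
          then have eq: "card (c ` {1..N}) = k" using few by simp
          show ?thesis
          proof (cases "v3 17 = 0")
            case flat: True
            then have "\<forall>j\<in>{1..N}. p j = 0" using F v2 arr by simp
            then have "fsol s a q" using sol_flat[OF eq] sol by simp
            then show ?thesis using False flat NB v3 by simp
          next
            case deep: False
            have "runs Branch v3 a2 (30 * N + 28) (branch_post q s a2 (sol N k p c) N k)"
            proof (rule branch[OF inst eq ok'(1,2) Bs c(1)])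
              show "v3 16 \<in> {1..N} \<and> card {i \<in> {1..N}. c i = c (v3 16)} = 1" if "v3 16 \<noteq> 0"
                using F that cnt[of "v3 16"] v2 arr by simp
              show "card {i \<in> {1..N}. c i = c j} \<noteq> 1" if "v3 16 = 0" "j \<in> {1..N}" for j
              proof -
                have "\<forall>j\<in>{1..N}. a2 11 (c j) \<noteq> 1" using F that(1) v2 arr by simp
                then show ?thesis using cnt[OF that(2)] that(2) by metis
              qed
            qed (use v3 arr c F v2 deep in simp_all)
            then have "runs Branch v3 a2 (30 * N + 28) ?Q"
            proof (rule runs_weaken[OF _ order_refl])
              fix v4 a4
              assume P: "branch_post q s a2 (sol N k p c) N k v4 a4"
              then have "below q s a a4" using below_trans[OF a2, of q a4] by (simp add: branch_post_def)
              then show "?Q v4 a4" using P sol by (simp add: branch_post_def N_def k_def)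
            qed
            then show ?thesis using False deep v3 F by (simp add: add.commute)
          qed
        qed
      qed (use v2 NB in simp_all)
      then show "runs ?F v2 a2 (36 * N + 34) ?Q" using NB by (simp add: add.commute)
    qed (use v1 NB in simp_all)
    then show "runs ?C v1 a1 (41 * N + 37) ?Q" using NB by (simp add: add.commute)
  qed (use NB ok' v in simp_all)
  then have "runs Search_step v a (48 * N + 43) ?Q"
    unfolding Search_step_def using NB v by (simp add: N_def[symmetric] k_def[symmetric] b_def[symmetric] add.commute)
  then show ?thesis by (rule runs_weaken) (simp_all add: N_def)
qed

text \<open>The potential falls by at least \<open>N + 1\<close> per step. Of the factor 51, the
  part 50 pays for the step itself and the rest for the loop test.\<close>

lemma search:
  assumes v: "v 6 = s" "v 0 = 0" and ok: "\<And>i. i < v 5 \<Longrightarrow> fok s a i" and Bs: "(2 * s + 2) * s < B" "4 < B"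
  shows "runs Search v a (51 * (\<Sum>i<v 5. fpot a i) + 1)
    (\<lambda>v' a'. v' 0 = (if \<exists>i<v 5. fsol s a i then 1 else 0))"
  unfolding Search_def
proof (rule runs_Loop_pot[where \<phi> = "\<lambda>v a. 51 * (\<Sum>i<v 5. fpot a i)" and I = "\<lambda>v' a'. v' 6 = s \<and>
    (v' 0 = 1 \<and> v' 5 = 0 \<and> (\<exists>i<v 5. fsol s a i) \<or>
     v' 0 = 0 \<and> (\<forall>i<v' 5. fok s a' i) \<and> ((\<exists>i<v 5. fsol s a i) \<longleftrightarrow> (\<exists>i<v' 5. fsol s a' i)))"])
  fix v1 a1
  assume I: "v1 6 = s \<and> (v1 0 = 1 \<and> v1 5 = 0 \<and> (\<exists>i<v 5. fsol s a i) \<or>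
     v1 0 = 0 \<and> (\<forall>i<v1 5. fok s a1 i) \<and> ((\<exists>i<v 5. fsol s a i) \<longleftrightarrow> (\<exists>i<v1 5. fsol s a1 i)))"
    and "val (Vr 5) v1 a1 \<noteq> 0"
  then obtain q where q: "v1 5 = Suc q" by (cases "v1 5") auto
  have I': "v1 6 = s" "v1 0 = 0" "\<And>i. i < Suc q \<Longrightarrow> fok s a1 i"
    "(\<exists>i<v 5. fsol s a i) \<longleftrightarrow> (\<exists>i<q. fsol s a1 i) \<or> fsol s a1 q"
    using I q by (auto simp: less_Suc_eq)
  have "runs Search_step v1 a1 (50 * (a1 7 q + 1)) (\<lambda>v' a'. (v' 6 = s \<and>
    (v' 0 = 1 \<and> v' 5 = 0 \<and> (\<exists>i<v 5. fsol s a i) \<or>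
     v' 0 = 0 \<and> (\<forall>i<v' 5. fok s a' i) \<and> ((\<exists>i<v 5. fsol s a i) \<longleftrightarrow> (\<exists>i<v' 5. fsol s a' i)))) \<and>
    51 * (\<Sum>i<v' 5. fpot a' i) + 50 * (a1 7 q + 1) + 1 \<le> 51 * (\<Sum>i<v1 5. fpot a1 i))"
  proof (rule runs_weaken[OF search_step[OF q I'(1,2) I'(3)[OF lessI] Bs] order_refl])
    fix v' a'
    assume Q: "v' 6 = s \<and>
      (v' 0 = 1 \<and> v' 5 = 0 \<and> fsol s a1 q \<or> branch_post q s a1 (fsol s a1 q) (a1 7 q) (a1 8 q) v' a')"
    have ge: "a1 7 q + 1 \<le> fpot a1 q" unfolding fpot_def by (rule pot_ge)
    show "(v' 6 = s \<and> (v' 0 = 1 \<and> v' 5 = 0 \<and> (\<exists>i<v 5. fsol s a i) \<or>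
       v' 0 = 0 \<and> (\<forall>i<v' 5. fok s a' i) \<and> ((\<exists>i<v 5. fsol s a i) \<longleftrightarrow> (\<exists>i<v' 5. fsol s a' i)))) \<and>
      51 * (\<Sum>i<v' 5. fpot a' i) + 50 * (a1 7 q + 1) + 1 \<le> 51 * (\<Sum>i<v1 5. fpot a1 i)"
    proof (cases "v' 0 = 1 \<and> v' 5 = 0 \<and> fsol s a1 q")
      case True
      then show ?thesis using Q I'(4) ge q by auto
    next
      case False
      then have P: "q \<le> v' 5" "v' 0 = 0" "below q s a1 a'" "\<forall>i\<in>{q..<v' 5}. fok s a' i"
        "(\<exists>i\<in>{q..<v' 5}. fsol s a' i) \<longleftrightarrow> fsol s a1 q"
        "(\<Sum>i\<in>{q..<v' 5}. fpot a' i) + (a1 7 q + 1) \<le> fpot a1 q"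
        using Q by (auto simp: branch_post_def fpot_def)
      have low: "fsol s a' i \<longleftrightarrow> fsol s a1 i" "fok s a' i" "fpot a' i = fpot a1 i" if "i < q" for i
        using frame_below[OF P(3) that] I'(3)[of i] that by (auto simp: fok_def)
      have split: "{..<v' 5} = {..<q} \<union> {q..<v' 5}" using P(1) by auto
      have all: "(\<forall>i<v' 5. fok s a' i)" using low(2) P(4) by (metis atLeastLessThan_iff linorder_not_less)
      have ex: "(\<exists>i<v' 5. fsol s a' i) \<longleftrightarrow> (\<exists>i<q. fsol s a1 i) \<or> fsol s a1 q"
      proof -
        have "(\<exists>i<v' 5. fsol s a' i) \<longleftrightarrow> (\<exists>i\<in>{..<q} \<union> {q..<v' 5}. fsol s a' i)" unfolding split[symmetric] by auto
        then show ?thesis using low(1) P(5) by auto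
      qed
      have "(\<Sum>i<v' 5. fpot a' i) = (\<Sum>i<q. fpot a' i) + (\<Sum>i\<in>{q..<v' 5}. fpot a' i)"
        unfolding split by (rule sum.union_disjoint) auto
      also have "(\<Sum>i<q. fpot a' i) = (\<Sum>i<q. fpot a1 i)" using low(3) by (intro sum.cong) auto
      finally have "51 * (\<Sum>i<v' 5. fpot a' i) + 50 * (a1 7 q + 1) + 1 \<le> 51 * (\<Sum>i<v1 5. fpot a1 i)"
        using P(6) unfolding q by simp
      then show ?thesis using Q P(2) all ex I'(4) by blast
    qed
  qed
  then show "\<exists>T. runs Search_step v1 a1 T (\<lambda>v' a'. (v' 6 = s \<and>
    (v' 0 = 1 \<and> v' 5 = 0 \<and> (\<exists>i<v 5. fsol s a i) \<or>
     v' 0 = 0 \<and> (\<forall>i<v' 5. fok s a' i) \<and> ((\<exists>i<v 5. fsol s a i) \<longleftrightarrow> (\<exists>i<v' 5. fsol s a' i)))) \<and>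
    51 * (\<Sum>i<v' 5. fpot a' i) + T + 1 \<le> 51 * (\<Sum>i<v1 5. fpot a1 i))" by blast
qed (use assms in auto)

end


section \<open>Rooting the input tree\<close>

text \<open>
  Variables: 2 \<open>|V|\<close>, 3 \<open>|E|\<close>, 4 \<open>|M|\<close>, 7 and 8 the input positions of the vertex colors and of the motif,
  22 the root, 24 and 25 the two ends of the queue. Arrays: 12 degrees, 13 sums of the neighbors, 14
  queue, 15 parents, 16 row numbers of the vertices, 17 membership in the motif, 18 multiplicities of the
  colors.
\<close>

definition Clear_degrees :: com where
  "Clear_degrees = For 9 (Vr 2) (Put 12 (Vr 9) (Cn 0) ;; Put 13 (Vr 9) (Cn 0))"

definition Add_edges :: com where
  "Add_edges = For 9 (Vr 3)
     (26 ::= In (Plus (Cn 4) (Plus (Vr 9) (Vr 9))) ;;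
      30 ::= In (Plus (Cn 5) (Plus (Vr 9) (Vr 9))) ;;
      Put 12 (Vr 26) (Plus (Ld 12 (Vr 26)) (Cn (Suc 0))) ;;
      Put 13 (Vr 26) (Plus (Ld 13 (Vr 26)) (Vr 30)) ;;
      Put 12 (Vr 30) (Plus (Ld 12 (Vr 30)) (Cn (Suc 0))) ;;
      Put 13 (Vr 30) (Plus (Ld 13 (Vr 30)) (Vr 26)))"

text \<open>The root is kept out of the queue even when its degree is 1, so that it remains as the
  last vertex.\<close>

definition Push_leaves :: com where
  "Push_leaves = For 9 (Vr 2)
     (Cond (Ne (Ld 12 (Vr 9)) (Cn (Suc 0))) Skip
       (Cond (Ne (Vr 9) (Vr 22)) (Put 14 (Vr 25) (Vr 9) ;; 25 ::= Plus (Vr 25) (Cn (Suc 0))) Skip))"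

text \<open>
  A leaf knows its parent because only the parent is left in its sum of neighbors.
\<close>

definition Strip_leaves :: com where
  "Strip_leaves = Loop (Minus (Vr 25) (Vr 24))
     (26 ::= Ld 14 (Vr 24) ;;
      30 ::= Ld 13 (Vr 26) ;;
      Put 15 (Vr 26) (Vr 30) ;;
      Put 12 (Vr 30) (Minus (Ld 12 (Vr 30)) (Cn (Suc 0))) ;;
      Put 13 (Vr 30) (Minus (Ld 13 (Vr 30)) (Vr 26)) ;;
      24 ::= Plus (Vr 24) (Cn (Suc 0)) ;;
      Cond (Ne (Ld 12 (Vr 30)) (Cn (Suc 0))) Skip
        (Cond (Ne (Vr 30) (Vr 22)) (Put 14 (Vr 25) (Vr 30) ;; 25 ::= Plus (Vr 25) (Cn (Suc 0))) Skip))"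

text \<open>The queue is read backwards, since leaves are removed before their parents. A parent
  thus has its number before its children ask for it.\<close>

definition Number_rows :: com where
  "Number_rows = For 9 (Vr 2)
     (26 ::= Ld 14 (Minus (Vr 13) (Vr 9)) ;;
      Put 16 (Vr 26) (Vr 9) ;;
      Put 2 (Vr 9) (Ld 16 (Ld 15 (Vr 26))) ;;
      Put 3 (Vr 9) (In (Plus (Vr 7) (Vr 26))) ;;
      Put 4 (Vr 9) (Cn 0))"

section \<open>Access to the encoded input and neighbor sums\<close>

lemma length_concat_pairs: "length (concat (map (\<lambda>(u, v). [u, v]) es)) = 2 * length es"
  by (induction es) auto

lemma nth_concat_pairs:
  "i < length es \<Longrightarrow> concat (map (\<lambda>(u, v). [u, v]) es) ! (2 * i) = fst (es ! i) \<and>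
    concat (map (\<lambda>(u, v). [u, v]) es) ! Suc (2 * i) = snd (es ! i)"
  by (induction es arbitrary: i) (auto simp: nth_Cons split: nat.splits)

text \<open>The first bound is the size \<open>(2 * s + 2) * s\<close> of the stack with frames of
  width \<open>s = n + 1\<close>; it also covers the sums of neighbors, which are at most
  \<open>2 * n * n\<close>. Colors are bounded because they serve as array indices.\<close>

locale motif_input = machine +
  fixes n q :: nat and es :: "(nat \<times> nat) list" and col :: "nat \<Rightarrow> nat" and ms :: "nat list"
  assumes xs: "xs = [n, length es, q, length ms] @ concat (map (\<lambda>(u, v). [u, v]) es) @ map col [0..<n] @ ms"
    and B_bounds: "(2 * (n + 1) + 2) * (n + 1) < B" "5 < B" "length xs < B"
    and col_bound: "\<And>v. v < n \<Longrightarrow> col v < B" and ms_bound: "\<And>x. x \<in> set ms \<Longrightarrow> x < B"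
    and edges: "\<And>u v. (u, v) \<in> set es \<Longrightarrow> u < n \<and> v < n" and edges_le: "length es \<le> n"
begin

abbreviation "off \<equiv> 4 + 2 * length es"

lemma length_xs: "length xs = off + n + length ms"
  by (simp add: xs length_concat_pairs)

lemma xs_head: "xs ! 0 = n" "xs ! Suc 0 = length es" "xs ! 3 = length ms"
  by (simp_all add: xs)

lemma xs_edge:
  assumes "i < length es"
  shows "xs ! (4 + (i + i)) = fst (es ! i)" "xs ! (5 + (i + i)) = snd (es ! i)"
  using assms nth_concat_pairs[OF assms]
  by (auto simp: xs nth_append length_concat_pairs mult_2 nth_Cons numeral_eq_Suc)

lemma xs_col: "v < n \<Longrightarrow> xs ! (off + v) = col v"
  by (simp add: xs nth_append length_concat_pairs nth_Cons numeral_eq_Suc)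

lemma xs_ms: "i < length ms \<Longrightarrow> xs ! (off + n + i) = ms ! i"
  by (simp add: xs nth_append length_concat_pairs nth_Cons numeral_eq_Suc)

lemma small_bounds: "n < B" "Suc n < B" "2 * n * n < B" "0 < B" "Suc 0 < B" "3 < B" "5 < B" "off + n + length ms < B"
  "n + 2 < B" "length es < B" "length ms < B"
proof -
  have "(2 * (n + 1) + 2) * (n + 1) = 2 * n * n + 6 * n + 4" by (simp add: algebra_simps)
  then show "n < B" "Suc n < B" "2 * n * n < B" "0 < B" "Suc 0 < B" "3 < B" "5 < B" "off + n + length ms < B"
    "n + 2 < B" "length es < B" "length ms < B"
    using B_bounds length_xs by linarith+
qed

text \<open>The contribution of the first \<open>k\<close> edges at \<open>v\<close>: the degree if
  \<open>f\<close> is constantly 1, and the sum of the neighbors if \<open>f\<close> is the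
  identity.\<close>

definition acc :: "(nat \<Rightarrow> nat) \<Rightarrow> nat \<Rightarrow> nat \<Rightarrow> nat" where
  "acc f k v = (\<Sum>i<k. (if fst (es ! i) = v then f (snd (es ! i)) else 0) +
     (if snd (es ! i) = v then f (fst (es ! i)) else 0))"

lemma acc_Suc: "acc f (Suc k) v = acc f k v + ((if fst (es ! k) = v then f (snd (es ! k)) else 0) +
     (if snd (es ! k) = v then f (fst (es ! k)) else 0))"
  by (simp add: acc_def)

lemma acc_le:
  assumes "k \<le> length es" "\<And>x. x < n \<Longrightarrow> f x \<le> b"
  shows "acc f k v \<le> 2 * b * k"
proof -
  have "(if fst (es ! i) = v then f (snd (es ! i)) else 0) + (if snd (es ! i) = v then f (fst (es ! i)) else 0)
      \<le> 2 * b" if "i < k" for i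
    using edges[of "fst (es ! i)" "snd (es ! i)"] that assms(1) assms(2)[of "fst (es ! i)"] assms(2)[of "snd (es ! i)"]
    by auto
  then have "acc f k v \<le> (\<Sum>i<k. 2 * b)" unfolding acc_def by (intro sum_mono) auto
  then show ?thesis by (simp add: mult.commute)
qed

lemma clear_degrees:
  assumes "v 9 = 0" "v 2 = n"
  shows "runs Clear_degrees v a (4 * n + 1) (\<lambda>v' a'. (\<forall>x. x \<noteq> 9 \<longrightarrow> v' x = v x) \<and>
    (\<forall>r. r \<notin> {12, 13} \<longrightarrow> a' r = a r) \<and> (\<forall>u<n. a' 12 u = 0 \<and> a' 13 u = 0))"
  unfolding Clear_degrees_def
proof (rule runs_For[where hi = n and T = 2 and I = "\<lambda>k v' a'. (\<forall>x. x \<noteq> 9 \<longrightarrow> v' x = v x) \<and>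
    (\<forall>r. r \<notin> {12, 13} \<longrightarrow> a' r = a r) \<and> (\<forall>u<k. a' 12 u = 0 \<and> a' 13 u = 0)"])
qed (use assms small_bounds in \<open>auto simp: less_Suc_eq\<close>)

lemma add_edges:
  assumes "v 9 = 0" "v 3 = length es" "\<And>u. u < n \<Longrightarrow> a 12 u = 0 \<and> a 13 u = 0"
  shows "runs Add_edges v a (8 * length es + 1) (\<lambda>v' a'. (\<forall>x. x \<notin> {9, 26, 30} \<longrightarrow> v' x = v x) \<and>
    (\<forall>r. r \<notin> {12, 13} \<longrightarrow> a' r = a r) \<and>
    (\<forall>u<n. a' 12 u = acc (\<lambda>_. 1) (length es) u \<and> a' 13 u = acc (\<lambda>x. x) (length es) u))"
  unfolding Add_edges_def
proof (rule runs_For[where hi = "length es" and T = 6 and I = "\<lambda>k v' a'. (\<forall>x. x \<notin> {9, 26, 30} \<longrightarrow> v' x = v x) \<and>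
    (\<forall>r. r \<notin> {12, 13} \<longrightarrow> a' r = a r) \<and> (\<forall>u<n. a' 12 u = acc (\<lambda>_. 1) k u \<and> a' 13 u = acc (\<lambda>x. x) k u)"])
  fix k v' a' assume I: "(\<forall>x. x \<notin> {9, 26, 30} \<longrightarrow> v' x = v x) \<and>
    (\<forall>r. r \<notin> {12, 13} \<longrightarrow> a' r = a r) \<and> (\<forall>u<n. a' 12 u = acc (\<lambda>_. 1) k u \<and> a' 13 u = acc (\<lambda>x. x) k u)"
    and k: "v' 9 = k" "k < length es"
  define x where "x = fst (es ! k)"
  define y where "y = snd (es ! k)"
  have "(x, y) \<in> set es" using k by (simp add: x_def y_def)
  then have xy: "x < n" "y < n" using edges by auto
  have arr: "a' 12 u = acc (\<lambda>_. 1) k u" "a' 13 u = acc (\<lambda>x. x) k u" if "u < n" for u using I that by auto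
  have fr: "\<forall>x. x \<notin> {9, 26, 30} \<longrightarrow> v' x = v x" "\<forall>r. r \<notin> {12, 13} \<longrightarrow> a' r = a r" using I by auto
  have "4 + (k + k) = 2 * k + 4" "5 + (k + k) = 2 * k + 5" by simp_all
  then have in_xs: "xs ! (2 * k + 4) = x" "xs ! (2 * k + 5) = y"
    using xs_edge[OF k(2)] unfolding x_def y_def by metis+
  have n2: "2 * n < B"
  proof -
    have "2 * n \<le> 2 * n * n" using xy by simp
    then show ?thesis using small_bounds(3) by linarith
  qed
  have le: "acc (\<lambda>_. 1) (Suc k) u \<le> 2 * n" "acc (\<lambda>x. x) (Suc k) u \<le> 2 * n * n" for u
  proof -
    have "acc (\<lambda>_. 1) (Suc k) u \<le> 2 * 1 * Suc k" using k by (intro acc_le) auto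
    also have "\<dots> \<le> 2 * n" using k edges_le by simp
    finally show "acc (\<lambda>_. 1) (Suc k) u \<le> 2 * n" .
    have "acc (\<lambda>x. x) (Suc k) u \<le> 2 * n * Suc k" using k by (intro acc_le) auto
    also have "\<dots> \<le> 2 * n * n" using k edges_le by (intro mult_le_mono2) simp
    finally show "acc (\<lambda>x. x) (Suc k) u \<le> 2 * n * n" .
  qed
  have S: "acc f (Suc k) u = acc f k u + ((if x = u then f y else 0) + (if y = u then f x else 0))" for f u
    by (simp add: acc_Suc x_def y_def)
  have b: "4 + (k + k) < length xs" "5 + (k + k) < length xs" "k + k < B" "4 + (k + k) < B" "5 + (k + k) < B"
    "x < B" "y < B"
    using k length_xs xy small_bounds(1,8) by auto
  have b12: "Suc (acc (\<lambda>_. 1) k x) < B" "Suc (acc (\<lambda>_. 1) k y + (if x = y then 1 else 0)) < B"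
    "acc (\<lambda>x. x) k x + y < B" "acc (\<lambda>x. x) k y + (if x = y then y else 0) + x < B"
    using le(1)[of x] le(1)[of y] le(2)[of x] le(2)[of y] n2 small_bounds(3) unfolding S by (auto split: if_splits)
  show "runs (26 ::= In (Plus (Cn 4) (Plus (Vr 9) (Vr 9))) ;;
      30 ::= In (Plus (Cn 5) (Plus (Vr 9) (Vr 9))) ;;
      Put 12 (Vr 26) (Plus (Ld 12 (Vr 26)) (Cn (Suc 0))) ;;
      Put 13 (Vr 26) (Plus (Ld 13 (Vr 26)) (Vr 30)) ;;
      Put 12 (Vr 30) (Plus (Ld 12 (Vr 30)) (Cn (Suc 0))) ;;
      Put 13 (Vr 30) (Plus (Ld 13 (Vr 30)) (Vr 26))) v' a' 6
    (\<lambda>v' a'. v' 9 = k \<and> (\<forall>x. x \<notin> {9, 26, 30} \<longrightarrow> (v'(9 := Suc k)) x = v x) \<and>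
    (\<forall>r. r \<notin> {12, 13} \<longrightarrow> a' r = a r) \<and>
    (\<forall>u<n. a' 12 u = acc (\<lambda>_. 1) (Suc k) u \<and> a' 13 u = acc (\<lambda>x. x) (Suc k) u))"
  \<comment> \<open>Loops are not excluded in this locale; for a loop both updates fall on the same
    cell.\<close>
  proof (cases "x = y")
    case True
    then show ?thesis using fr k b b12 xy small_bounds by (simp add: in_xs arr S)
  next
    case False
    then show ?thesis using fr k b b12 xy small_bounds by (simp add: in_xs arr S)
  qed
qed (use assms small_bounds in \<open>auto simp: acc_def\<close>)

end

locale rooted_input = motif_input xs B n q es col ms + rooted_tree "{..<n}" "set es \<union> (set es)\<inverse>" r par depth
  for xs B n q es col ms r par depth +
  assumes es_distinct: "distinct es" and es_oriented: "set es \<inter> (set es)\<inverse> = {}"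
begin

section \<open>Removal of leaves and the order obtained from it\<close>

definition ch :: "nat \<Rightarrow> nat set" where
  "ch u = {x \<in> {..<n}. x \<noteq> r \<and> par x = u}"

lemma finite_ch [simp]: "finite (ch u)"
  by (simp add: ch_def)

lemma par_notin_ch: "u < n \<Longrightarrow> u \<noteq> r \<Longrightarrow> par u \<notin> ch u"
  using par_depth[of u] par_depth[of "par u"] by (force simp: ch_def)

text \<open>Each edge is listed in one direction only, so every neighbor is counted once, and the
  neighbors are the children and the parent.\<close>

lemma acc_total:
  assumes u: "u < n"
  shows "acc f (length es) u = (\<Sum>x\<in>ch u. f x) + (if u \<noteq> r then f (par u) else 0)"
proof -
  let ?A = "{x. (u, x) \<in> set es}" and ?A' = "{x. (x, u) \<in> set es}"
  have fin: "finite ?A" "finite ?A'"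
    using edges finite_subset[of ?A "{..<n}"] finite_subset[of ?A' "{..<n}"] by auto
  have A: "(\<Sum>e\<in>set es. if fst e = u then f (snd e) else 0) = sum f ?A"
  proof -
    have "(\<Sum>e\<in>set es. if fst e = u then f (snd e) else 0) = (\<Sum>e\<in>{e \<in> set es. fst e = u}. f (snd e))"
      by (simp add: sum.inter_filter)
    also have "\<dots> = sum f ?A" by (rule sum.reindex_bij_witness[of _ "\<lambda>x. (u, x)" snd]) auto
    finally show ?thesis .
  qed
  have A': "(\<Sum>e\<in>set es. if snd e = u then f (fst e) else 0) = sum f ?A'"
  proof -
    have "(\<Sum>e\<in>set es. if snd e = u then f (fst e) else 0) = (\<Sum>e\<in>{e \<in> set es. snd e = u}. f (fst e))"
      by (simp add: sum.inter_filter)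
    also have "\<dots> = sum f ?A'" by (rule sum.reindex_bij_witness[of _ "\<lambda>x. (x, u)" fst]) auto
    finally show ?thesis .
  qed
  have "acc f (length es) u = (\<Sum>e\<in>set es. (if fst e = u then f (snd e) else 0) + (if snd e = u then f (fst e) else 0))"
    unfolding acc_def using es_distinct
    by (simp add: sum.distinct_set_conv_list sum_list_sum_nth atLeast0LessThan)
  also have "\<dots> = sum f ?A + sum f ?A'" by (simp add: sum.distrib A A')
  also have "\<dots> = sum f (?A \<union> ?A')"
    using es_oriented by (intro sum.union_disjoint[symmetric] fin) auto
  also have "?A \<union> ?A' = ch u \<union> (if u \<noteq> r then {par u} else {})"
  proof -
    have "x \<in> ch u \<or> u \<noteq> r \<and> x = par u" if "(u, x) \<in> set es \<union> (set es)\<inverse>" for x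
      using edge_par[OF that] E_sub that by (auto simp: ch_def)
    moreover have "(u, x) \<in> set es \<union> (set es)\<inverse>" if "x \<in> ch u" for x
      using par_edge[of x] that by (auto simp: ch_def)
    moreover have "(u, par u) \<in> set es \<union> (set es)\<inverse>" if "u \<noteq> r" using par_edge[of u] that u by auto
    ultimately show ?thesis by (auto split: if_splits)
  qed
  also have "sum f \<dots> = (\<Sum>x\<in>ch u. f x) + (if u \<noteq> r then f (par u) else 0)"
    using par_notin_ch[OF u] by (auto simp: sum.union_disjoint)
  finally show ?thesis .
qed

text \<open>
  The queue \<open>que\<close> has length \<open>t\<close>, and its first \<open>h\<close> vertices have been removed from the tree.
\<close>

definition strip_inv :: "nat \<Rightarrow> nat \<Rightarrow> (nat \<Rightarrow> nat) \<Rightarrow> (nat \<Rightarrow> nat) \<Rightarrow> (nat \<Rightarrow> nat) \<Rightarrow> (nat \<Rightarrow> nat) \<Rightarrow> bool" where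
  "strip_inv h t que dg sm pr \<longleftrightarrow> h \<le> t \<and> inj_on que {..<t} \<and>
     que ` {..<t} = {u. u < n \<and> u \<noteq> r \<and> ch u \<subseteq> que ` {..<h}} \<and>
     (\<forall>i<t. ch (que i) \<subseteq> que ` {..<i}) \<and>
     (\<forall>u<n. u \<notin> que ` {..<h} \<longrightarrow> dg u = card (ch u - que ` {..<h}) + (if u \<noteq> r then 1 else 0) \<and>
        sm u = \<Sum>(ch u - que ` {..<h}) + (if u \<noteq> r then par u else 0)) \<and>
     (\<forall>i<h. pr (que i) = par (que i))"

lemma strip_le: "strip_inv h t que dg sm pr \<Longrightarrow> t \<le> n - 1"
proof -
  assume I: "strip_inv h t que dg sm pr"
  then have "inj_on que {..<t}" unfolding strip_inv_def by blast
  then have "t = card (que ` {..<t})" by (simp add: card_image)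
  also have "\<dots> \<le> card ({..<n} - {r})" using I by (intro card_mono) (auto simp: strip_inv_def)
  also have "\<dots> = n - 1" using root_in by simp
  finally show "t \<le> n - 1" .
qed

text \<open>All children of \<open>w\<close> have been removed, so its degree is 1 and what remains
  of its sum of neighbors is the parent. Only the counts of this parent \<open>u\<close> change; it
  joins the queue exactly when its last child has gone.\<close>

lemma strip_step:
  assumes I: "strip_inv h t que dg sm pr" and ht: "h < t"
  defines "w \<equiv> que h" and "u \<equiv> sm (que h)"
  defines "dg' \<equiv> dg(u := dg u - 1)"
  shows "w < n" "u < n"
    "strip_inv (Suc h) (if dg' u = 1 \<and> u \<noteq> r then Suc t else t) (if dg' u = 1 \<and> u \<noteq> r then que(t := u) else que)
       dg' (sm(u := sm u - w)) (pr(w := u))"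
proof -
  let ?P = "que ` {..<h}" and ?P' = "que ` {..<Suc h}"
  have inj: "inj_on que {..<t}" and Q: "que ` {..<t} = {u. u < n \<and> u \<noteq> r \<and> ch u \<subseteq> ?P}"
    and ord: "\<And>i. i < t \<Longrightarrow> ch (que i) \<subseteq> que ` {..<i}"
    and deg: "\<And>u. u < n \<Longrightarrow> u \<notin> ?P \<Longrightarrow> dg u = card (ch u - ?P) + (if u \<noteq> r then 1 else 0) \<and>
        sm u = \<Sum>(ch u - ?P) + (if u \<noteq> r then par u else 0)"
    and pr: "\<And>i. i < h \<Longrightarrow> pr (que i) = par (que i)"
    using I by (auto simp: strip_inv_def)
  have "w \<in> que ` {..<t}" using ht by (auto simp: w_def)
  then have w: "w < n" "w \<noteq> r" "ch w \<subseteq> ?P" using Q by auto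
  have wP: "w \<notin> ?P" using inj ht by (auto simp: w_def dest!: inj_onD)
  have e: "ch w - ?P = {}" using w by blast
  have u: "u = par w" using deg[OF w(1) wP] w(2) unfolding e by (simp add: u_def w_def)
  show "w < n" by fact
  show un: "u < n" using par_in[of w] w u by auto
  have wch: "w \<in> ch u" using w u by (simp add: ch_def)
  have P': "?P' = insert w ?P" by (simp add: lessThan_Suc w_def)
  \<comment> \<open>A removed vertex has all its children at earlier positions of the queue, while
    the child \<open>w\<close> of \<open>u\<close> is still present.\<close>
  have uP: "u \<notin> ?P"
  proof
    assume "u \<in> ?P"
    then obtain i where i: "i < h" "u = que i" by auto
    then have "w \<in> que ` {..<i}" using ord[of i] ht wch by auto
    then show False using wP i by auto
  qed
  have uw: "u \<noteq> w" using par_depth[of w] w u by auto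
  have uP': "u \<notin> ?P'" using uP uw P' by auto
  have diff: "ch u - ?P = insert w (ch u - ?P')" "w \<notin> ch u - ?P'" using wch wP P' by auto
  have dgu: "dg' u = card (ch u - ?P') + (if u \<noteq> r then 1 else 0)"
    and smu: "sm u - w = \<Sum>(ch u - ?P') + (if u \<noteq> r then par u else 0)"
    using deg[OF un uP] diff by (simp_all add: dg'_def)
  have new: "dg' u = 1 \<and> u \<noteq> r \<longleftrightarrow> ch u \<subseteq> ?P' \<and> u \<noteq> r" using dgu by auto
  have same: "ch x - ?P' = ch x - ?P" if "x \<noteq> u" for x using that u P' by (auto simp: ch_def)
  have Q': "{x. x < n \<and> x \<noteq> r \<and> ch x \<subseteq> ?P'} = que ` {..<t} \<union> (if dg' u = 1 \<and> u \<noteq> r then {u} else {})"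
  proof -
    have "ch x \<subseteq> ?P' \<longleftrightarrow> ch x \<subseteq> ?P" if "x \<noteq> u" for x using same[OF that] by blast
    moreover have "\<not> ch u \<subseteq> ?P" using wch wP by blast
    ultimately have "x < n \<and> x \<noteq> r \<and> ch x \<subseteq> ?P' \<longleftrightarrow>
        x < n \<and> x \<noteq> r \<and> ch x \<subseteq> ?P \<or> x = u \<and> ch u \<subseteq> ?P' \<and> u \<noteq> r" for x
      using un by (cases "x = u") auto
    then show ?thesis unfolding Q new by (auto split: if_splits)
  qed
  have all: "(\<forall>x<n. x \<notin> ?P' \<longrightarrow> dg' x = card (ch x - ?P') + (if x \<noteq> r then 1 else 0) \<and>
        (sm(u := sm u - w)) x = \<Sum>(ch x - ?P') + (if x \<noteq> r then par x else 0))"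
  proof (intro allI impI)
    fix x assume x: "x < n" "x \<notin> ?P'"
    show "dg' x = card (ch x - ?P') + (if x \<noteq> r then 1 else 0) \<and>
        (sm(u := sm u - w)) x = \<Sum>(ch x - ?P') + (if x \<noteq> r then par x else 0)"
    proof (cases "x = u")
      case True
      then show ?thesis using dgu smu by simp
    next
      case False
      then show ?thesis using deg[of x] x P' same[OF False] by (simp add: dg'_def)
    qed
  qed
  have prs: "\<forall>i<Suc h. (pr(w := u)) (que i) = par (que i)"
    using pr u wP by (auto simp: less_Suc_eq w_def)
  show "strip_inv (Suc h) (if dg' u = 1 \<and> u \<noteq> r then Suc t else t) (if dg' u = 1 \<and> u \<noteq> r then que(t := u) else que)
       dg' (sm(u := sm u - w)) (pr(w := u))"
  proof (cases "dg' u = 1 \<and> u \<noteq> r")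
    case False
    then show ?thesis using ht inj Q' ord all prs unfolding strip_inv_def by auto
  next
    case True
    let ?que = "que(t := u)"
    have img: "?que ` {..<i} = que ` {..<i}" if "i \<le> t" for i using that by (intro image_cong) auto
    have uQ: "u \<notin> que ` {..<t}" using Q wch wP by auto
    have "inj_on ?que {..<Suc t}" using inj uQ by (auto simp: lessThan_Suc inj_on_def)
    moreover have "?que ` {..<Suc t} = {x. x < n \<and> x \<noteq> r \<and> ch x \<subseteq> ?que ` {..<Suc h}}"
    proof -
      have "?que ` {..<Suc t} = insert u (que ` {..<t})" 
        unfolding lessThan_Suc image_insert img[OF order_refl] by simp
      then show ?thesis using Q' True img[of "Suc h"] ht by auto
    qed
    moreover have "ch (?que i) \<subseteq> ?que ` {..<i}" if "i < Suc t" for i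
    proof (cases "i = t")
      case False
      then show ?thesis using ord[of i] that img[of i] by simp
    next
      case eq: True
      have "ch u \<subseteq> ?P'" using True new by blast
      also have "\<dots> \<subseteq> que ` {..<t}" using ht by (intro image_mono) auto
      finally show ?thesis using eq img[of t] by simp
    qed
    ultimately show ?thesis using ht True all prs img[of "Suc h"] unfolding strip_inv_def by auto
  qed
qed

text \<open>If vertices other than the root were left, one of maximal depth among them would have no
  remaining children and would therefore be in the queue.\<close>

lemma strip_done:
  assumes I: "strip_inv t t que dg sm pr"
  shows "t = n - 1" "bij_betw que {..<n - 1} ({..<n} - {r})" "\<forall>i<n - 1. ch (que i) \<subseteq> que ` {..<i} \<and> pr (que i) = par (que i)"
proof -
  let ?P = "que ` {..<t}"
  have inj: "inj_on que {..<t}" and Q: "?P = {u. u < n \<and> u \<noteq> r \<and> ch u \<subseteq> ?P}" using I by (auto simp: strip_inv_def)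
  have "?P = {..<n} - {r}"
  proof (rule ccontr)
    assume "?P \<noteq> {..<n} - {r}"
    then have ne: "{..<n} - {r} - ?P \<noteq> {}" using Q by auto
    define m where "m = Max (depth ` ({..<n} - {r} - ?P))"
    have "m \<in> depth ` ({..<n} - {r} - ?P)" unfolding m_def using ne by (intro Max_in) auto
    then obtain v where v: "v < n" "v \<noteq> r" "v \<notin> ?P" "depth v = m" by auto
    have "x \<in> ?P" if "x \<in> ch v" for x
    proof (rule ccontr)
      assume "x \<notin> ?P"
      then have "depth x \<le> m" using that unfolding m_def by (intro Max_ge) (auto simp: ch_def)
      moreover have "depth v < depth x" using par_depth[of x] that by (auto simp: ch_def)
      ultimately show False using v by simp
    qed
    then have "v \<in> ?P" using Q v by blast
    then show False using v by simp
  qed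
  moreover from this have "t = n - 1" using card_image[OF inj] root_in by simp
  ultimately show "t = n - 1" "bij_betw que {..<n - 1} ({..<n} - {r})" "\<forall>i<n - 1. ch (que i) \<subseteq> que ` {..<i} \<and> pr (que i) = par (que i)"
    using inj I by (auto simp: bij_betw_def strip_inv_def)
qed

definition layout :: "(nat \<Rightarrow> nat) \<Rightarrow> (nat \<Rightarrow> nat) \<Rightarrow> (nat \<Rightarrow> nat) \<Rightarrow> bool" where
  "layout ord p c \<longleftrightarrow> bij_betw ord {..<n} {..<n} \<and> ord 0 = r \<and>
     (\<forall>j\<in>{1..<n}. p j < j \<and> ord (p j) = par (ord j) \<and> c j = col (ord j))"

text \<open>Children precede their parents in the queue, so in the reversed order parents come
  first. The root is not in the queue and gets position 0.\<close>

lemma strip_order: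
  assumes "bij_betw que {..<n - 1} ({..<n} - {r})" "\<forall>i<n - 1. ch (que i) \<subseteq> que ` {..<i}"
  defines "ord \<equiv> \<lambda>j. if j = 0 then r else que (n - 1 - j)"
  shows "bij_betw ord {..<n} {..<n}" "\<And>k. k \<in> {1..<n} \<Longrightarrow> \<exists>i<k. par (ord k) = ord i"
proof -
  have n: "0 < n" using root_in by auto
  have "bij_betw (\<lambda>j. n - 1 - j) {1..<n} {..<n - 1}"
    by (rule bij_betwI[where g = "\<lambda>j. n - 1 - j"]) auto
  from bij_betw_trans[OF this assms(1)] have "bij_betw (\<lambda>j. que (n - 1 - j)) {1..<n} ({..<n} - {r})"
    by (simp add: comp_def)
  then have b: "bij_betw ord {1..<n} ({..<n} - {r})" by (subst bij_betw_cong[of _ _ "\<lambda>j. que (n - 1 - j)"]) (auto simp: ord_def)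
  have "bij_betw ord {0} {r}" by (simp add: ord_def)
  from bij_betw_combine[OF this b] have "bij_betw ord ({0} \<union> {1..<n}) ({r} \<union> ({..<n} - {r}))" by auto
  moreover have "{0} \<union> {1..<n} = {..<n}" "{r} \<union> ({..<n} - {r}) = {..<n}" using n root_in by auto
  ultimately show bij: "bij_betw ord {..<n} {..<n}" by simp
  fix k assume k: "k \<in> {1..<n}"
  have ok: "ord k < n" "ord k \<noteq> r" using bij_betwE[OF b] k by auto
  then have "par (ord k) < n" using par_in[of "ord k"] by simp
  then obtain i where i: "i < n" "par (ord k) = ord i" using bij unfolding bij_betw_def by (metis imageE lessThan_iff)
  moreover have "i < k"
  proof (cases "i = 0")
    case False
    then have "ord k \<in> ch (que (n - 1 - i))" using i ok by (auto simp: ch_def ord_def)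
    moreover have "n - 1 - i < n - 1" using i False by linarith
    ultimately have "ord k \<in> que ` {..<n - 1 - i}" using assms(2) by blast
    then obtain l where l: "l < n - 1 - i" "que (n - 1 - k) = que l" using k by (auto simp: ord_def)
    have "inj_on que {..<n - 1}" using assms(1) by (simp add: bij_betw_def)
    moreover have "n - 1 - k < n - 1" "l < n - 1" using k l(1) by auto
    ultimately have "n - 1 - k = l" using l(2) unfolding inj_on_def by blast
    then show ?thesis using l by simp
  qed (use k in simp)
  ultimately show "\<exists>i<k. par (ord k) = ord i" by blast
qed

lemma push_leaves:
  assumes "v 9 = 0" "v 25 = 0" "v 2 = n" "v 22 = r"
    "\<And>u. u < n \<Longrightarrow> a 12 u = acc (\<lambda>_. 1) (length es) u \<and> a 13 u = acc (\<lambda>x. x) (length es) u"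
  shows "runs Push_leaves v a (6 * n + 1) (\<lambda>v' a'. (\<forall>x. x \<notin> {9, 25} \<longrightarrow> v' x = v x) \<and>
    (\<forall>r. r \<noteq> 14 \<longrightarrow> a' r = a r) \<and> strip_inv 0 (v' 25) (a' 14) (a' 12) (a' 13) (a' 15))"
  unfolding Push_leaves_def
proof (rule runs_For[where hi = n and T = 4 and I = "\<lambda>k v' a'. (\<forall>x. x \<notin> {9, 25} \<longrightarrow> v' x = v x) \<and>
    (\<forall>r. r \<noteq> 14 \<longrightarrow> a' r = a r) \<and> v' 25 \<le> k \<and> inj_on (a' 14) {..<v' 25} \<and>
    a' 14 ` {..<v' 25} = {u. u < k \<and> u \<noteq> r \<and> a 12 u = 1}"])
  fix k v' a' assume I: "(\<forall>x. x \<notin> {9, 25} \<longrightarrow> v' x = v x) \<and>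
    (\<forall>r. r \<noteq> 14 \<longrightarrow> a' r = a r) \<and> v' 25 \<le> k \<and> inj_on (a' 14) {..<v' 25} \<and>
    a' 14 ` {..<v' 25} = {u. u < k \<and> u \<noteq> r \<and> a 12 u = 1}" and k: "v' 9 = k" "k < n"
  define t where "t = v' 25"
  have v': "v' 22 = r" "a' 12 = a 12" using I assms by auto
  have b: "k < B" "t < B" "Suc t < B" using I k small_bounds unfolding t_def by auto
  have J: "inj_on (a' 14) {..<t}" "a' 14 ` {..<t} = {u. u < k \<and> u \<noteq> r \<and> a 12 u = 1}" "t \<le> k" using I by (auto simp: t_def)
  have img: "((a' 14)(t := k)) ` {..<Suc t} = insert k (a' 14 ` {..<t})"
  proof -
    have "((a' 14)(t := k)) ` {..<t} = a' 14 ` {..<t}" by (intro image_cong) auto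
    then show ?thesis unfolding lessThan_Suc image_insert by simp
  qed
  have "k \<notin> a' 14 ` {..<t}" using J(2) by auto
  then have inj: "inj_on ((a' 14)(t := k)) {..<Suc t}" using J(1) by (auto simp: lessThan_Suc inj_on_def)
  have set: "{u. u < Suc k \<and> u \<noteq> r \<and> a 12 u = 1} =
      (if k \<noteq> r \<and> a 12 k = 1 then insert k {u. u < k \<and> u \<noteq> r \<and> a 12 u = 1} else {u. u < k \<and> u \<noteq> r \<and> a 12 u = 1})"
    by (auto simp: less_Suc_eq)
  have fr: "\<forall>x. x \<notin> {9, 25} \<longrightarrow> v' x = v x" "\<forall>r. r \<noteq> 14 \<longrightarrow> a' r = a r" using I by auto
  show "runs (Cond (Ne (Ld 12 (Vr 9)) (Cn (Suc 0))) Skip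
       (Cond (Ne (Vr 9) (Vr 22)) (Put 14 (Vr 25) (Vr 9) ;; 25 ::= Plus (Vr 25) (Cn (Suc 0))) Skip)) v' a' 4
    (\<lambda>v' a'. v' 9 = k \<and> (\<forall>x. x \<notin> {9, 25} \<longrightarrow> (v'(9 := Suc k)) x = v x) \<and>
    (\<forall>r. r \<noteq> 14 \<longrightarrow> a' r = a r) \<and> (v'(9 := Suc k)) 25 \<le> Suc k \<and> inj_on (a' 14) {..<(v'(9 := Suc k)) 25} \<and>
    a' 14 ` {..<(v'(9 := Suc k)) 25} = {u. u < Suc k \<and> u \<noteq> r \<and> a 12 u = 1})"
    unfolding set using fr k b small_bounds J inj img by (simp add: v' t_def[symmetric])
next
  fix v' a' assume I: "(\<forall>x. x \<notin> {9, 25} \<longrightarrow> v' x = v x) \<and>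
    (\<forall>r. r \<noteq> 14 \<longrightarrow> a' r = a r) \<and> v' 25 \<le> n \<and> inj_on (a' 14) {..<v' 25} \<and>
    a' 14 ` {..<v' 25} = {u. u < n \<and> u \<noteq> r \<and> a 12 u = 1}"
  have deg: "a 12 u = card (ch u) + (if u \<noteq> r then 1 else 0)" "a 13 u = \<Sum>(ch u) + (if u \<noteq> r then par u else 0)"
    if "u < n" for u using assms(5)[OF that] acc_total[OF that] by simp_all
  then have leaf: "{u. u < n \<and> u \<noteq> r \<and> a 12 u = 1} = {u. u < n \<and> u \<noteq> r \<and> ch u = {}}" by auto
  have "ch (a' 14 i) = {}" if "i < v' 25" for i
  proof -
    have "a' 14 i \<in> a' 14 ` {..<v' 25}" using that by simp
    then show ?thesis using I leaf by auto
  qed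
  moreover have "a' 12 = a 12" "a' 13 = a 13" using I by auto
  ultimately have "strip_inv 0 (v' 25) (a' 14) (a' 12) (a' 13) (a' 15)"
    using I leaf deg unfolding strip_inv_def by simp
  then show "(\<forall>x. x \<notin> {9, 25} \<longrightarrow> v' x = v x) \<and>
    (\<forall>r. r \<noteq> 14 \<longrightarrow> a' r = a r) \<and> strip_inv 0 (v' 25) (a' 14) (a' 12) (a' 13) (a' 15)" using I by simp
qed (use assms small_bounds in auto)

lemma strip_leaves:
  assumes "v 24 = 0" "v 22 = r" "strip_inv 0 (v 25) (a 14) (a 12) (a 13) (a 15)"
  shows "runs Strip_leaves v a (11 * n + 1) (\<lambda>v' a'. (\<forall>x. x \<notin> {24, 25, 26, 30} \<longrightarrow> v' x = v x) \<and>
    (\<forall>r. r \<notin> {12, 13, 14, 15} \<longrightarrow> a' r = a r) \<and>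
    strip_inv (v' 25) (v' 25) (a' 14) (a' 12) (a' 13) (a' 15))"
  unfolding Strip_leaves_def
proof (rule runs_Loop[where k = n and T = 10 and I = "\<lambda>k v' a'. v' 24 + k = n \<and> (\<forall>x. x \<notin> {24, 25, 26, 30} \<longrightarrow> v' x = v x) \<and>
    (\<forall>r. r \<notin> {12, 13, 14, 15} \<longrightarrow> a' r = a r) \<and> strip_inv (v' 24) (v' 25) (a' 14) (a' 12) (a' 13) (a' 15)"])
  fix k v' a' assume I: "v' 24 + k = n \<and> (\<forall>x. x \<notin> {24, 25, 26, 30} \<longrightarrow> v' x = v x) \<and>
    (\<forall>r. r \<notin> {12, 13, 14, 15} \<longrightarrow> a' r = a r) \<and> strip_inv (v' 24) (v' 25) (a' 14) (a' 12) (a' 13) (a' 15)"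
  define h where "h = v' 24"
  define t where "t = v' 25"
  have fr: "\<forall>x. x \<notin> {24, 25, 26, 30} \<longrightarrow> v' x = v x" "\<forall>r. r \<notin> {12, 13, 14, 15} \<longrightarrow> a' r = a r" using I by auto
  have inv: "strip_inv h t (a' 14) (a' 12) (a' 13) (a' 15)" "h + k = n" using I by (auto simp: h_def t_def)
  have ht: "h \<le> t" using inv by (simp add: strip_inv_def)
  show "(\<forall>x. x \<notin> {24, 25, 26, 30} \<longrightarrow> v' x = v x) \<and> (\<forall>r. r \<notin> {12, 13, 14, 15} \<longrightarrow> a' r = a r) \<and>
      strip_inv (v' 25) (v' 25) (a' 14) (a' 12) (a' 13) (a' 15)" if "val (Minus (Vr 25) (Vr 24)) v' a' = 0"
    using that I ht by (simp add: h_def t_def)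
  assume "val (Minus (Vr 25) (Vr 24)) v' a' \<noteq> 0"
  then have ht: "h < t" by (simp add: h_def t_def)
  define w where "w = a' 14 h"
  define u where "u = a' 13 w"
  note step = strip_step[OF inv(1) ht, folded w_def, folded u_def]
  have tn: "t \<le> n - 1" using strip_le[OF inv(1)] .
  have b: "h < B" "t < B" "Suc t < B" "Suc h < B" "w < B" "u < B" "Suc 0 < B"
    using ht tn small_bounds step(1,2) by auto
  have k: "0 < k" "Suc (h + (k - 1)) = n" using ht tn inv(2) by auto
  have h': "v' 24 = h" "v' 25 = t" "v' 22 = r" "a' 14 h = w" "a' 13 w = u"
    using assms fr by (auto simp: h_def t_def w_def u_def)
  have "runs (26 ::= Ld 14 (Vr 24) ;;
      30 ::= Ld 13 (Vr 26) ;;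
      Put 15 (Vr 26) (Vr 30) ;;
      Put 12 (Vr 30) (Minus (Ld 12 (Vr 30)) (Cn (Suc 0))) ;;
      Put 13 (Vr 30) (Minus (Ld 13 (Vr 30)) (Vr 26)) ;;
      24 ::= Plus (Vr 24) (Cn (Suc 0)) ;;
      Cond (Ne (Ld 12 (Vr 30)) (Cn (Suc 0))) Skip
        (Cond (Ne (Vr 30) (Vr 22)) (Put 14 (Vr 25) (Vr 30) ;; 25 ::= Plus (Vr 25) (Cn (Suc 0))) Skip)) v' a' 10
     (\<lambda>v' a'. v' 24 + (k - 1) = n \<and> (\<forall>x. x \<notin> {24, 25, 26, 30} \<longrightarrow> v' x = v x) \<and>
    (\<forall>r. r \<notin> {12, 13, 14, 15} \<longrightarrow> a' r = a r) \<and> strip_inv (v' 24) (v' 25) (a' 14) (a' 12) (a' 13) (a' 15))"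
    using fr b k step(3) by (cases "a' 12 u - Suc 0 = Suc 0"; cases "u = r") (simp_all add: h')
  from k(1) this show "0 < k \<and> runs (26 ::= Ld 14 (Vr 24) ;;
      30 ::= Ld 13 (Vr 26) ;;
      Put 15 (Vr 26) (Vr 30) ;;
      Put 12 (Vr 30) (Minus (Ld 12 (Vr 30)) (Cn (Suc 0))) ;;
      Put 13 (Vr 30) (Minus (Ld 13 (Vr 30)) (Vr 26)) ;;
      24 ::= Plus (Vr 24) (Cn (Suc 0)) ;;
      Cond (Ne (Ld 12 (Vr 30)) (Cn (Suc 0))) Skip
        (Cond (Ne (Vr 30) (Vr 22)) (Put 14 (Vr 25) (Vr 30) ;; 25 ::= Plus (Vr 25) (Cn (Suc 0))) Skip)) v' a' 10
     (\<lambda>v' a'. v' 24 + (k - 1) = n \<and> (\<forall>x. x \<notin> {24, 25, 26, 30} \<longrightarrow> v' x = v x) \<and>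
    (\<forall>r. r \<notin> {12, 13, 14, 15} \<longrightarrow> a' r = a r) \<and> strip_inv (v' 24) (v' 25) (a' 14) (a' 12) (a' 13) (a' 15))"
    by (rule conjI)
qed (use assms in auto)

lemma number_rows:
  assumes v: "v 9 = 1" "v 2 = n" "v 13 = n - 1" "v 7 = off" and que: "a 16 r = 0"
    and inv: "bij_betw (a 14) {..<n - 1} ({..<n} - {r})"
      "\<forall>i<n - 1. ch (a 14 i) \<subseteq> a 14 ` {..<i} \<and> a 15 (a 14 i) = par (a 14 i)"
  shows "runs Number_rows v a (7 * n + 1) (\<lambda>v' a'. (\<forall>x. x \<notin> {9, 26} \<longrightarrow> v' x = v x) \<and>
    (\<forall>r. r \<notin> {2, 3, 4, 16} \<longrightarrow> a' r = a r) \<and> (\<forall>j\<in>{1..<n}. a' 4 j = 0) \<and>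
    (\<exists>ord. layout ord (a' 2) (a' 3)))"
proof -
  define ord where "ord = (\<lambda>j. if j = 0 then r else a 14 (n - 1 - j))"
  have bij: "bij_betw ord {..<n} {..<n}" and up: "\<And>k. k \<in> {1..<n} \<Longrightarrow> \<exists>i<k. par (ord k) = ord i"
    using strip_order[OF inv(1)] inv(2) by (auto simp: ord_def)
  have n: "0 < n" using root_in by auto
  show ?thesis
    unfolding Number_rows_def
  proof (rule runs_For[where hi = n and T = 5 and I = "\<lambda>k v' a'. 1 \<le> k \<and> (\<forall>x. x \<notin> {9, 26} \<longrightarrow> v' x = v x) \<and>
      (\<forall>r. r \<notin> {2, 3, 4, 16} \<longrightarrow> a' r = a r) \<and> (\<forall>j<k. a' 16 (ord j) = j) \<and>
      (\<forall>j\<in>{1..<k}. a' 4 j = 0 \<and> a' 2 j < j \<and> ord (a' 2 j) = par (ord j) \<and> a' 3 j = col (ord j))"])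
    fix k v' a' assume I: "1 \<le> k \<and> (\<forall>x. x \<notin> {9, 26} \<longrightarrow> v' x = v x) \<and>
      (\<forall>r. r \<notin> {2, 3, 4, 16} \<longrightarrow> a' r = a r) \<and> (\<forall>j<k. a' 16 (ord j) = j) \<and>
      (\<forall>j\<in>{1..<k}. a' 4 j = 0 \<and> a' 2 j < j \<and> ord (a' 2 j) = par (ord j) \<and> a' 3 j = col (ord j))"
      and k: "v' 9 = k" "k < n"
    have fr: "\<forall>x. x \<notin> {9, 26} \<longrightarrow> v' x = v x" "\<forall>r. r \<notin> {2, 3, 4, 16} \<longrightarrow> a' r = a r" and k1: "1 \<le> k"
      and num: "\<And>j. j < k \<Longrightarrow> a' 16 (ord j) = j"
      and old: "\<And>j. j \<in> {1..<k} \<Longrightarrow> a' 4 j = 0 \<and> a' 2 j < j \<and> ord (a' 2 j) = par (ord j) \<and> a' 3 j = col (ord j)"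
      using I by auto
    define w where "w = ord k"
    have w: "w < n" "w \<noteq> r" "a 14 (n - 1 - k) = w" "a 15 w = par w"
    proof -
      show e: "a 14 (n - 1 - k) = w" using k1 by (simp add: w_def ord_def)
      have "n - 1 - k < n - 1" using k k1 by simp
      then show "w < n" "w \<noteq> r" "a 15 w = par w" using inv bij_betwE[OF inv(1)] e by auto
    qed
    obtain i where i: "i < k" "par w = ord i" using up[of k] k k1 by (auto simp: w_def)
    have diff: "ord j \<noteq> w" if "j < k" for j
      using bij that k by (auto simp: w_def bij_betw_def dest!: inj_onD)
    have pi: "ord i < n" using par_in[of w] w i by auto
    have arr: "a' 14 = a 14" "a' 15 = a 15" "v' 13 = n - 1" "v' 7 = off" using fr v by auto
    have b: "k < B" "n - 1 - k < B" "w < B" "ord i < B" "off + w < length xs" "off + w < B" "4 < B" "0 < B"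
      using k w pi small_bounds length_xs B_bounds by auto
    show "runs (26 ::= Ld 14 (Minus (Vr 13) (Vr 9)) ;;
        Put 16 (Vr 26) (Vr 9) ;;
        Put 2 (Vr 9) (Ld 16 (Ld 15 (Vr 26))) ;;
        Put 3 (Vr 9) (In (Plus (Vr 7) (Vr 26))) ;;
        Put 4 (Vr 9) (Cn 0)) v' a' 5
      (\<lambda>v' a'. v' 9 = k \<and> 1 \<le> Suc k \<and> (\<forall>x. x \<notin> {9, 26} \<longrightarrow> (v'(9 := Suc k)) x = v x) \<and>
      (\<forall>r. r \<notin> {2, 3, 4, 16} \<longrightarrow> a' r = a r) \<and> (\<forall>j<Suc k. a' 16 (ord j) = j) \<and>
      (\<forall>j\<in>{1..<Suc k}. a' 4 j = 0 \<and> a' 2 j < j \<and> ord (a' 2 j) = par (ord j) \<and> a' 3 j = col (ord j)))"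
      unfolding ball_less_Suc[OF k1] less_Suc_eq
      using fr k b w i diff num old xs_col[OF w(1)] by (simp add: arr w_def[symmetric] all_conj_distrib imp_conjR)
  next
    fix v' a' assume I: "1 \<le> n \<and> (\<forall>x. x \<notin> {9, 26} \<longrightarrow> v' x = v x) \<and>
      (\<forall>r. r \<notin> {2, 3, 4, 16} \<longrightarrow> a' r = a r) \<and> (\<forall>j<n. a' 16 (ord j) = j) \<and>
      (\<forall>j\<in>{1..<n}. a' 4 j = 0 \<and> a' 2 j < j \<and> ord (a' 2 j) = par (ord j) \<and> a' 3 j = col (ord j))"
    then have "layout ord (a' 2) (a' 3)" using bij by (simp add: layout_def ord_def)
    with I show "(\<forall>x. x \<notin> {9, 26} \<longrightarrow> v' x = v x) \<and> (\<forall>r. r \<notin> {2, 3, 4, 16} \<longrightarrow> a' r = a r) \<and>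
      (\<forall>j\<in>{1..<n}. a' 4 j = 0) \<and> (\<exists>ord. layout ord (a' 2) (a' 3))" by blast
  qed (use v n que small_bounds in \<open>auto simp: ord_def\<close>)
qed

end


section \<open>The kernel of a rooted tree\<close>

context motif_input
begin

definition mult :: "nat \<Rightarrow> nat" where
  "mult x = card {v \<in> {..<n}. col v = x}"

text \<open>No parent function occurs, so that the predicate makes sense for all roots at once,
  outside the context of a particular rooting.\<close>

definition msol :: "nat \<Rightarrow> bool" where
  "msol r \<longleftrightarrow> (\<exists>S\<subseteq>{..<n}. r \<in> S \<and> (\<forall>u\<in>S. \<forall>v\<in>S. (u, v) \<in> ((set es \<union> (set es)\<inverse>) \<inter> S \<times> S)\<^sup>*) \<and>
     inj_on col S \<and> col ` S = set ms)"

end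

context rooted_input
begin

definition rsol :: bool where
  "rsol \<longleftrightarrow> (\<exists>S\<subseteq>{..<n}. r \<in> S \<and> (\<forall>v\<in>S - {r}. par v \<in> S) \<and> inj_on col S \<and> col ` S = set ms)"

lemma rsol_iff: "rsol \<longleftrightarrow> msol r"
  unfolding rsol_def msol_def using connected_iff_parent_closed by (metis (no_types, lifting))

lemma n_pos: "0 < n"
  using root_in by auto

lemma rows_range: "{1..n - 1} = {1..<n}"
  using n_pos by auto

context
  fixes ord p c :: "nat \<Rightarrow> nat"
  assumes lay: "layout ord p c" and rM: "col r \<in> set ms" and ms_distinct: "distinct ms"
begin

section \<open>Solutions in terms of rows, and the forced rows\<close>

lemma ord_facts: "inj_on ord {..<n}" "ord ` {..<n} = {..<n}" "ord 0 = r"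
  "\<And>j. j \<in> {1..<n} \<Longrightarrow> p j < j \<and> ord (p j) = par (ord j) \<and> c j = col (ord j)"
  using lay by (auto simp: layout_def bij_betw_def)

lemma ord_ne_r: "j \<in> {1..<n} \<Longrightarrow> ord j \<noteq> r"
  using inj_onD[OF ord_facts(1), of j 0] ord_facts(3) n_pos by auto

lemma ord_image: "ord ` {1..<n} = {..<n} - {r}"
proof -
  have e: "insert 0 {1..<n} = {..<n}" using n_pos by auto
  have "ord ` insert 0 {1..<n} = {..<n}" by (simp only: e ord_facts(2))
  then show ?thesis using ord_ne_r ord_facts(3) by auto
qed

lemma sol_colors_eq:
  assumes "is_sol (n - 1) (length ms - 1) p c S" "c ` S \<subseteq> set ms - {col r}"
  shows "c ` S = set ms - {col r}"
proof (rule card_subset_eq)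
  have "card (c ` S) = length ms - 1" using assms(1) by (simp add: is_sol_def card_image)
  then show "card (c ` S) = card (set ms - {col r})" using rM ms_distinct by (simp add: distinct_card)
qed (use assms(2) in auto)

text \<open>The root is row 0 and stays outside the row set, so one vertex and its color are
  subtracted from the motif. Injectivity and cardinality turn the inclusion of colors into
  equality.\<close>

lemma layout_sol:
  "rsol \<longleftrightarrow> (\<exists>S. is_sol (n - 1) (length ms - 1) p c S \<and> c ` S \<subseteq> set ms - {col r})" (is "?A \<longleftrightarrow> ?B")
proof
  assume ?A
  then obtain S where S: "S \<subseteq> {..<n}" "r \<in> S" "\<And>v. v \<in> S \<Longrightarrow> v \<noteq> r \<Longrightarrow> par v \<in> S" "inj_on col S" "col ` S = set ms"
    by (auto simp: rsol_def)
  define S' where "S' = {j \<in> {1..<n}. ord j \<in> S}"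
  have img: "ord ` S' = S - {r}"
  proof -
    have "v \<in> ord ` S'" if "v \<in> S - {r}" for v
    proof -
      have "v \<in> ord ` {1..<n}" unfolding ord_image using that S(1) by auto
      then show ?thesis using that by (auto simp: S'_def)
    qed
    then show ?thesis using ord_ne_r by (auto simp: S'_def)
  qed
  have inj: "inj_on ord S'" by (rule inj_on_subset[OF ord_facts(1)]) (auto simp: S'_def)
  have cS: "c j = col (ord j)" if "j \<in> S'" for j using that ord_facts(4)[of j] by (auto simp: S'_def)
  have injc: "inj_on c S'"
  proof (rule inj_onI)
    fix i j assume ij: "i \<in> S'" "j \<in> S'" "c i = c j"
    then have "col (ord i) = col (ord j)" using cS by simp
    then have "ord i = ord j" using inj_onD[OF S(4), of "ord i" "ord j"] ij(1,2) by (simp add: S'_def)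
    then show "i = j" using inj_onD[OF inj] ij by blast
  qed
  have "card S' = card (S - {r})" using card_image[OF inj] img by simp
  also have "\<dots> = length ms - 1" using S(2) card_image[OF S(4)] S(5) ms_distinct by (simp add: distinct_card)
  finally have card: "card S' = length ms - 1" .
  have "up_closed p S'"
    unfolding up_closed_def
  proof
    fix j assume j: "j \<in> S'"
    then have jn: "j \<in> {1..<n}" "ord j \<in> S" by (auto simp: S'_def)
    have "par (ord j) \<in> S" by (rule S(3)[OF jn(2) ord_ne_r[OF jn(1)]])
    then show "p j = 0 \<or> p j \<in> S'" using ord_facts(4)[OF jn(1)] jn(1) by (auto simp: S'_def)
  qed
  then have "is_sol (n - 1) (length ms - 1) p c S'" using injc card by (auto simp: is_sol_def S'_def)
  moreover have "c ` S' \<subseteq> set ms - {col r}"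
  proof
    fix x assume "x \<in> c ` S'"
    then obtain j where j: "j \<in> S'" "x = col (ord j)" using cS by auto
    then have "ord j \<in> S" "ord j \<noteq> r" using ord_ne_r by (auto simp: S'_def)
    then show "x \<in> set ms - {col r}" using j S(2,4,5) by (auto dest: inj_onD)
  qed
  ultimately show ?B by blast
next
  assume ?B
  then obtain S' where S': "is_sol (n - 1) (length ms - 1) p c S'" "c ` S' \<subseteq> set ms - {col r}" by blast
  have sub: "S' \<subseteq> {1..<n}" and up: "up_closed p S'" and injc: "inj_on c S'"
    using S'(1) unfolding is_sol_def rows_range by blast+
  have cS: "c j = col (ord j)" "ord j < n" "ord j \<noteq> r" if "j \<in> S'" for j
  proof -
    have j: "j \<in> {1..<n}" using that sub by blast
    then show "c j = col (ord j)" "ord j \<noteq> r" using ord_facts(4) ord_ne_r by blast+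
    show "ord j < n" using j ord_image by blast
  qed
  let ?S = "insert r (ord ` S')"
  have colS: "col ` ord ` S' = c ` S'" using cS by (simp add: image_image)
  have 1: "?S \<subseteq> {..<n}" using cS root_in by auto
  have 2: "par v \<in> ?S" if v: "v \<in> ?S - {r}" for v
  proof -
    obtain j where j: "j \<in> S'" "v = ord j" using v by auto
    then have "par v = ord (p j)" using ord_facts(4)[of j] sub by auto
    moreover have "p j = 0 \<or> p j \<in> S'" using up j by (auto simp: up_closed_def)
    ultimately show ?thesis using ord_facts(3) by auto
  qed
  have 3: "inj_on col ?S"
  proof -
    have "inj_on col (ord ` S')"
    proof (rule inj_onI)
      fix x y assume "x \<in> ord ` S'" "y \<in> ord ` S'" and eq: "col x = col y"
      then obtain i j where ij: "i \<in> S'" "x = ord i" "j \<in> S'" "y = ord j" by auto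
      then have "c i = c j" using eq cS by simp
      then show "x = y" using inj_onD[OF injc, of i j] ij by simp
    qed
    moreover have "col r \<notin> col ` (ord ` S' - {r})" using colS S'(2) by auto
    ultimately show ?thesis by simp
  qed
  have 4: "col ` ?S = set ms" unfolding image_insert colS sol_colors_eq[OF S'] using rM by (rule insert_Diff)
  show ?A unfolding rsol_def
    by (intro exI[of _ ?S] conjI ballI insertI1 1 2 3 4)
qed

definition uniq :: "nat \<Rightarrow> bool" where
  "uniq j \<longleftrightarrow> mult (c j) = 1 \<and> c j \<in> set ms"

lemma mult_1_unique: "mult x = 1 \<Longrightarrow> u < n \<Longrightarrow> v < n \<Longrightarrow> col u = x \<Longrightarrow> col v = x \<Longrightarrow> u = v"
proof -
  assume m: "mult x = 1" and uv: "u < n" "v < n" "col u = x" "col v = x"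
  obtain y where y: "{v \<in> {..<n}. col v = x} = {y}" using m unfolding mult_def by (rule card_1_singletonE)
  have "u \<in> {y}" "v \<in> {y}" unfolding y[symmetric] using uv by simp_all
  then show "u = v" by simp
qed

lemma uniq_in_sol:
  assumes "is_sol (n - 1) (length ms - 1) p c S" "c ` S \<subseteq> set ms - {col r}" "j \<in> {1..<n}" "uniq j"
  shows "j \<in> S"
proof -
  have j: "c j = col (ord j)" "ord j < n" "ord j \<noteq> r" using assms(3) ord_facts(2,4) ord_ne_r by auto
  have "c j \<noteq> col r" using mult_1_unique[of "c j" "ord j" r] assms(4) j root_in
    unfolding uniq_def by (metis lessThan_iff)
  then have "c j \<in> c ` S" using assms(4) sol_colors_eq[OF assms(1,2)] by (auto simp: uniq_def)
  then obtain i where i: "i \<in> S" "c i = c j" by auto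
  have "i \<in> {1..<n}" using i(1) assms(1) unfolding is_sol_def rows_range by blast
  then have ci: "c i = col (ord i)" "ord i < n" "i < n" using ord_facts(2,4) by auto
  have m: "mult (c j) = 1" using assms(4) by (simp add: uniq_def)
  have "ord i = ord j"
    by (rule mult_1_unique[OF m ci(2) j(2) trans[OF ci(1)[symmetric] i(2)] j(1)[symmetric]])
  from inj_onD[OF ord_facts(1) this] have "i = j" using ci(3) assms(3) by simp
  then show ?thesis using i(1) by simp
qed

context
  fixes st :: "nat \<Rightarrow> nat" and T g :: "nat set" and k :: nat
  assumes T: "T = {j \<in> {1..n - 1}. st j = 1}" and st01: "\<And>j. j \<in> {1..n - 1} \<Longrightarrow> st j = 0 \<or> st j = 1"
    and uniq_T: "\<And>j. j \<in> {1..<n} \<Longrightarrow> uniq j \<Longrightarrow> j \<in> T"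
    and T_least: "\<And>S. up_closed p S \<Longrightarrow> (\<forall>j\<in>{1..<n}. uniq j \<longrightarrow> j \<in> S) \<Longrightarrow> T \<subseteq> S"
begin

text \<open>\<open>T\<close> consists of the rows with unique motif colors and their ancestors,
  described by minimality. A solution is closed under parents and contains every row of unique motif
  color.\<close>

lemma T_sub_sol:
  assumes "is_sol (n - 1) (length ms - 1) p c S" "c ` S \<subseteq> set ms - {col r}"
  shows "T \<subseteq> S"
  using T_least[of S] uniq_in_sol[OF assms] assms(1) by (auto simp: is_sol_def)

text \<open>As \<open>T\<close> is forced, a color that is repeated in it, lies outside the motif or
  equals that of the root rules out every solution.\<close>

lemma bad_no_sol:
  assumes "\<not> (inj_on c T \<and> c ` T \<subseteq> set ms - {col r})"
  shows "\<not> rsol"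
proof
  assume rsol
  then obtain S where S: "is_sol (n - 1) (length ms - 1) p c S" "c ` S \<subseteq> set ms - {col r}" using layout_sol by blast
  then have "T \<subseteq> S" by (rule T_sub_sol)
  then have "inj_on c T" "c ` T \<subseteq> set ms - {col r}" using S by (auto simp: is_sol_def intro: inj_on_subset)
  then show False using assms by simp
qed

context
  fixes ren :: "nat \<Rightarrow> nat" and N' :: nat and p' c' :: "nat \<Rightarrow> nat"
  assumes good: "inj_on c T" "c ` T \<subseteq> set ms - {col r}"
    and g: "g = set ms - {col r} - c ` T" and k: "k = length ms - 1 - card T"
    and em: "emission (n - 1) p c st g ren N' p' c'"
begin

interpretation E: emission "n - 1" p c st g ren N' p' c' by (rule em)

lemma kept_facts: "x \<in> E.K \<Longrightarrow> st x = 0 \<and> c x \<in> g"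
proof -
  assume "x \<in> E.K"
  then have "x \<in> {1..n - 1}" "ren x \<noteq> 0" unfolding E.K_def by simp_all
  then show ?thesis using E.ren_iff by blast
qed

lemma T_eq_E: "E.T = T"
  using T E.T_def by simp

lemma finite_T: "finite T"
  by (simp add: T)

lemma card_T: "card T \<le> length ms - 1"
proof -
  have "card T = card (c ` T)" using card_image[OF good(1)] by simp
  also have "\<dots> \<le> card (set ms - {col r})" using good(2) by (intro card_mono) auto
  also have "\<dots> = length ms - 1" using rM ms_distinct by (simp add: distinct_card)
  finally show ?thesis .
qed

lemma card_g: "card g = k"
proof -
  have "card g = card (set ms - {col r}) - card (c ` T)" unfolding g using good(2) finite_T by (intro card_Diff_subset) auto
  then show ?thesis using rM ms_distinct card_image[OF good(1)] by (simp add: distinct_card k)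
qed

text \<open>\<open>emitted_sol\<close> speaks of solutions that contain \<open>T\<close> and are
  admissible elsewhere; since \<open>T\<close> is forced, these are all solutions with motif
  colors.\<close>

lemma kernel_sol: "sol N' k p' c' \<longleftrightarrow> rsol"
proof -
  have kT: "k + card T = length ms - 1" using card_T k by simp
  have "sol N' k p' c' \<longleftrightarrow> (\<exists>S. is_sol (n - 1) (length ms - 1) p c S \<and> T \<subseteq> S \<and> (\<forall>j\<in>S - T. st j = 0 \<and> c j \<in> g))"
    using E.emitted_sol[of k] good g unfolding T_eq_E kT by auto
  also have "\<dots> \<longleftrightarrow> (\<exists>S. is_sol (n - 1) (length ms - 1) p c S \<and> c ` S \<subseteq> set ms - {col r})"
  proof (intro ex_cong1 conj_cong refl)
    fix S assume S: "is_sol (n - 1) (length ms - 1) p c S"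
    show "T \<subseteq> S \<and> (\<forall>j\<in>S - T. st j = 0 \<and> c j \<in> g) \<longleftrightarrow> c ` S \<subseteq> set ms - {col r}"
    proof
      assume *: "T \<subseteq> S \<and> (\<forall>j\<in>S - T. st j = 0 \<and> c j \<in> g)"
      show "c ` S \<subseteq> set ms - {col r}"
      proof
        fix x assume "x \<in> c ` S"
        then obtain j where j: "j \<in> S" "x = c j" by auto
        show "x \<in> set ms - {col r}" using * j good(2) g by (cases "j \<in> T") auto
      qed
    next
      assume cS: "c ` S \<subseteq> set ms - {col r}"
      have TS: "T \<subseteq> S" by (rule T_sub_sol[OF S cS])
      moreover have "st j = 0 \<and> c j \<in> g" if "j \<in> S - T" for j
      proof -
        have "j \<in> {1..n - 1}" using that S by (auto simp: is_sol_def)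
        then have "st j = 0" using st01[of j] that T by auto
        moreover have "c j \<notin> c ` T" using that TS S by (auto simp: is_sol_def dest: inj_onD)
        ultimately show ?thesis using cS that g by auto
      qed
      ultimately show "T \<subseteq> S \<and> (\<forall>j\<in>S - T. st j = 0 \<and> c j \<in> g)" by blast
    qed
  qed
  finally show ?thesis using layout_sol by simp
qed

lemma kernel_instance: "instance_rows N' k p' c'"
proof
  have "c' ` {1..N'} \<subseteq> g" unfolding E.emitted_colors using kept_facts by blast
  then have "card (c' ` {1..N'}) \<le> card g" by (intro card_mono) (auto simp: g)
  then show "card (c' ` {1..N'}) \<le> k" using card_g by simp
qed (rule E.emitted_rows)

text \<open>Neither \<open>T\<close> nor the other vertices with the color of the root survive, and
  the two sets are disjoint. The second set is the gain of \<open>u - 1\<close> when there are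
  \<open>u\<close> candidates for the root.\<close>

lemma kernel_size: "N' + card T + (mult (col r) - 1) \<le> n - 1"
proof -
  let ?A = "{j \<in> {1..<n}. c j = col r}"
  have img: "ord ` ?A = {v \<in> {..<n}. col v = col r} - {r}"
  proof -
    have "c j = col (ord j)" if "j \<in> {1..<n}" for j using ord_facts(4)[OF that] by simp
    then have "?A = {j \<in> {1..<n}. col (ord j) = col r}" by (intro Collect_cong) auto
    then have "ord ` ?A = {v \<in> ord ` {1..<n}. col v = col r}" by blast
    then show ?thesis unfolding ord_image by blast
  qed
  have "inj_on ord ?A" by (rule inj_on_subset[OF ord_facts(1)]) auto
  then have "card ?A = card (ord ` ?A)" by (rule card_image[symmetric])
  also note img
  also have "card ({v \<in> {..<n}. col v = col r} - {r}) = mult (col r) - 1" using root_in by (simp add: mult_def)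
  finally have A: "card ?A = mult (col r) - 1" .
  have disj: "T \<inter> ?A = {}" using good(2) by auto
  have "(T \<union> ?A) \<inter> E.K = {}"
  proof -
    have "x \<notin> E.K" if "x \<in> T" for x using kept_facts[of x] that T by auto
    moreover have "x \<notin> E.K" if "x \<in> ?A" for x using kept_facts[of x] that g by auto
    ultimately show ?thesis by blast
  qed
  moreover have "T \<union> ?A \<subseteq> {1..n - 1}" using T by auto
  ultimately have "N' + card (T \<union> ?A) \<le> n - 1" by (intro E.emitted_le)
  moreover have "card (T \<union> ?A) = card T + card ?A" by (rule card_Un_disjoint[OF finite_T _ disj]) simp
  ultimately show ?thesis unfolding A by simp
qed

text \<open>A color in \<open>g\<close> is not unique, as its row would be in \<open>T\<close>; so
  at least \<open>2 * k\<close> vertices have colors in \<open>g\<close>. The root and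
  \<open>T\<close> are further vertices, whence \<open>1 + card T + 2 * k <= n\<close>, and
  \<open>card T + k + 1\<close> is the size of the motif.\<close>

lemma kernel_k:
  assumes pos: "\<And>x. x \<in> set ms \<Longrightarrow> 1 \<le> mult x"
  shows "k + length ms \<le> n"
proof -
  have two: "2 \<le> mult x" if x: "x \<in> g" for x
  proof -
    have "mult x \<noteq> 1"
    proof
      assume m: "mult x = 1"
      then obtain v where v: "v < n" "col v = x" by (auto simp: mult_def card_1_singleton_iff)
      then have "v \<in> ord ` {1..<n}" unfolding ord_image using x g by auto
      then obtain j where j: "j \<in> {1..<n}" "v = ord j" by auto
      then have "c j = x" using ord_facts(4)[of j] v by simp
      then have "uniq j" using m x g by (simp add: uniq_def)
      then have "x \<in> c ` T" using uniq_T j \<open>c j = x\<close> by blast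
      then show False using x g by simp
    qed
    then show ?thesis using pos[of x] x g by auto
  qed
  let ?W = "{v \<in> {..<n}. col v \<in> g}"
  have "2 * k = (\<Sum>x\<in>g. 2)" using card_g by simp
  also have "\<dots> \<le> (\<Sum>x\<in>g. mult x)" using two by (rule sum_mono)
  also have "\<dots> = card (\<Union>x\<in>g. {v \<in> {..<n}. col v = x})"
    unfolding mult_def by (rule card_UN_disjoint[symmetric]) (auto simp: g)
  also have "(\<Union>x\<in>g. {v \<in> {..<n}. col v = x}) = ?W" by auto
  finally have W: "2 * k \<le> card ?W" .
  have Tn: "T \<subseteq> {1..<n}" using T by auto
  let ?U = "insert r (ord ` T)"
  have U: "card ?U = Suc (card T)"
  proof -
    have "inj_on ord T" by (rule inj_on_subset[OF ord_facts(1)]) (use Tn in auto)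
    moreover have "r \<notin> ord ` T" using ord_ne_r Tn by blast
    ultimately show ?thesis using finite_T by (simp add: card_image)
  qed
  have colU: "col x \<notin> g" if "x \<in> ?U" for x
  proof (cases "x = r")
    case False
    then obtain j where "j \<in> T" "x = ord j" using \<open>x \<in> ?U\<close> by auto
    then have "col x = c j" "j \<in> T" using ord_facts(4)[of j] Tn by auto
    then show ?thesis using g by auto
  qed (simp add: g)
  have "?U \<subseteq> {..<n}" using root_in ord_facts(2) Tn by fastforce
  then have "card (?U \<union> ?W) \<le> card {..<n}" by (intro card_mono) auto
  moreover have "?U \<inter> ?W = {}" using colU by blast
  ultimately have "Suc (card T) + 2 * k \<le> n" using W U card_Un_disjoint[of ?U ?W] finite_T by auto
  moreover have "0 < length ms" using rM by auto
  ultimately show ?thesis using card_T k by simp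
qed

end

end

end

end


section \<open>Computing the kernels\<close>

definition Set_good :: com where
  "Set_good = For 9 (Vr 4) (Put 5 (In (Plus (Vr 8) (Vr 9))) (Cn (Suc 0)))"

text \<open>Row \<open>n - i\<close> is treated in round \<open>i\<close>, so rows come in
  decreasing order and a mark is handed on to the parent before the parent's turn. One sweep closes
  the set of marked rows under parents.\<close>

definition Mark :: com where
  "Mark = For 9 (Vr 2)
     (26 ::= Minus (Vr 2) (Vr 9) ;;
      Cond (Ne (Ld 18 (Ld 3 (Vr 26))) (Cn (Suc 0))) Skip
        (Cond (Ld 17 (Ld 3 (Vr 26))) (Put 4 (Vr 26) (Cn (Suc 0))) Skip) ;;
      Cond (Ld 4 (Vr 26)) (Put 4 (Ld 2 (Vr 26)) (Cn (Suc 0))) Skip)"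

text \<open>Each marked row uses up its color. A color that is already gone was repeated, is that of
  the root, or is not in the motif; variable 30 records this failure.\<close>

definition Check :: com where
  "Check = For 9 (Vr 2)
     (Cond (Ld 4 (Vr 9))
       (Cond (Ld 5 (Ld 3 (Vr 9))) (Put 5 (Ld 3 (Vr 9)) (Cn 0)) (30 ::= Cn (Suc 0)) ;;
        21 ::= Minus (Vr 21) (Cn (Suc 0)))
       Skip)"

definition Layout :: com where
  "Layout =
     9 ::= Cn 0 ;;
     Clear_degrees ;;
     9 ::= Cn 0 ;;
     Add_edges ;;
     9 ::= Cn 0 ;;
     25 ::= Cn 0 ;;
     Push_leaves ;;
     24 ::= Cn 0 ;;
     Strip_leaves ;;
     13 ::= Minus (Vr 2) (Cn (Suc 0)) ;;
     Put 16 (Vr 22) (Cn 0) ;;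
     9 ::= Cn (Suc 0) ;;
     Number_rows"

text \<open>The admissible colors are set anew for every root because \<open>Check\<close> deletes
  some of them. Deleted colors are motif colors, so setting the motif again restores array 5
  completely.\<close>

definition Kernel :: com where
  "Kernel =
     9 ::= Cn 0 ;;
     Set_good ;;
     Put 4 (Cn 0) (Cn (Suc 0)) ;;
     9 ::= Cn (Suc 0) ;;
     Mark ;;
     30 ::= Cn 0 ;;
     21 ::= Minus (Vr 4) (Cn (Suc 0)) ;;
     Put 5 (In (Plus (Vr 7) (Vr 22))) (Cn 0) ;;
     9 ::= Cn (Suc 0) ;;
     Check ;;
     Cond (Vr 30) Skip Emit"

context motif_input
begin

lemma set_good:
  assumes "v 9 = 0" "v 4 = length ms" "v 8 = off + n"
  shows "runs Set_good v a (3 * length ms + 1) (\<lambda>v' a'. (\<forall>x. x \<noteq> 9 \<longrightarrow> v' x = v x) \<and>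
    (\<forall>r. r \<noteq> 5 \<longrightarrow> a' r = a r) \<and> (\<forall>x. a' 5 x = (if x \<in> set ms then 1 else a 5 x)))"
  unfolding Set_good_def
proof (rule runs_For[where hi = "length ms" and T = 1 and I = "\<lambda>k v' a'. (\<forall>x. x \<noteq> 9 \<longrightarrow> v' x = v x) \<and>
    (\<forall>r. r \<noteq> 5 \<longrightarrow> a' r = a r) \<and> (\<forall>x. a' 5 x = (if x \<in> (!) ms ` {..<k} then 1 else a 5 x))"])
  fix k v' a' assume I: "(\<forall>x. x \<noteq> 9 \<longrightarrow> v' x = v x) \<and>
    (\<forall>r. r \<noteq> 5 \<longrightarrow> a' r = a r) \<and> (\<forall>x. a' 5 x = (if x \<in> (!) ms ` {..<k} then 1 else a 5 x))"
    and k: "v' 9 = k" "k < length ms"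
  have fr: "\<forall>x. x \<noteq> 9 \<longrightarrow> v' x = v x" "\<forall>r. r \<noteq> 5 \<longrightarrow> a' r = a r"
    and five: "\<And>x. a' 5 x = (if x \<in> (!) ms ` {..<k} then 1 else a 5 x)" using I by auto
  have b: "off + n + k < length xs" "off + n + k < B" "ms ! k < B" "Suc 0 < B"
    using k length_xs small_bounds ms_bound by auto
  have v': "v' 8 = off + n" using fr assms by simp
  show "runs (Put 5 (In (Plus (Vr 8) (Vr 9))) (Cn (Suc 0))) v' a' 1
    (\<lambda>v' a'. v' 9 = k \<and> (\<forall>x. x \<noteq> 9 \<longrightarrow> (v'(9 := Suc k)) x = v x) \<and>
    (\<forall>r. r \<noteq> 5 \<longrightarrow> a' r = a r) \<and> (\<forall>x. a' 5 x = (if x \<in> (!) ms ` {..<Suc k} then 1 else a 5 x)))"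
    unfolding lessThan_Suc image_insert insert_iff
    using fr k b five xs_ms[OF k(2)] by (simp add: v')
next
  fix v' a' assume I: "(\<forall>x. x \<noteq> 9 \<longrightarrow> v' x = v x) \<and>
    (\<forall>r. r \<noteq> 5 \<longrightarrow> a' r = a r) \<and> (\<forall>x. a' 5 x = (if x \<in> (!) ms ` {..<length ms} then 1 else a 5 x))"
  have "(!) ms ` {..<length ms} = set ms" by (auto simp: set_conv_nth)
  with I show "(\<forall>x. x \<noteq> 9 \<longrightarrow> v' x = v x) \<and>
    (\<forall>r. r \<noteq> 5 \<longrightarrow> a' r = a r) \<and> (\<forall>x. a' 5 x = (if x \<in> set ms then 1 else a 5 x))" by simp
qed (use assms small_bounds in auto)

text \<open>The invariant uses \<open>n < j + k\<close> for the rows already swept. Later rounds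
  write only to smaller rows, so closure once achieved persists. Minimality holds because a mark
  arises from a unique motif color or from a marked child.\<close>

lemma mark:
  assumes v: "v 9 = 1" "v 2 = n" and n: "0 < n" and a: "a 4 0 = 1" "\<And>j. j \<in> {1..<n} \<Longrightarrow> a 4 j = 0"
    "\<And>j. j \<in> {1..<n} \<Longrightarrow> a 2 j < j" "\<And>j. j \<in> {1..<n} \<Longrightarrow> a 3 j < B"
  defines "U \<equiv> \<lambda>j. a 18 (a 3 j) = 1 \<and> a 17 (a 3 j) \<noteq> 0"
  shows "runs Mark v a (8 * n + 1) (\<lambda>v' a'. (\<forall>x. x \<notin> {9, 26} \<longrightarrow> v' x = v x) \<and>
    (\<forall>r. r \<noteq> 4 \<longrightarrow> a' r = a r) \<and> a' 4 0 = 1 \<and> (\<forall>j<n. a' 4 j \<le> 1) \<and>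
    (\<forall>j\<in>{1..<n}. (a' 4 j = 1 \<longrightarrow> a' 4 (a 2 j) = 1) \<and> (U j \<longrightarrow> a' 4 j = 1)) \<and>
    (\<forall>S. up_closed (a 2) S \<longrightarrow> (\<forall>j\<in>{1..<n}. U j \<longrightarrow> j \<in> S) \<longrightarrow> (\<forall>j\<in>{1..<n}. a' 4 j = 1 \<longrightarrow> j \<in> S)))"
  unfolding Mark_def
proof (rule runs_For[where hi = n and T = 6 and I = "\<lambda>k v' a'. 1 \<le> k \<and> (\<forall>x. x \<notin> {9, 26} \<longrightarrow> v' x = v x) \<and>
    (\<forall>r. r \<noteq> 4 \<longrightarrow> a' r = a r) \<and> a' 4 0 = 1 \<and> (\<forall>j<n. a' 4 j \<le> 1) \<and>
    (\<forall>j\<in>{1..<n}. n < j + k \<longrightarrow> (a' 4 j = 1 \<longrightarrow> a' 4 (a 2 j) = 1) \<and> (U j \<longrightarrow> a' 4 j = 1)) \<and>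
    (\<forall>S. up_closed (a 2) S \<longrightarrow> (\<forall>j\<in>{1..<n}. U j \<longrightarrow> j \<in> S) \<longrightarrow> (\<forall>j\<in>{1..<n}. a' 4 j = 1 \<longrightarrow> j \<in> S))"])
  fix k v' a' assume I: "1 \<le> k \<and> (\<forall>x. x \<notin> {9, 26} \<longrightarrow> v' x = v x) \<and>
    (\<forall>r. r \<noteq> 4 \<longrightarrow> a' r = a r) \<and> a' 4 0 = 1 \<and> (\<forall>j<n. a' 4 j \<le> 1) \<and>
    (\<forall>j\<in>{1..<n}. n < j + k \<longrightarrow> (a' 4 j = 1 \<longrightarrow> a' 4 (a 2 j) = 1) \<and> (U j \<longrightarrow> a' 4 j = 1)) \<and>
    (\<forall>S. up_closed (a 2) S \<longrightarrow> (\<forall>j\<in>{1..<n}. U j \<longrightarrow> j \<in> S) \<longrightarrow> (\<forall>j\<in>{1..<n}. a' 4 j = 1 \<longrightarrow> j \<in> S))"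
    and k: "v' 9 = k" "k < n"
  define j where "j = n - k"
  define s where "s = a' 4"
  define f where "f = (if U j \<or> s j = 1 then s(j := 1, a 2 j := 1) else s)"
  have fr: "\<forall>x. x \<notin> {9, 26} \<longrightarrow> v' x = v x" "\<forall>r. r \<noteq> 4 \<longrightarrow> a' r = a r" and s0: "s 0 = 1"
    and s01: "\<And>j. j < n \<Longrightarrow> s j \<le> 1"
    and prev: "\<And>j. j \<in> {1..<n} \<Longrightarrow> n < j + k \<Longrightarrow> (s j = 1 \<longrightarrow> s (a 2 j) = 1) \<and> (U j \<longrightarrow> s j = 1)"
    and least: "\<And>S j. up_closed (a 2) S \<Longrightarrow> (\<forall>j\<in>{1..<n}. U j \<longrightarrow> j \<in> S) \<Longrightarrow> j \<in> {1..<n} \<Longrightarrow> s j = 1 \<Longrightarrow> j \<in> S"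
    using I by (auto simp: s_def)
  have jn: "j \<in> {1..<n}" using I k by (auto simp: j_def)
  have pj: "a 2 j < j" "a 3 j < B" using a jn by auto
  have sj: "s j = 0 \<or> s j = 1" using s01[of j] jn by (auto simp: le_Suc_eq)
  have goal: "f 0 = 1 \<and> (\<forall>j<n. f j \<le> 1) \<and>
    (\<forall>j\<in>{1..<n}. n < j + Suc k \<longrightarrow> (f j = 1 \<longrightarrow> f (a 2 j) = 1) \<and> (U j \<longrightarrow> f j = 1)) \<and>
    (\<forall>S. up_closed (a 2) S \<longrightarrow> (\<forall>j\<in>{1..<n}. U j \<longrightarrow> j \<in> S) \<longrightarrow> (\<forall>j\<in>{1..<n}. f j = 1 \<longrightarrow> j \<in> S))"
  proof (intro conjI allI ballI impI)
    show "f 0 = 1" using s0 by (simp add: f_def)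
    show "f i \<le> 1" if "i < n" for i using s01[OF that] by (simp add: f_def)
  next
    fix i assume i: "i \<in> {1..<n}" "n < i + Suc k"
    then have ij: "i = j \<or> n < i + k \<and> i \<noteq> j \<and> i \<noteq> a 2 j" using pj k by (auto simp: j_def)
    show "f (a 2 i) = 1" if "f i = 1"
      using ij that prev[OF i(1)] pj by (auto simp: f_def split: if_splits)
    show "f i = 1" if "U i" using ij that prev[OF i(1)] by (auto simp: f_def)
  next
    fix S i assume S: "up_closed (a 2) S" "\<forall>j\<in>{1..<n}. U j \<longrightarrow> j \<in> S" and i: "i \<in> {1..<n}" "f i = 1"
    have jS: "j \<in> S" if "U j \<or> s j = 1" using that S jn least[OF S jn] by auto
    have "a 2 j \<in> S" if "U j \<or> s j = 1" "a 2 j \<noteq> 0" using jS[OF that(1)] S(1) that(2) unfolding up_closed_def by auto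
    then show "i \<in> S" using i jS least[OF S i(1)] by (auto simp: f_def split: if_splits)
  qed
  have b: "n - k < B" "a 3 j < B" "a 2 j < B" "Suc 0 < B" "j < B" "k < B" using pj jn small_bounds k by auto
  have v': "v' 2 = n" "a' 2 = a 2" "a' 3 = a 3" "a' 17 = a 17" "a' 18 = a 18" "a' 4 = s" using fr v by (auto simp: s_def)
  have triv: "a'(4 := s) = a'" "s j = Suc 0 \<Longrightarrow> s(j := Suc 0) = s" using v'(6) by auto
  have step: "runs (26 ::= Minus (Vr 2) (Vr 9) ;;
      Cond (Ne (Ld 18 (Ld 3 (Vr 26))) (Cn (Suc 0))) Skip
        (Cond (Ld 17 (Ld 3 (Vr 26))) (Put 4 (Vr 26) (Cn (Suc 0))) Skip) ;;
      Cond (Ld 4 (Vr 26)) (Put 4 (Ld 2 (Vr 26)) (Cn (Suc 0))) Skip) v' a' 6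
    (\<lambda>v'' a''. v'' = v'(26 := j) \<and> a'' = a'(4 := f))"
    using b k sj unfolding f_def U_def
    by (cases "a 18 (a 3 j) = Suc 0"; cases "a 17 (a 3 j) = 0"; cases "s j = 0")
      (simp_all add: v' j_def[symmetric] triv)
  show "runs (26 ::= Minus (Vr 2) (Vr 9) ;;
      Cond (Ne (Ld 18 (Ld 3 (Vr 26))) (Cn (Suc 0))) Skip
        (Cond (Ld 17 (Ld 3 (Vr 26))) (Put 4 (Vr 26) (Cn (Suc 0))) Skip) ;;
      Cond (Ld 4 (Vr 26)) (Put 4 (Ld 2 (Vr 26)) (Cn (Suc 0))) Skip) v' a' 6
    (\<lambda>v' a'. v' 9 = k \<and> 1 \<le> Suc k \<and> (\<forall>x. x \<notin> {9, 26} \<longrightarrow> (v'(9 := Suc k)) x = v x) \<and>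
    (\<forall>r. r \<noteq> 4 \<longrightarrow> a' r = a r) \<and> a' 4 0 = 1 \<and> (\<forall>j<n. a' 4 j \<le> 1) \<and>
    (\<forall>j\<in>{1..<n}. n < j + Suc k \<longrightarrow> (a' 4 j = 1 \<longrightarrow> a' 4 (a 2 j) = 1) \<and> (U j \<longrightarrow> a' 4 j = 1)) \<and>
    (\<forall>S. up_closed (a 2) S \<longrightarrow> (\<forall>j\<in>{1..<n}. U j \<longrightarrow> j \<in> S) \<longrightarrow> (\<forall>j\<in>{1..<n}. a' 4 j = 1 \<longrightarrow> j \<in> S)))"
  proof (rule runs_weaken[OF step order_refl], elim conjE, hypsubst)
    show "(v'(26 := j)) 9 = k \<and> 1 \<le> Suc k \<and> (\<forall>x. x \<notin> {9, 26} \<longrightarrow> (v'(26 := j, 9 := Suc k)) x = v x) \<and>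
      (\<forall>r. r \<noteq> 4 \<longrightarrow> (a'(4 := f)) r = a r) \<and> (a'(4 := f)) 4 0 = 1 \<and> (\<forall>j<n. (a'(4 := f)) 4 j \<le> 1) \<and>
      (\<forall>j\<in>{1..<n}. n < j + Suc k \<longrightarrow> ((a'(4 := f)) 4 j = 1 \<longrightarrow> (a'(4 := f)) 4 (a 2 j) = 1) \<and> (U j \<longrightarrow> (a'(4 := f)) 4 j = 1)) \<and>
      (\<forall>S. up_closed (a 2) S \<longrightarrow> (\<forall>j\<in>{1..<n}. U j \<longrightarrow> j \<in> S) \<longrightarrow> (\<forall>j\<in>{1..<n}. (a'(4 := f)) 4 j = 1 \<longrightarrow> j \<in> S))"
      unfolding fun_upd_same using goal fr k(1) by simp
  qed
next
  fix v' a' assume I: "1 \<le> n \<and> (\<forall>x. x \<notin> {9, 26} \<longrightarrow> v' x = v x) \<and>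
    (\<forall>r. r \<noteq> 4 \<longrightarrow> a' r = a r) \<and> a' 4 0 = 1 \<and> (\<forall>j<n. a' 4 j \<le> 1) \<and>
    (\<forall>j\<in>{1..<n}. n < j + n \<longrightarrow> (a' 4 j = 1 \<longrightarrow> a' 4 (a 2 j) = 1) \<and> (U j \<longrightarrow> a' 4 j = 1)) \<and>
    (\<forall>S. up_closed (a 2) S \<longrightarrow> (\<forall>j\<in>{1..<n}. U j \<longrightarrow> j \<in> S) \<longrightarrow> (\<forall>j\<in>{1..<n}. a' 4 j = 1 \<longrightarrow> j \<in> S))"
  then show "(\<forall>x. x \<notin> {9, 26} \<longrightarrow> v' x = v x) \<and>
    (\<forall>r. r \<noteq> 4 \<longrightarrow> a' r = a r) \<and> a' 4 0 = 1 \<and> (\<forall>j<n. a' 4 j \<le> 1) \<and>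
    (\<forall>j\<in>{1..<n}. (a' 4 j = 1 \<longrightarrow> a' 4 (a 2 j) = 1) \<and> (U j \<longrightarrow> a' 4 j = 1)) \<and>
    (\<forall>S. up_closed (a 2) S \<longrightarrow> (\<forall>j\<in>{1..<n}. U j \<longrightarrow> j \<in> S) \<longrightarrow> (\<forall>j\<in>{1..<n}. a' 4 j = 1 \<longrightarrow> j \<in> S))" by simp
next
  show "1 \<le> v 9 \<and> (\<forall>x. x \<notin> {9, 26} \<longrightarrow> v x = v x) \<and>
    (\<forall>r. r \<noteq> 4 \<longrightarrow> a r = a r) \<and> a 4 0 = 1 \<and> (\<forall>j<n. a 4 j \<le> 1) \<and>
    (\<forall>j\<in>{1..<n}. n < j + v 9 \<longrightarrow> (a 4 j = 1 \<longrightarrow> a 4 (a 2 j) = 1) \<and> (U j \<longrightarrow> a 4 j = 1)) \<and>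
    (\<forall>S. up_closed (a 2) S \<longrightarrow> (\<forall>j\<in>{1..<n}. U j \<longrightarrow> j \<in> S) \<longrightarrow> (\<forall>j\<in>{1..<n}. a 4 j = 1 \<longrightarrow> j \<in> S))"
  proof -
    have "a 4 j \<le> 1" if "j < n" for j using a(1) a(2)[of j] that by (cases "j = 0") auto
    moreover have "a 4 j \<noteq> 1" if "j \<in> {1..<n}" for j using a(2)[OF that] by simp
    ultimately show ?thesis using v a(1) by auto
  qed
qed (use v n small_bounds in auto)

lemma check:
  assumes v: "v 9 = 1" "v 2 = n" "v 30 = 0" and n: "0 < n" and a: "\<And>j. j \<in> {1..<n} \<Longrightarrow> a 3 j < B"
  defines "T \<equiv> \<lambda>k. {i \<in> {1..<k}. a 4 i \<noteq> 0}"
  shows "runs Check v a (6 * n + 1) (\<lambda>v' a'. (\<forall>x. x \<notin> {9, 21, 30} \<longrightarrow> v' x = v x) \<and>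
    (\<forall>r. r \<noteq> 5 \<longrightarrow> a' r = a r) \<and> v' 21 = v 21 - card (T n) \<and>
    (v' 30 = 0 \<longleftrightarrow> inj_on (a 3) (T n) \<and> a 3 ` T n \<subseteq> {x. a 5 x \<noteq> 0}) \<and>
    {x. a' 5 x \<noteq> 0} = {x. a 5 x \<noteq> 0} - a 3 ` T n)"
  unfolding Check_def
proof (rule runs_For[where hi = n and T = 4 and I = "\<lambda>k v' a'. 1 \<le> k \<and> (\<forall>x. x \<notin> {9, 21, 30} \<longrightarrow> v' x = v x) \<and>
    (\<forall>r. r \<noteq> 5 \<longrightarrow> a' r = a r) \<and> v' 21 = v 21 - card (T k) \<and>
    (v' 30 = 0 \<longleftrightarrow> inj_on (a 3) (T k) \<and> a 3 ` T k \<subseteq> {x. a 5 x \<noteq> 0}) \<and>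
    {x. a' 5 x \<noteq> 0} = {x. a 5 x \<noteq> 0} - a 3 ` T k"])
  fix k v' a' assume I: "1 \<le> k \<and> (\<forall>x. x \<notin> {9, 21, 30} \<longrightarrow> v' x = v x) \<and>
    (\<forall>r. r \<noteq> 5 \<longrightarrow> a' r = a r) \<and> v' 21 = v 21 - card (T k) \<and>
    (v' 30 = 0 \<longleftrightarrow> inj_on (a 3) (T k) \<and> a 3 ` T k \<subseteq> {x. a 5 x \<noteq> 0}) \<and>
    {x. a' 5 x \<noteq> 0} = {x. a 5 x \<noteq> 0} - a 3 ` T k" and k: "v' 9 = k" "k < n"
  have fr: "\<forall>x. x \<notin> {9, 21, 30} \<longrightarrow> v' x = v x" "\<forall>r. r \<noteq> 5 \<longrightarrow> a' r = a r" and k1: "1 \<le> k"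
    and v21: "v' 21 = v 21 - card (T k)" and v30: "v' 30 = 0 \<longleftrightarrow> inj_on (a 3) (T k) \<and> a 3 ` T k \<subseteq> {x. a 5 x \<noteq> 0}"
    and five: "{x. a' 5 x \<noteq> 0} = {x. a 5 x \<noteq> 0} - a 3 ` T k" using I by auto
  have b: "k < B" "a 3 k < B" "Suc 0 < B" using k k1 a[of k] small_bounds by auto
  have arr: "a' 3 = a 3" "a' 4 = a 4" using fr by auto
  have T_Suc: "T (Suc k) = (if a 4 k \<noteq> 0 then insert k (T k) else T k)" using k1 by (auto simp: T_def less_Suc_eq)
  have kT: "k \<notin> T k" "finite (T k)" by (auto simp: T_def)
  have mem: "a' 5 (a 3 k) \<noteq> 0 \<longleftrightarrow> a 5 (a 3 k) \<noteq> 0 \<and> a 3 k \<notin> a 3 ` T k" using five by blast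
  \<comment> \<open>A single cell detects both defects: it is 0 if the color was inadmissible from
    the start or has been used by an earlier marked row.\<close>
  have ext: "inj_on (a 3) (insert k (T k)) \<and> a 3 ` insert k (T k) \<subseteq> {x. a 5 x \<noteq> 0} \<longleftrightarrow>
      (inj_on (a 3) (T k) \<and> a 3 ` T k \<subseteq> {x. a 5 x \<noteq> 0}) \<and> a' 5 (a 3 k) \<noteq> 0"
    unfolding mem inj_on_insert using kT by auto
  have set: "{x. ((a' 5)(a 3 k := 0)) x \<noteq> 0} = {x. a 5 x \<noteq> 0} - a 3 ` insert k (T k)" using five by auto
  have set': "{x. a' 5 x \<noteq> 0} = {x. a 5 x \<noteq> 0} - a 3 ` insert k (T k)" if "a' 5 (a 3 k) = 0"
  proof -
    have "{x. a 5 x \<noteq> 0} - a 3 ` insert k (T k) = {x. a' 5 x \<noteq> 0} - {a 3 k}" unfolding five by blast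
    then show ?thesis using that by auto
  qed
  have card: "v 21 - card (insert k (T k)) = v 21 - card (T k) - Suc 0" using kT by simp
  let ?Q = "\<lambda>v' a'. v' 9 = k \<and> 1 \<le> Suc k \<and> (\<forall>x. x \<notin> {9, 21, 30} \<longrightarrow> (v'(9 := Suc k)) x = v x) \<and>
    (\<forall>r. r \<noteq> 5 \<longrightarrow> a' r = a r) \<and> (v'(9 := Suc k)) 21 = v 21 - card (T (Suc k)) \<and>
    ((v'(9 := Suc k)) 30 = 0 \<longleftrightarrow> inj_on (a 3) (T (Suc k)) \<and> a 3 ` T (Suc k) \<subseteq> {x. a 5 x \<noteq> 0}) \<and>
    {x. a' 5 x \<noteq> 0} = {x. a 5 x \<noteq> 0} - a 3 ` T (Suc k)"
  have Q1: "?Q (v'(21 := v' 21 - Suc 0)) (a'(5 := (a' 5)(a 3 k := 0)))" if "a 4 k \<noteq> 0" "a' 5 (a 3 k) \<noteq> 0"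
    unfolding T_Suc if_P[OF that(1)] ext card using fr k v21 v30 set that(2) by simp
  have Q2: "?Q (v'(30 := Suc 0, 21 := v' 21 - Suc 0)) a'" if "a 4 k \<noteq> 0" "a' 5 (a 3 k) = 0"
    unfolding T_Suc if_P[OF that(1)] ext card using fr k v21 set'[OF that(2)] that(2) by simp
  have Q3: "?Q v' a'" if "a 4 k = 0" using I k T_Suc that by simp
  show "runs (Cond (Ld 4 (Vr 9))
       (Cond (Ld 5 (Ld 3 (Vr 9))) (Put 5 (Ld 3 (Vr 9)) (Cn 0)) (30 ::= Cn (Suc 0)) ;;
        21 ::= Minus (Vr 21) (Cn (Suc 0)))
       Skip) v' a' 4 ?Q"
  proof (cases "a 4 k = 0")
    case True
    then show ?thesis using b k Q3 by (simp only: runs_Cond) (simp add: arr)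
  next
    case False
    then show ?thesis
    proof (cases "a' 5 (a 3 k) = 0")
      case True
      show ?thesis using b k False True Q2[OF False True] by (simp add: arr)
    next
      case F: False
      show ?thesis using b k False F Q1[OF False F] by (simp add: arr)
    qed
  qed
qed (use v n small_bounds in \<open>auto simp: T_def cong: conj_cong\<close>)

end

context rooted_input
begin

text \<open>The factor 36 is the sum \<open>4 + 8 + 6 + 11 + 7\<close> of the loops, where the
  number of edges is at most \<open>n\<close>.\<close>

lemma layout_runs:
  assumes v: "v 2 = n" "v 3 = length es" "v 7 = off" "v 22 = r"
  shows "runs Layout v a (36 * n + 13) (\<lambda>v' a'. (\<forall>x. x \<notin> {9, 13, 24, 25, 26, 30} \<longrightarrow> v' x = v x) \<and> v' 13 = n - 1 \<and>
    (\<forall>r. r \<notin> {2, 3, 4, 12, 13, 14, 15, 16} \<longrightarrow> a' r = a r) \<and> (\<forall>j\<in>{1..<n}. a' 4 j = 0) \<and>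
    (\<exists>ord. layout ord (a' 2) (a' 3)))" (is "runs _ _ _ _ ?Q")
proof -
  have b: "Suc 0 < B" "0 < B" "r < B" using small_bounds root_in by auto
  let ?C5 = "13 ::= Minus (Vr 2) (Cn (Suc 0)) ;; Put 16 (Vr 22) (Cn 0) ;; 9 ::= Cn (Suc 0) ;; Number_rows"
  let ?C4 = "24 ::= Cn 0 ;; Strip_leaves ;; ?C5"
  let ?C3 = "9 ::= Cn 0 ;; 25 ::= Cn 0 ;; Push_leaves ;; ?C4"
  let ?C2 = "9 ::= Cn 0 ;; Add_edges ;; ?C3"
  have "runs (Clear_degrees ;; ?C2) (v(9 := 0)) a (36 * n + 12) ?Q"
  proof (rule runs_Seq[OF runs_weaken[OF clear_degrees[of "v(9 := 0)" a] order_refl], where ?T2.0 = "32 * n + 11"])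
    fix v1 a1
    assume 1: "(\<forall>x. x \<noteq> 9 \<longrightarrow> v1 x = (v(9 := 0)) x) \<and>
      (\<forall>r. r \<notin> {12, 13} \<longrightarrow> a1 r = a r) \<and> (\<forall>u<n. a1 12 u = 0 \<and> a1 13 u = 0)"
    have "runs (Add_edges ;; ?C3) (v1(9 := 0)) a1 (32 * n + 10) ?Q"
    proof (rule runs_Seq[OF runs_weaken[OF add_edges[of "v1(9 := 0)" a1] order_refl], where ?T2.0 = "24 * n + 9"])
      fix v2 a2
      assume 2: "(\<forall>x. x \<notin> {9, 26, 30} \<longrightarrow> v2 x = (v1(9 := 0)) x) \<and> (\<forall>r. r \<notin> {12, 13} \<longrightarrow> a2 r = a1 r) \<and>
        (\<forall>u<n. a2 12 u = acc (\<lambda>_. 1) (length es) u \<and> a2 13 u = acc (\<lambda>x. x) (length es) u)"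
      let ?v2 = "v2(9 := 0, 25 := 0)"
      have "runs (Push_leaves ;; ?C4) ?v2 a2 (24 * n + 7) ?Q"
      proof (rule runs_Seq[OF runs_weaken[OF push_leaves[of ?v2 a2] order_refl], where ?T2.0 = "18 * n + 6"])
        fix v3 a3
        assume 3: "(\<forall>x. x \<notin> {9, 25} \<longrightarrow> v3 x = ?v2 x) \<and> (\<forall>r. r \<noteq> 14 \<longrightarrow> a3 r = a2 r) \<and>
          strip_inv 0 (v3 25) (a3 14) (a3 12) (a3 13) (a3 15)"
        from 3 have s3: "strip_inv 0 (v3 25) (a3 14) (a3 12) (a3 13) (a3 15)" by blast
        let ?v3 = "v3(24 := 0)"
        have "runs (Strip_leaves ;; ?C5) ?v3 a3 (18 * n + 5) ?Q"
        proof (rule runs_Seq[OF runs_weaken[OF strip_leaves[of ?v3 a3] order_refl], where ?T2.0 = "7 * n + 4"])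
          show "strip_inv 0 (?v3 25) (a3 14) (a3 12) (a3 13) (a3 15)" using s3 by simp
          show "?v3 24 = 0" by simp
          show "?v3 22 = r" using 1 2 3 v by simp
          fix v4 a4
          assume 4: "(\<forall>x. x \<notin> {24, 25, 26, 30} \<longrightarrow> v4 x = ?v3 x) \<and> (\<forall>r. r \<notin> {12, 13, 14, 15} \<longrightarrow> a4 r = a3 r) \<and>
            strip_inv (v4 25) (v4 25) (a4 14) (a4 12) (a4 13) (a4 15)"
          then have "strip_inv (v4 25) (v4 25) (a4 14) (a4 12) (a4 13) (a4 15)" by blast
          note done' = strip_done[OF this]
          have v4: "v4 2 = n" "v4 22 = r" "v4 7 = off" using 1 2 3 4 v by auto
          let ?v4 = "v4(13 := n - Suc 0, 9 := Suc 0)" and ?a4 = "a4(16 := (a4 16)(r := 0))"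
          have "runs Number_rows ?v4 ?a4 (7 * n + 1) ?Q"
          proof (rule runs_weaken[OF number_rows[of ?v4 ?a4] order_refl])
            fix v5 a5
            assume 5: "(\<forall>x. x \<notin> {9, 26} \<longrightarrow> v5 x = ?v4 x) \<and> (\<forall>r. r \<notin> {2, 3, 4, 16} \<longrightarrow> a5 r = ?a4 r) \<and>
              (\<forall>j\<in>{1..<n}. a5 4 j = 0) \<and> (\<exists>ord. layout ord (a5 2) (a5 3))"
            have "\<forall>x. x \<notin> {9, 13, 24, 25, 26, 30} \<longrightarrow> v5 x = v x" using 1 2 3 4 5 by simp
            moreover have "\<forall>r. r \<notin> {2, 3, 4, 12, 13, 14, 15, 16} \<longrightarrow> a5 r = a r" using 1 2 3 4 5 by simp
            ultimately show "?Q v5 a5" using 5 by simp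
          qed (use v4 done' in simp_all)
          then show "runs ?C5 v4 a4 (7 * n + 4) ?Q" using b v4 by (simp add: add.commute)
        qed simp
        then show "runs ?C4 v3 a3 (18 * n + 6) ?Q" using b by (simp add: add.commute)
      qed (use 1 2 v in simp_all)
      then show "runs ?C3 v2 a2 (24 * n + 9) ?Q" using b by (simp add: add.commute)
    qed (use 1 v edges_le in simp_all)
    then show "runs ?C2 v1 a1 (32 * n + 11) ?Q" using b by (simp add: add.commute)
  qed (use v in simp_all)
  then show ?thesis unfolding Layout_def using b by (simp add: add.commute)
qed

text \<open>Either no frame is pushed and the root admits no solution, or the new frame is
  equivalent to the root. The two inequalities bound its potential: at most \<open>2 * l\<close>
  rows, and a surplus of at most \<open>l - (u - 1)\<close> over the required vertices.\<close>

definition kernel_post :: "nat \<Rightarrow> vars \<Rightarrow> arrs \<Rightarrow> vars \<Rightarrow> arrs \<Rightarrow> bool" where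
  "kernel_post j v a v' a' \<longleftrightarrow> below j (n + 1) a a' \<and> {x. a' 5 x \<noteq> 0} \<subseteq> set ms \<and>
     (\<forall>x. x \<notin> {5, 9, 10, 11, 12, 19, 21, 26, 30} \<longrightarrow> v' x = v x) \<and>
     (\<forall>r. r \<notin> {4, 5, 6, 7, 8, 9, 10} \<longrightarrow> a' r = a r) \<and>
     (v' 5 = j \<and> \<not> rsol \<or> v' 5 = Suc j \<and> fok (n + 1) a' j \<and> (fsol (n + 1) a' j \<longleftrightarrow> rsol) \<and>
       a' 7 j \<le> 2 * (n - length ms) \<and> a' 7 j - a' 8 j \<le> n - length ms - (mult (col r) - 1))"

lemma kernel_runs:
  assumes v: "v 2 = n" "v 4 = length ms" "v 5 = j" "v 6 = n + 1" "v 7 = off" "v 8 = off + n" "v 13 = n - 1" "v 22 = r"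
    and j: "j \<le> n" and ms: "length ms \<le> n" "distinct ms" "col r \<in> set ms" "\<And>x. x \<in> set ms \<Longrightarrow> 1 \<le> mult x"
    and a: "layout ord (a 2) (a 3)" "\<And>j. j \<in> {1..<n} \<Longrightarrow> a 4 j = 0" "\<And>x. a 17 x \<noteq> 0 \<longleftrightarrow> x \<in> set ms"
      "\<And>x. a 18 x = mult x" "{x. a 5 x \<noteq> 0} \<subseteq> set ms"
  shows "runs Kernel v a (31 * n + 19) (kernel_post j v a)" (is "runs _ _ _ _ ?Q")
proof -
  define p where "p = a 2"
  define c where "c = a 3"
  have lay: "layout ord p c" using a(1) by (simp add: p_def c_def)
  have ordn: "ord i < n" if "i < n" for i using lay that by (auto simp: layout_def bij_betw_def)
  have pc: "p i < i" "c i < B" if "i \<in> {1..<n}" for i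
    using lay that ordn[of i] col_bound by (auto simp: layout_def)
  have n0: "0 < n" by (rule n_pos)
  have rows: "rows (n - 1) p" using pc by (auto simp: rows_def)
  have uniq: "uniq c i \<longleftrightarrow> a 18 (c i) = 1 \<and> a 17 (c i) \<noteq> 0" for i
    using a(3,4) uniq_def[OF lay ms(3,2)] by simp
  have b: "Suc 0 < B" "0 < B" "r < B" "off + r < length xs" "off + r < B" "col r < B"
    using small_bounds root_in length_xs col_bound by auto
  let ?C5 = "Cond (Vr 30) Skip Emit"
  let ?C4 = "30 ::= Cn 0 ;; 21 ::= Minus (Vr 4) (Cn (Suc 0)) ;; Put 5 (In (Plus (Vr 7) (Vr 22))) (Cn 0) ;; 9 ::= Cn (Suc 0) ;; Check ;; ?C5"
  let ?C3 = "Put 4 (Cn 0) (Cn (Suc 0)) ;; 9 ::= Cn (Suc 0) ;; Mark ;; ?C4"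
  have "runs (Set_good ;; ?C3) (v(9 := 0)) a (31 * n + 18) ?Q"
  proof (rule runs_Seq[OF runs_weaken[OF set_good[of "v(9 := 0)" a] order_refl], where ?T2.0 = "28 * n + 17"])
    fix v1 a1
    assume 1: "(\<forall>x. x \<noteq> 9 \<longrightarrow> v1 x = (v(9 := 0)) x) \<and> (\<forall>r. r \<noteq> 5 \<longrightarrow> a1 r = a r) \<and>
      (\<forall>x. a1 5 x = (if x \<in> set ms then 1 else a 5 x))"
    have good1: "{x. a1 5 x \<noteq> 0} = set ms"
    proof -
      have "a1 5 x \<noteq> 0 \<longleftrightarrow> x \<in> set ms" for x using 1 a(5) by auto
      then show ?thesis by blast
    qed
    let ?v1 = "v1(9 := Suc 0)" and ?a1 = "a1(4 := (a1 4)(0 := Suc 0))"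
    have "runs (Mark ;; ?C4) ?v1 ?a1 (28 * n + 15) ?Q"
    proof (rule runs_Seq[OF runs_weaken[OF mark[of ?v1 ?a1] order_refl], where ?T2.0 = "20 * n + 14"])
      fix v2 a2
      assume 2: "(\<forall>x. x \<notin> {9, 26} \<longrightarrow> v2 x = ?v1 x) \<and>
        (\<forall>r. r \<noteq> 4 \<longrightarrow> a2 r = ?a1 r) \<and> a2 4 0 = 1 \<and> (\<forall>j<n. a2 4 j \<le> 1) \<and>
        (\<forall>j\<in>{1..<n}. (a2 4 j = 1 \<longrightarrow> a2 4 (?a1 2 j) = 1) \<and> (?a1 18 (?a1 3 j) = 1 \<and> ?a1 17 (?a1 3 j) \<noteq> 0 \<longrightarrow> a2 4 j = 1)) \<and>
        (\<forall>S. up_closed (?a1 2) S \<longrightarrow> (\<forall>j\<in>{1..<n}. ?a1 18 (?a1 3 j) = 1 \<and> ?a1 17 (?a1 3 j) \<noteq> 0 \<longrightarrow> j \<in> S) \<longrightarrow>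
          (\<forall>j\<in>{1..<n}. a2 4 j = 1 \<longrightarrow> j \<in> S))"
      define st where "st = a2 4"
      define T where "T = {i \<in> {1..n - 1}. st i = 1}"
      have a1: "?a1 2 = p" "?a1 3 = c" "?a1 17 = a 17" "?a1 18 = a 18" using 1 by (simp_all add: p_def c_def)
      have st: "st 0 = 1" "\<And>i. i \<in> {1..n - 1} \<Longrightarrow> st i = 0 \<or> st i = 1" "\<And>i. i \<in> {1..n - 1} \<Longrightarrow> st i = 1 \<Longrightarrow> st (p i) = 1"
      proof -
        show "st 0 = 1" using 2 by (simp add: st_def)
        fix i assume i: "i \<in> {1..n - 1}"
        then have i': "i \<in> {1..<n}" unfolding rows_range .
        have "\<forall>i<n. st i \<le> 1" using 2 unfolding st_def by blast
        then have "st i \<le> 1" using i' by simp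
        then show "st i = 0 \<or> st i = 1" by auto
        show "st (p i) = 1" if "st i = 1" using 2 i' that unfolding a1 st_def by blast
      qed
      have uT: "i \<in> T" if "i \<in> {1..<n}" "uniq c i" for i
      proof -
        have "st i = 1" using 2 that unfolding a1 uniq st_def by blast
        then show ?thesis using that(1) unfolding T_def rows_range by simp
      qed
      have least: "T \<subseteq> S" if "up_closed p S" "\<forall>i\<in>{1..<n}. uniq c i \<longrightarrow> i \<in> S" for S
      proof -
        have "\<forall>i\<in>{1..<n}. st i = 1 \<longrightarrow> i \<in> S" using 2 that unfolding a1 uniq st_def by blast
        then show ?thesis by (auto simp: T_def)
      qed
      have fr2: "\<forall>x. x \<notin> {9, 26} \<longrightarrow> v2 x = v x" "\<forall>r. r \<notin> {4, 5} \<longrightarrow> a2 r = a r" "a2 5 = a1 5"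
        using 1 2 by simp_all
      have v2: "v2 2 = n" "v2 4 = length ms" "v2 5 = j" "v2 6 = n + 1" "v2 7 = off" "v2 13 = n - 1" "v2 22 = r"
        using fr2(1) v by simp_all
      let ?v2 = "v2(30 := 0, 21 := length ms - Suc 0, 9 := Suc 0)" and ?a2 = "a2(5 := (a2 5)(col r := 0))"
      have good2: "{x. ?a2 5 x \<noteq> 0} = set ms - {col r}" unfolding good1[symmetric] using fr2(3) by auto
      have Teq: "{i \<in> {1..<n}. st i \<noteq> 0} = T"
      proof -
        have "st i \<noteq> 0 \<longleftrightarrow> st i = 1" if "i \<in> {1..<n}" for i using st(2)[of i] that by auto
        then show ?thesis unfolding T_def rows_range by blast
      qed
      have arr2: "?a2 3 = c" "?a2 2 = p" "?a2 4 = st" using fr2 by (simp_all add: p_def c_def st_def)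
      have "runs (Check ;; ?C5) ?v2 ?a2 (20 * n + 10) ?Q"
      proof (rule runs_Seq[OF runs_weaken[OF check[of ?v2 ?a2] order_refl], where ?T2.0 = "14 * n + 9"])
        fix v3 a3
        assume "(\<forall>x. x \<notin> {9, 21, 30} \<longrightarrow> v3 x = ?v2 x) \<and> (\<forall>r. r \<noteq> 5 \<longrightarrow> a3 r = ?a2 r) \<and>
          v3 21 = ?v2 21 - card {i \<in> {1..<n}. ?a2 4 i \<noteq> 0} \<and>
          (v3 30 = 0 \<longleftrightarrow> inj_on (?a2 3) {i \<in> {1..<n}. ?a2 4 i \<noteq> 0} \<and>
             ?a2 3 ` {i \<in> {1..<n}. ?a2 4 i \<noteq> 0} \<subseteq> {x. ?a2 5 x \<noteq> 0}) \<and>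
          {x. a3 5 x \<noteq> 0} = {x. ?a2 5 x \<noteq> 0} - ?a2 3 ` {i \<in> {1..<n}. ?a2 4 i \<noteq> 0}"
        then have 3: "\<forall>x. x \<notin> {9, 21, 30} \<longrightarrow> v3 x = ?v2 x" "\<forall>r. r \<noteq> 5 \<longrightarrow> a3 r = ?a2 r"
          "v3 21 = length ms - 1 - card T" "v3 30 = 0 \<longleftrightarrow> inj_on c T \<and> c ` T \<subseteq> set ms - {col r}"
          "{x. a3 5 x \<noteq> 0} = set ms - {col r} - c ` T"
          unfolding arr2 good2 Teq by simp_all
        have fr3: "\<forall>x. x \<notin> {9, 21, 26, 30} \<longrightarrow> v3 x = v x" "\<forall>r. r \<notin> {4, 5} \<longrightarrow> a3 r = a r"
          using 3(1,2) fr2 by simp_all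
        have sub3: "{x. a3 5 x \<noteq> 0} \<subseteq> set ms" unfolding 3(5) by blast
        show "runs ?C5 v3 a3 (14 * n + 9) ?Q"
        proof (cases "v3 30 = 0")
          case False
          then have bad: "\<not> (inj_on c T \<and> c ` T \<subseteq> set ms - {col r})" unfolding 3(4) .
          have "\<not> rsol" by (rule bad_no_sol[OF lay ms(3,2) T_def st(2) uT least bad])
          moreover have "below j (n + 1) a a3" using fr3 by (simp add: below_def)
          ultimately have "?Q v3 a3" using fr3 sub3 v(3) by (simp add: kernel_post_def)
          then show ?thesis using False by simp
        next
          case True
          then have good: "inj_on c T" "c ` T \<subseteq> set ms - {col r}" using 3(4) by auto
          have v3: "v3 13 = n - 1" "v3 5 = j" "v3 6 = n + 1" using fr3 v by simp_all
          have arr3: "a3 2 = p" "a3 3 = c" "a3 4 = st" using 3(2) arr2 by simp_all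
          have "runs Emit v3 a3 (14 * v3 13 + 8) ?Q"
          proof (rule runs_weaken[OF emit_pushes order_refl])
            show "rows (v3 13) (a3 2)" using rows v3 arr3 by simp
            show "v3 13 < v3 6" using v3 by simp
            have "Suc j * (n + 1) \<le> (2 * (n + 1) + 2) * (n + 1)" using j by (intro mult_le_mono1) simp
            from le_less_trans[OF this B_bounds(1)] show "Suc (v3 5) * v3 6 < B" using v3 by simp
            show "1 < B" using b by simp
            show "a3 3 i < B" if "i \<in> {1..v3 13}" for i using that pc(2)[of i] v3 arr3 n0 by auto
            show "a3 4 0 = 1" using st(1) arr3 by simp
            show "a3 4 (a3 2 i) = 1" if "i \<in> {1..v3 13}" "a3 4 i = 1" for i
              using st(3)[of i] that v3 arr3 by simp
            fix v4 a4
            assume "emission (v3 13) (a3 2) (a3 3) (a3 4) {x. a3 5 x \<noteq> 0} (a4 6) (a4 7 (v3 5))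
              (\<lambda>j. a4 9 (v3 5 * v3 6 + j)) (\<lambda>j. a4 10 (v3 5 * v3 6 + j)) \<and>
              v4 5 = Suc (v3 5) \<and> a4 8 (v3 5) = v3 21 \<and>
              (\<forall>x. x \<notin> {5, 10, 11, 12, 19} \<longrightarrow> v4 x = v3 x) \<and>
              (\<forall>r. r \<notin> {6, 7, 8, 9, 10} \<longrightarrow> a4 r = a3 r) \<and>
              (\<forall>i. i \<noteq> v3 5 \<longrightarrow> a4 7 i = a3 7 i \<and> a4 8 i = a3 8 i) \<and>
              (\<forall>x\<le>v3 5 * v3 6. a4 9 x = a3 9 x \<and> a4 10 x = a3 10 x)"
            then have 4: "emission (n - 1) p c st (set ms - {col r} - c ` T) (a4 6) (a4 7 j)
                (\<lambda>i. a4 9 (j * (n + 1) + i)) (\<lambda>i. a4 10 (j * (n + 1) + i))"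
              "v4 5 = Suc j" "a4 8 j = length ms - 1 - card T"
              "\<forall>x. x \<notin> {5, 10, 11, 12, 19} \<longrightarrow> v4 x = v3 x" "\<forall>r. r \<notin> {6, 7, 8, 9, 10} \<longrightarrow> a4 r = a3 r"
              "\<forall>i. i \<noteq> j \<longrightarrow> a4 7 i = a3 7 i \<and> a4 8 i = a3 8 i"
              "\<forall>x\<le>j * (n + 1). a4 9 x = a3 9 x \<and> a4 10 x = a3 10 x"
              unfolding v3 arr3 3(3,5) by blast+
            note K = lay ms(3,2) T_def st(2) uT least good refl 4(3) 4(1)
            have size: "a4 7 j + card T + (mult (col r) - 1) \<le> n - 1" by (rule kernel_size[OF K])
            have k: "a4 8 j + length ms \<le> n" by (rule kernel_k[OF K ms(4)])
            have cT: "card T \<le> length ms - 1" by (rule card_T[OF K])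
            have inst: "instance_rows (a4 7 j) (a4 8 j) (\<lambda>i. a4 9 (j * (n + 1) + i)) (\<lambda>i. a4 10 (j * (n + 1) + i))"
              by (rule kernel_instance[OF K])
            have "fsol (n + 1) a4 j \<longleftrightarrow> rsol" unfolding fsol_def by (rule kernel_sol[OF K])
            moreover have "fok (n + 1) a4 j"
            proof (rule fok_emitted[OF 4(1) inst])
              show "c i < B" if "i \<in> {1..n - 1}" for i using pc(2)[of i] that n0 by auto
            qed (use size j in auto)
            \<comment> \<open>Here \<open>card T\<close> cancels: the rows are at most
              \<open>n - 1 - card T - (u - 1)\<close>, with \<open>u\<close> the multiplicity of the
              root's color, while \<open>k = length ms - 1 - card T\<close>.\<close>
            moreover have "a4 7 j - a4 8 j \<le> n - length ms - (mult (col r) - 1)"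
              using size 4(3) cT ms(1) n0 by linarith
            moreover have "a4 7 j \<le> 2 * (n - length ms)"
              using size 4(3) cT ms(1) n0 k by linarith
            moreover have "below j (n + 1) a a4" using 4(6,7) fr3(2) by (simp add: below_def)
            moreover have "{x. a4 5 x \<noteq> 0} \<subseteq> set ms" using 4(5) sub3 by simp
            moreover have "\<forall>x. x \<notin> {5, 9, 10, 11, 12, 19, 21, 26, 30} \<longrightarrow> v4 x = v x" using 4(4) fr3(1) by simp
            moreover have "\<forall>r. r \<notin> {4, 5, 6, 7, 8, 9, 10} \<longrightarrow> a4 r = a r" using 4(5) fr3(2) by simp
            ultimately show "?Q v4 a4" using 4(2) by (simp add: kernel_post_def)
          qed
          then have "runs Emit v3 a3 (14 * n + 8) ?Q" by (rule runs_weaken) (use v3 in auto)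
          then show ?thesis using True by (simp add: add.commute)
        qed
      qed (use v2 n0 b pc arr2 in auto)
      then show "runs ?C4 v2 a2 (20 * n + 14) ?Q" using b v2 xs_col[of r] root_in by (simp add: add.commute)
    qed (use 1 v n0 a pc in \<open>auto simp: p_def c_def\<close>)
    then show "runs ?C3 v1 a1 (28 * n + 17) ?Q" using b by (simp add: add.commute)
  qed (use v ms in simp_all)
  then show ?thesis unfolding Kernel_def using b by (simp add: add.commute)
qed

end


section \<open>The complete program\<close>

definition Count :: com where
  "Count = For 9 (Vr 2)
     (26 ::= In (Plus (Vr 7) (Vr 9)) ;;
      Put 18 (Vr 26) (Plus (Ld 18 (Vr 26)) (Cn (Suc 0))))"

text \<open>
  Variable 27 becomes a motif color that occurs once in the tree, if there is one (29), and any motif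
  color otherwise; 28 is set if some motif color does not occur.
\<close>

definition Scan :: com where
  "Scan = For 9 (Vr 4)
     (26 ::= In (Plus (Vr 8) (Vr 9)) ;;
      Put 17 (Vr 26) (Cn (Suc 0)) ;;
      Cond (Ld 18 (Vr 26)) Skip (28 ::= Cn (Suc 0)) ;;
      Cond (Vr 29) Skip
        (27 ::= Vr 26 ;; Cond (Ne (Ld 18 (Vr 26)) (Cn (Suc 0))) Skip (29 ::= Cn (Suc 0))))"

definition Roots :: com where
  "Roots = For 22 (Vr 2)
     (Cond (Ne (In (Plus (Vr 7) (Vr 22))) (Vr 27)) Skip (Layout ;; Kernel))"

text \<open>An empty motif has no solution because connected sets are nonempty. A motif larger than
  the tree is rejected before any of it is read, since the time allowed is then linear in
  \<open>n\<close> and independent of the length of the motif.\<close>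

definition Decide :: com where
  "Decide = Cond (Vr 4)
     (Cond (Minus (Vr 4) (Vr 2)) Skip
       ((Count ;;
         9 ::= Cn 0 ;;
         Scan) ;;
        Cond (Vr 28) Skip (Roots ;; Search)))
     Skip"

text \<open>Variable 0 starts with the input length; it is set to 0 so that every early exit answers
  no.\<close>

definition Main :: com where
  "Main =
     2 ::= In (Cn 0) ;;
     3 ::= In (Cn (Suc 0)) ;;
     4 ::= In (Cn 3) ;;
     7 ::= Plus (Cn 4) (Plus (Vr 3) (Vr 3)) ;;
     8 ::= Plus (Vr 7) (Vr 2) ;;
     6 ::= Plus (Vr 2) (Cn (Suc 0)) ;;
     0 ::= Cn 0 ;;
     Decide"

text \<open>The time needed by \<open>d\<close> may depend on what \<open>c\<close> has computed;
  here it depends on the multiplicity of the color chosen for the root.\<close>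

lemma (in machine) runs_Seq_ex:
  assumes "runs c v a T (\<lambda>v' a'. \<exists>T'. P T' \<and> runs d v' a' T' Q)"
  shows "\<exists>T'. P T' \<and> runs (c ;; d) v a (T + T') Q"
proof -
  obtain t v' a' T' where 1: "run c v a t v' a'" "t \<le> T" "P T'" "runs d v' a' T' Q"
    using assms unfolding runs_def[of c] by blast
  then have "runs c v a T (\<lambda>v' a'. runs d v' a' T' Q)" unfolding runs_def[of c] by blast
  then have "runs (c ;; d) v a (T + T') Q" by (rule runs_Seq) simp
  with 1(3) show ?thesis by blast
qed

context motif_input
begin

lemma count:
  assumes "v 9 = 0" "v 2 = n" "v 7 = off" "\<And>x. a 18 x = 0"
  shows "runs Count v a (4 * n + 1) (\<lambda>v' a'. (\<forall>x. x \<notin> {9, 26} \<longrightarrow> v' x = v x) \<and>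
    (\<forall>r. r \<noteq> 18 \<longrightarrow> a' r = a r) \<and> (\<forall>x. a' 18 x = mult x))"
  unfolding Count_def
proof (rule runs_For[where hi = n and T = 2 and I = "\<lambda>k v' a'. (\<forall>x. x \<notin> {9, 26} \<longrightarrow> v' x = v x) \<and>
    (\<forall>r. r \<noteq> 18 \<longrightarrow> a' r = a r) \<and> (\<forall>x. a' 18 x = card {u \<in> {..<k}. col u = x})"])
  fix k v' a' assume I: "(\<forall>x. x \<notin> {9, 26} \<longrightarrow> v' x = v x) \<and>
    (\<forall>r. r \<noteq> 18 \<longrightarrow> a' r = a r) \<and> (\<forall>x. a' 18 x = card {u \<in> {..<k}. col u = x})" and k: "v' 9 = k" "k < n"
  have fr: "\<forall>x. x \<notin> {9, 26} \<longrightarrow> v' x = v x" "\<forall>r. r \<noteq> 18 \<longrightarrow> a' r = a r"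
    and c: "\<And>x. a' 18 x = card {u \<in> {..<k}. col u = x}" using I by auto
  have "card {u \<in> {..<k}. col u = x} \<le> card {..<k}" for x by (intro card_mono) auto
  then have le: "card {u \<in> {..<k}. col u = x} \<le> k" for x by simp
  have bS: "Suc (card {u \<in> {..<k}. col u = x}) < B" for x using le[of x] k(2) small_bounds(2) by linarith
  have b: "off + k < length xs" "off + k < B" "col k < B" "Suc 0 < B"
    using k(2) length_xs small_bounds(5,8) col_bound by simp_all
  have S: "card {u \<in> {..<Suc k}. col u = x} = card {u \<in> {..<k}. col u = x} + (if col k = x then 1 else 0)" for x
  proof -
    have "{u \<in> {..<Suc k}. col u = x} = (if col k = x then insert k {u \<in> {..<k}. col u = x} else {u \<in> {..<k}. col u = x})"
      by (auto simp: less_Suc_eq)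
    then show ?thesis by simp
  qed
  have v': "v' 7 = off" using fr assms by simp
  show "runs (26 ::= In (Plus (Vr 7) (Vr 9)) ;;
      Put 18 (Vr 26) (Plus (Ld 18 (Vr 26)) (Cn (Suc 0)))) v' a' 2
    (\<lambda>v' a'. v' 9 = k \<and> (\<forall>x. x \<notin> {9, 26} \<longrightarrow> (v'(9 := Suc k)) x = v x) \<and>
    (\<forall>r. r \<noteq> 18 \<longrightarrow> a' r = a r) \<and> (\<forall>x. a' 18 x = card {u \<in> {..<Suc k}. col u = x}))"
    unfolding S using fr k b bS[of "col k"] c xs_col[OF k(2)] by (simp add: v')
qed (use assms small_bounds in \<open>auto simp: mult_def\<close>)

lemma scan:
  assumes "v 9 = 0" "v 4 = length ms" "v 8 = off + n" "v 28 = 0" "v 29 = 0" "\<And>x. a 17 x = 0"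
    "\<And>x. a 18 x = mult x" "ms \<noteq> []"
  shows "runs Scan v a (9 * length ms + 1) (\<lambda>v' a'. (\<forall>x. x \<notin> {9, 26, 27, 28, 29} \<longrightarrow> v' x = v x) \<and>
    (\<forall>r. r \<noteq> 17 \<longrightarrow> a' r = a r) \<and> (\<forall>x. a' 17 x \<noteq> 0 \<longleftrightarrow> x \<in> set ms) \<and>
    (v' 28 = 0 \<longleftrightarrow> (\<forall>x\<in>set ms. 1 \<le> mult x)) \<and> v' 27 \<in> set ms \<and>
    (mult (v' 27) = 1 \<or> (\<forall>x\<in>set ms. mult x \<noteq> 1)))"
  unfolding Scan_def
proof (rule runs_For[where hi = "length ms" and T = 7 and I = "\<lambda>k v' a'. (\<forall>x. x \<notin> {9, 26, 27, 28, 29} \<longrightarrow> v' x = v x) \<and>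
    (\<forall>r. r \<noteq> 17 \<longrightarrow> a' r = a r) \<and> (\<forall>x. a' 17 x \<noteq> 0 \<longleftrightarrow> x \<in> set (take k ms)) \<and>
    (v' 28 = 0 \<longleftrightarrow> (\<forall>x\<in>set (take k ms). 1 \<le> mult x)) \<and> (0 < k \<longrightarrow> v' 27 \<in> set (take k ms)) \<and>
    (v' 29 \<noteq> 0 \<longrightarrow> 0 < k \<and> mult (v' 27) = 1) \<and> (v' 29 = 0 \<longrightarrow> (\<forall>x\<in>set (take k ms). mult x \<noteq> 1))"])
  fix k v' a' assume I: "(\<forall>x. x \<notin> {9, 26, 27, 28, 29} \<longrightarrow> v' x = v x) \<and>
    (\<forall>r. r \<noteq> 17 \<longrightarrow> a' r = a r) \<and> (\<forall>x. a' 17 x \<noteq> 0 \<longleftrightarrow> x \<in> set (take k ms)) \<and>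
    (v' 28 = 0 \<longleftrightarrow> (\<forall>x\<in>set (take k ms). 1 \<le> mult x)) \<and> (0 < k \<longrightarrow> v' 27 \<in> set (take k ms)) \<and>
    (v' 29 \<noteq> 0 \<longrightarrow> 0 < k \<and> mult (v' 27) = 1) \<and> (v' 29 = 0 \<longrightarrow> (\<forall>x\<in>set (take k ms). mult x \<noteq> 1))"
    and k: "v' 9 = k" "k < length ms"
  define y where "y = ms ! k"
  have fr: "\<forall>x. x \<notin> {9, 26, 27, 28, 29} \<longrightarrow> v' x = v x" "\<forall>r. r \<noteq> 17 \<longrightarrow> a' r = a r"
    and inM: "\<And>x. a' 17 x \<noteq> 0 \<longleftrightarrow> x \<in> set (take k ms)"
    and miss: "v' 28 = 0 \<longleftrightarrow> (\<forall>x\<in>set (take k ms). 1 \<le> mult x)" and cs: "0 < k \<Longrightarrow> v' 27 \<in> set (take k ms)"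
    and u1: "v' 29 \<noteq> 0 \<Longrightarrow> 0 < k \<and> mult (v' 27) = 1" and u0: "v' 29 = 0 \<Longrightarrow> (\<forall>x\<in>set (take k ms). mult x \<noteq> 1)"
    using I by auto
  have tk: "set (take (Suc k) ms) = insert y (set (take k ms))" using k by (simp add: take_Suc_conv_app_nth y_def)
  have b: "off + n + k < length xs" "off + n + k < B" "y < B" "Suc 0 < B"
    using k length_xs small_bounds ms_bound by (auto simp: y_def)
  have v': "v' 8 = off + n" "a' 18 y = mult y" using fr assms by simp_all
  have xy: "xs ! (off + n + k) = y" using xs_ms[OF k(2)] by (simp add: y_def)
  have inM': "((a' 17)(y := Suc 0)) x \<noteq> 0 \<longleftrightarrow> x \<in> insert y (set (take k ms))" for x using inM[of x] by auto
  have step: "runs (26 ::= In (Plus (Vr 8) (Vr 9)) ;;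
      Put 17 (Vr 26) (Cn (Suc 0)) ;;
      Cond (Ld 18 (Vr 26)) Skip (28 ::= Cn (Suc 0)) ;;
      Cond (Vr 29) Skip
        (27 ::= Vr 26 ;; Cond (Ne (Ld 18 (Vr 26)) (Cn (Suc 0))) Skip (29 ::= Cn (Suc 0)))) v' a' 7
    (\<lambda>v'' a''. (\<forall>x. x \<notin> {26, 27, 28, 29} \<longrightarrow> v'' x = v' x) \<and> a'' = a'(17 := (a' 17)(y := Suc 0)) \<and>
      v'' 28 = (if mult y = 0 then Suc 0 else v' 28) \<and>
      v'' 27 = (if v' 29 = 0 then y else v' 27) \<and>
      v'' 29 = (if v' 29 = 0 \<and> mult y = 1 then Suc 0 else v' 29))"
    using b k(1) by (cases "mult y = 0"; cases "v' 29 = 0"; cases "mult y = Suc 0") (simp_all add: v' xy)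
  show "runs (26 ::= In (Plus (Vr 8) (Vr 9)) ;;
      Put 17 (Vr 26) (Cn (Suc 0)) ;;
      Cond (Ld 18 (Vr 26)) Skip (28 ::= Cn (Suc 0)) ;;
      Cond (Vr 29) Skip
        (27 ::= Vr 26 ;; Cond (Ne (Ld 18 (Vr 26)) (Cn (Suc 0))) Skip (29 ::= Cn (Suc 0)))) v' a' 7
    (\<lambda>v' a'. v' 9 = k \<and> (\<forall>x. x \<notin> {9, 26, 27, 28, 29} \<longrightarrow> (v'(9 := Suc k)) x = v x) \<and>
    (\<forall>r. r \<noteq> 17 \<longrightarrow> a' r = a r) \<and> (\<forall>x. a' 17 x \<noteq> 0 \<longleftrightarrow> x \<in> set (take (Suc k) ms)) \<and>
    ((v'(9 := Suc k)) 28 = 0 \<longleftrightarrow> (\<forall>x\<in>set (take (Suc k) ms). 1 \<le> mult x)) \<and>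
    (0 < Suc k \<longrightarrow> (v'(9 := Suc k)) 27 \<in> set (take (Suc k) ms)) \<and>
    ((v'(9 := Suc k)) 29 \<noteq> 0 \<longrightarrow> 0 < Suc k \<and> mult ((v'(9 := Suc k)) 27) = 1) \<and>
    ((v'(9 := Suc k)) 29 = 0 \<longrightarrow> (\<forall>x\<in>set (take (Suc k) ms). mult x \<noteq> 1)))"
  proof (rule runs_weaken[OF step order_refl], elim conjE)
    fix v'' a''
    assume s: "\<forall>x. x \<notin> {26, 27, 28, 29} \<longrightarrow> v'' x = v' x" "a'' = a'(17 := (a' 17)(y := Suc 0))"
      "v'' 28 = (if mult y = 0 then Suc 0 else v' 28)" "v'' 27 = (if v' 29 = 0 then y else v' 27)"
      "v'' 29 = (if v' 29 = 0 \<and> mult y = 1 then Suc 0 else v' 29)"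
    have 1: "\<forall>x. x \<notin> {9, 26, 27, 28, 29} \<longrightarrow> (v''(9 := Suc k)) x = v x" using s(1) fr(1) by simp
    have 2: "\<forall>r. r \<noteq> 17 \<longrightarrow> a'' r = a r" using s(2) fr(2) by simp
    have 3: "\<forall>x. a'' 17 x \<noteq> 0 \<longleftrightarrow> x \<in> insert y (set (take k ms))" unfolding s(2) fun_upd_same using inM' by blast
    have 4: "v'' 28 = 0 \<longleftrightarrow> (\<forall>x\<in>insert y (set (take k ms)). 1 \<le> mult x)" using s(3) miss by (cases "mult y = 0") auto
    have 5: "v'' 27 \<in> insert y (set (take k ms))" using s(4) cs u1 by (cases "v' 29 = 0") auto
    have 6: "v'' 29 \<noteq> 0 \<longrightarrow> mult (v'' 27) = 1" using s(4,5) u1 by (cases "v' 29 = 0") auto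
    have 7: "v'' 29 = 0 \<longrightarrow> (\<forall>x\<in>insert y (set (take k ms)). mult x \<noteq> 1)"
      using s(5) u0 by (cases "v' 29 = 0"; cases "mult y = 1") auto
    have 8: "v'' 9 = k" using s(1) k(1) by simp
    show "v'' 9 = k \<and> (\<forall>x. x \<notin> {9, 26, 27, 28, 29} \<longrightarrow> (v''(9 := Suc k)) x = v x) \<and>
      (\<forall>r. r \<noteq> 17 \<longrightarrow> a'' r = a r) \<and> (\<forall>x. a'' 17 x \<noteq> 0 \<longleftrightarrow> x \<in> set (take (Suc k) ms)) \<and>
      ((v''(9 := Suc k)) 28 = 0 \<longleftrightarrow> (\<forall>x\<in>set (take (Suc k) ms). 1 \<le> mult x)) \<and>
      (0 < Suc k \<longrightarrow> (v''(9 := Suc k)) 27 \<in> set (take (Suc k) ms)) \<and>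
      ((v''(9 := Suc k)) 29 \<noteq> 0 \<longrightarrow> 0 < Suc k \<and> mult ((v''(9 := Suc k)) 27) = 1) \<and>
      ((v''(9 := Suc k)) 29 = 0 \<longrightarrow> (\<forall>x\<in>set (take (Suc k) ms). mult x \<noteq> 1))"
      unfolding tk using 1 2 3 4 5 6 7 8 by (intro conjI) simp_all
  qed
next
  fix v' a' assume I: "(\<forall>x. x \<notin> {9, 26, 27, 28, 29} \<longrightarrow> v' x = v x) \<and>
    (\<forall>r. r \<noteq> 17 \<longrightarrow> a' r = a r) \<and> (\<forall>x. a' 17 x \<noteq> 0 \<longleftrightarrow> x \<in> set (take (length ms) ms)) \<and>
    (v' 28 = 0 \<longleftrightarrow> (\<forall>x\<in>set (take (length ms) ms). 1 \<le> mult x)) \<and> (0 < length ms \<longrightarrow> v' 27 \<in> set (take (length ms) ms)) \<and>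
    (v' 29 \<noteq> 0 \<longrightarrow> 0 < length ms \<and> mult (v' 27) = 1) \<and> (v' 29 = 0 \<longrightarrow> (\<forall>x\<in>set (take (length ms) ms). mult x \<noteq> 1))"
  moreover have "0 < length ms" using assms(8) by simp
  ultimately show "(\<forall>x. x \<notin> {9, 26, 27, 28, 29} \<longrightarrow> v' x = v x) \<and>
    (\<forall>r. r \<noteq> 17 \<longrightarrow> a' r = a r) \<and> (\<forall>x. a' 17 x \<noteq> 0 \<longleftrightarrow> x \<in> set ms) \<and>
    (v' 28 = 0 \<longleftrightarrow> (\<forall>x\<in>set ms. 1 \<le> mult x)) \<and> v' 27 \<in> set ms \<and>
    (mult (v' 27) = 1 \<or> (\<forall>x\<in>set ms. mult x \<noteq> 1))"
    unfolding take_all[OF order_refl] by (cases "v' 29 = 0") simp_all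
qed (use assms small_bounds in auto)

end

text \<open>The number of roots that are tried is \<open>u\<close>.\<close>

definition run_time :: "nat \<Rightarrow> nat \<Rightarrow> nat \<Rightarrow> nat" where
  "run_time n l u = 16 * n + 20 + (67 * n + 40) * u + 51 * (u * ((2 * l + 1)\<^sup>2 + hpot (l - (u - 1))))"

locale tree_input = motif_input +
  assumes tree: "\<And>r. r < n \<Longrightarrow> \<exists>par depth. rooted_tree {..<n} (set es \<union> (set es)\<inverse>) r par depth"
    and es_distinct: "distinct es" and es_oriented: "set es \<inter> (set es)\<inverse> = {}" and ms_distinct: "distinct ms"
begin

definition root_post :: "nat \<Rightarrow> nat \<Rightarrow> vars \<Rightarrow> arrs \<Rightarrow> vars \<Rightarrow> arrs \<Rightarrow> bool" where
  "root_post r j v a v' a' \<longleftrightarrow> below j (n + 1) a a' \<and> {x. a' 5 x \<noteq> 0} \<subseteq> set ms \<and>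
     (\<forall>x. x \<notin> {5, 9, 10, 11, 12, 13, 19, 21, 24, 25, 26, 30} \<longrightarrow> v' x = v x) \<and> a' 17 = a 17 \<and> a' 18 = a 18 \<and>
     (v' 5 = j \<and> \<not> msol r \<or> v' 5 = Suc j \<and> fok (n + 1) a' j \<and> (fsol (n + 1) a' j \<longleftrightarrow> msol r) \<and>
       a' 7 j \<le> 2 * (n - length ms) \<and> a' 7 j - a' 8 j \<le> n - length ms - (mult (col r) - 1))"

lemma root:
  assumes v: "v 2 = n" "v 3 = length es" "v 4 = length ms" "v 5 = j" "v 6 = n + 1" "v 7 = off" "v 8 = off + n" "v 22 = r"
    and j: "j \<le> n" and r: "r < n" "col r \<in> set ms" and ms: "length ms \<le> n" "\<And>x. x \<in> set ms \<Longrightarrow> 1 \<le> mult x"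
    and a: "\<And>x. a 17 x \<noteq> 0 \<longleftrightarrow> x \<in> set ms" "\<And>x. a 18 x = mult x" "{x. a 5 x \<noteq> 0} \<subseteq> set ms"
  shows "runs (Layout ;; Kernel) v a (67 * n + 32) (root_post r j v a)"
proof -
  obtain par depth where "rooted_tree {..<n} (set es \<union> (set es)\<inverse>) r par depth" using tree[OF r(1)] by blast
  then interpret rooted_input xs B n q es col ms r par depth
    using motif_input_axioms es_distinct es_oriented by (simp add: rooted_input_def rooted_input_axioms_def)
  show ?thesis
  proof (rule runs_Seq[OF runs_weaken[OF layout_runs[of v a] order_refl], where ?T2.0 = "31 * n + 19"])
    fix v1 a1
    assume "(\<forall>x. x \<notin> {9, 13, 24, 25, 26, 30} \<longrightarrow> v1 x = v x) \<and> v1 13 = n - 1 \<and>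
      (\<forall>r. r \<notin> {2, 3, 4, 12, 13, 14, 15, 16} \<longrightarrow> a1 r = a r) \<and> (\<forall>j\<in>{1..<n}. a1 4 j = 0) \<and>
      (\<exists>ord. layout ord (a1 2) (a1 3))"
    then obtain ord where 1: "\<forall>x. x \<notin> {9, 13, 24, 25, 26, 30} \<longrightarrow> v1 x = v x" "v1 13 = n - 1"
      "\<forall>r. r \<notin> {2, 3, 4, 12, 13, 14, 15, 16} \<longrightarrow> a1 r = a r" "\<forall>j\<in>{1..<n}. a1 4 j = 0"
      "layout ord (a1 2) (a1 3)" by blast
    show "runs Kernel v1 a1 (31 * n + 19) (root_post r j v a)"
    proof (rule runs_weaken[OF kernel_runs[of v1 j ord a1] order_refl])
      show "a1 17 x \<noteq> 0 \<longleftrightarrow> x \<in> set ms" for x using a(1) 1(3) by simp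
      show "{x. a1 5 x \<noteq> 0} \<subseteq> set ms" using a(3) 1(3) by simp
      show "1 \<le> mult x" if "x \<in> set ms" for x by (rule ms(2)[OF that])
      fix v2 a2
      assume K: "kernel_post j v1 a1 v2 a2"
      have "below j (n + 1) a a1" using 1(3) by (simp add: below_def)
      then have "below j (n + 1) a a2" using K below_trans[of j "n + 1" a a1 j a2] by (simp add: kernel_post_def)
      then show "root_post r j v a v2 a2"
        using K 1(1,3) unfolding root_post_def kernel_post_def rsol_iff[symmetric] by simp
    qed (use 1 v j ms ms_distinct r a in simp_all)
  qed (use v in simp_all)
qed

text \<open>Only vertices with color \<open>cs\<close> cause the linear work of a kernel. A uniform
  bound per round would give a quadratic time even for a single root, so the loop is analysed with a
  potential that charges the expensive rounds separately.\<close>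

lemma roots:
  assumes v: "v 22 = 0" "v 2 = n" "v 3 = length es" "v 4 = length ms" "v 5 = 0" "v 6 = n + 1" "v 7 = off"
      "v 8 = off + n" "v 27 = cs" "v 0 = 0"
    and cs: "cs \<in> set ms" and ms: "length ms \<le> n" "\<And>x. x \<in> set ms \<Longrightarrow> 1 \<le> mult x"
    and a: "\<And>x. a 17 x \<noteq> 0 \<longleftrightarrow> x \<in> set ms" "\<And>x. a 18 x = mult x" "{x. a 5 x \<noteq> 0} \<subseteq> set ms"
  shows "runs Roots v a (3 * n + (67 * n + 40) * mult cs + 1) (\<lambda>v' a'. v' 6 = n + 1 \<and> v' 0 = 0 \<and> v' 5 \<le> mult cs \<and>
    (\<forall>i<v' 5. fok (n + 1) a' i \<and> a' 7 i \<le> 2 * (n - length ms) \<and> a' 7 i - a' 8 i \<le> n - length ms - (mult cs - 1)) \<and>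
    ((\<exists>i<v' 5. fsol (n + 1) a' i) \<longleftrightarrow> (\<exists>x<n. col x = cs \<and> msol x)))"
proof -
  let ?body = "Cond (Ne (In (Plus (Vr 7) (Vr 22))) (Vr 27)) Skip (Layout ;; Kernel)"
  let ?inc = "22 ::= Plus (Vr 22) (Cn (Suc 0))"
  \<comment> \<open>\<open>lo\<close> counts the candidates already tried and bounds the stack
    height; \<open>hi\<close> counts those still to come and enters the potential.\<close>
  define lo where "lo k = card {x \<in> {..<k}. col x = cs}" for k
  define hi where "hi k = card {x \<in> {k..<n}. col x = cs}" for k
  define \<phi> where "\<phi> v' a' = 3 * (n - v' 22) + (67 * n + 40) * hi (v' 22)" for v' :: vars and a' :: arrs
  define I where "I v' a' \<longleftrightarrow> v' 22 \<le> n \<and> (\<forall>x\<in>{0, 2, 3, 4, 6, 7, 8, 27}. v' x = v x) \<and> a' 17 = a 17 \<and> a' 18 = a 18 \<and>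
    {x. a' 5 x \<noteq> 0} \<subseteq> set ms \<and> v' 5 \<le> lo (v' 22) \<and>
    (\<forall>i<v' 5. fok (n + 1) a' i \<and> a' 7 i \<le> 2 * (n - length ms) \<and> a' 7 i - a' 8 i \<le> n - length ms - (mult cs - 1)) \<and>
    ((\<exists>i<v' 5. fsol (n + 1) a' i) \<longleftrightarrow> (\<exists>x<v' 22. col x = cs \<and> msol x))" for v' a'
  have lo_Suc: "lo (Suc k) = lo k + (if col k = cs then 1 else 0)" for k
  proof -
    have "{x \<in> {..<Suc k}. col x = cs} = (if col k = cs then insert k {x \<in> {..<k}. col x = cs} else {x \<in> {..<k}. col x = cs})"
      by (auto simp: less_Suc_eq)
    then show ?thesis by (simp add: lo_def)
  qed
  have hi_Suc: "hi k = hi (Suc k) + (if col k = cs then 1 else 0)" if "k < n" for k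
  proof -
    have "{x \<in> {k..<n}. col x = cs} = (if col k = cs then insert k {x \<in> {Suc k..<n}. col x = cs} else {x \<in> {Suc k..<n}. col x = cs})"
      using that by (auto simp: le_Suc_eq Suc_le_eq order_le_less)
    then show ?thesis by (simp add: hi_def)
  qed
  have lo_le: "lo k \<le> k" for k
  proof -
    have "lo k \<le> card {..<k}" unfolding lo_def by (intro card_mono) auto
    then show ?thesis by simp
  qed
  have b: "Suc 0 < B" using small_bounds by simp
  have "runs (Loop (Minus (Vr 2) (Vr 22)) (?body ;; ?inc)) v a (\<phi> v a + 1) (\<lambda>v' a'. v' 6 = n + 1 \<and> v' 0 = 0 \<and> v' 5 \<le> mult cs \<and>
    (\<forall>i<v' 5. fok (n + 1) a' i \<and> a' 7 i \<le> 2 * (n - length ms) \<and> a' 7 i - a' 8 i \<le> n - length ms - (mult cs - 1)) \<and>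
    ((\<exists>i<v' 5. fsol (n + 1) a' i) \<longleftrightarrow> (\<exists>x<n. col x = cs \<and> msol x)))"
  proof (rule runs_Loop_pot[where I = I])
    show "I v a" using v a by (simp add: I_def)
    fix v1 a1 assume I1: "I v1 a1"
    show "ok (Minus (Vr 2) (Vr 22)) v1 a1" by simp
    define k where "k = v1 22"
    define j where "j = v1 5"
    have v1: "v1 2 = n" "v1 3 = length es" "v1 4 = length ms" "v1 6 = n + 1" "v1 7 = off" "v1 8 = off + n" "v1 27 = cs" "v1 0 = 0"
      using I1 v by (simp_all add: I_def)
    have st: "k \<le> n" "j \<le> lo k" "{x. a1 5 x \<noteq> 0} \<subseteq> set ms" "a1 17 = a 17" "a1 18 = a 18"
      "\<And>i. i < j \<Longrightarrow> fok (n + 1) a1 i \<and> a1 7 i \<le> 2 * (n - length ms) \<and> a1 7 i - a1 8 i \<le> n - length ms - (mult cs - 1)"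
      "(\<exists>i<j. fsol (n + 1) a1 i) \<longleftrightarrow> (\<exists>x<k. col x = cs \<and> msol x)"
      using I1 by (auto simp: I_def k_def j_def)
    show "v1 6 = n + 1 \<and> v1 0 = 0 \<and> v1 5 \<le> mult cs \<and>
      (\<forall>i<v1 5. fok (n + 1) a1 i \<and> a1 7 i \<le> 2 * (n - length ms) \<and> a1 7 i - a1 8 i \<le> n - length ms - (mult cs - 1)) \<and>
      ((\<exists>i<v1 5. fsol (n + 1) a1 i) \<longleftrightarrow> (\<exists>x<n. col x = cs \<and> msol x))" if "val (Minus (Vr 2) (Vr 22)) v1 a1 = 0"
    proof -
      have "k = n" using that v1 st(1) by (simp add: k_def)
      moreover have "lo n = mult cs" by (simp add: lo_def mult_def)
      ultimately show ?thesis using st v1 unfolding j_def by simp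
    qed
    assume "val (Minus (Vr 2) (Vr 22)) v1 a1 \<noteq> 0"
    then have kn: "k < n" using v1 by (simp add: k_def)
    have bk: "off + k < length xs" "off + k < B" "Suc k < B" using kn length_xs small_bounds by auto
    have cond: "ok (Ne (In (Plus (Vr 7) (Vr 22))) (Vr 27)) v1 a1"
      "val (Ne (In (Plus (Vr 7) (Vr 22))) (Vr 27)) v1 a1 \<noteq> 0 \<longleftrightarrow> col k \<noteq> cs"
      using bk v1 xs_col[OF kn] by (simp_all add: k_def)
    have msS: "(\<exists>x<Suc k. col x = cs \<and> msol x) \<longleftrightarrow> (\<exists>x<k. col x = cs \<and> msol x) \<or> col k = cs \<and> msol k"
      by (auto simp: less_Suc_eq)
    show "\<exists>T. runs (?body ;; ?inc) v1 a1 T (\<lambda>v' a'. I v' a' \<and> \<phi> v' a' + T + 1 \<le> \<phi> v1 a1)"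
    proof (cases "col k = cs")
      case False
      have "I (v1(22 := Suc k)) a1"
        using I1 kn False lo_Suc[of k] msS by (simp add: I_def k_def)
      moreover have "\<phi> (v1(22 := Suc k)) a1 + 2 + 1 \<le> \<phi> v1 a1"
        using hi_Suc[OF kn] False kn by (simp add: \<phi>_def k_def[symmetric])
      ultimately have "runs (?body ;; ?inc) v1 a1 2 (\<lambda>v' a'. I v' a' \<and> \<phi> v' a' + 2 + 1 \<le> \<phi> v1 a1)"
        using cond False bk b by (simp add: k_def[symmetric])
      then show ?thesis by blast
    next
      case True
      let ?T = "67 * n + 34"
      have "runs (Layout ;; Kernel) v1 a1 (67 * n + 32)
          (\<lambda>v' a'. runs ?inc v' a' 1 (\<lambda>v' a'. I v' a' \<and> \<phi> v' a' + ?T + 1 \<le> \<phi> v1 a1))"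
      proof (rule runs_weaken[OF root[of v1 j k a1] order_refl])
        show "j \<le> n" using st(1,2) lo_le[of k] by simp
        show "col k \<in> set ms" using True cs by simp
        show "1 \<le> mult x" if "x \<in> set ms" for x by (rule ms(2)[OF that])
        show "a1 17 x \<noteq> 0 \<longleftrightarrow> x \<in> set ms" for x using a(1) st(4) by simp
        fix v2 a2 assume R: "root_post k j v1 a1 v2 a2"
        have v2: "\<forall>x. x \<notin> {5, 9, 10, 11, 12, 13, 19, 21, 24, 25, 26, 30} \<longrightarrow> v2 x = v1 x" "v2 22 = k"
          and bel: "below j (n + 1) a1 a2" and arr: "{x. a2 5 x \<noteq> 0} \<subseteq> set ms" "a2 17 = a 17" "a2 18 = a 18"
          and new: "v2 5 = j \<and> \<not> msol k \<or> v2 5 = Suc j \<and> fok (n + 1) a2 j \<and> (fsol (n + 1) a2 j \<longleftrightarrow> msol k) \<and>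
            a2 7 j \<le> 2 * (n - length ms) \<and> a2 7 j - a2 8 j \<le> n - length ms - (mult cs - 1)"
          using R st(4,5) True by (auto simp: root_post_def k_def)
        have old: "fok (n + 1) a2 i \<and> a2 7 i \<le> 2 * (n - length ms) \<and> a2 7 i - a2 8 i \<le> n - length ms - (mult cs - 1)"
          "fsol (n + 1) a2 i \<longleftrightarrow> fsol (n + 1) a1 i" if "i < j" for i
        proof -
          have "a1 7 i < n + 1" using st(6)[OF that] by (simp add: fok_def)
          note fb = frame_below[OF bel that this]
          have "a2 7 i = a1 7 i" "a2 8 i = a1 8 i" using bel that by (auto simp: below_def)
          then show "fok (n + 1) a2 i \<and> a2 7 i \<le> 2 * (n - length ms) \<and> a2 7 i - a2 8 i \<le> n - length ms - (mult cs - 1)"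
            "fsol (n + 1) a2 i \<longleftrightarrow> fsol (n + 1) a1 i" using fb st(6)[OF that] by simp_all
        qed
        have all: "\<forall>i<v2 5. fok (n + 1) a2 i \<and> a2 7 i \<le> 2 * (n - length ms) \<and> a2 7 i - a2 8 i \<le> n - length ms - (mult cs - 1)"
          using new old(1) by (auto simp: less_Suc_eq)
        have ex: "(\<exists>i<v2 5. fsol (n + 1) a2 i) \<longleftrightarrow> (\<exists>x<Suc k. col x = cs \<and> msol x)"
        proof -
          have "(\<exists>i<j. fsol (n + 1) a2 i) \<longleftrightarrow> (\<exists>x<k. col x = cs \<and> msol x)" using old(2) st(7) by blast
          moreover have "(\<exists>i<v2 5. fsol (n + 1) a2 i) \<longleftrightarrow> (\<exists>i<j. fsol (n + 1) a2 i) \<or> msol k"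
            using new by (auto simp: less_Suc_eq)
          ultimately show ?thesis unfolding msS using True by simp
        qed
        have h5: "v2 5 \<le> lo (Suc k)" using lo_Suc[of k] True new st(2) by auto
        have vs: "\<forall>x\<in>{0, 2, 3, 4, 6, 7, 8, 27}. v2 x = v x" using v2(1) I1 by (simp add: I_def)
        have "I (v2(22 := Suc k)) a2"
          unfolding I_def using kn arr vs h5 all ex by simp
        moreover have "\<phi> (v2(22 := Suc k)) a2 + ?T + 1 \<le> \<phi> v1 a1"
          using hi_Suc[OF kn] True kn by (simp add: \<phi>_def k_def[symmetric])
        ultimately show "runs ?inc v2 a2 1 (\<lambda>v' a'. I v' a' \<and> \<phi> v' a' + ?T + 1 \<le> \<phi> v1 a1)"
          using v2(2) bk b by simp
      qed (use v1 kn ms a st k_def j_def in simp_all)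
      then have "runs ?body v1 a1 (67 * n + 33)
          (\<lambda>v' a'. runs ?inc v' a' 1 (\<lambda>v' a'. I v' a' \<and> \<phi> v' a' + ?T + 1 \<le> \<phi> v1 a1))"
        unfolding runs_Cond using cond True by (simp add: add.commute)
      then have "runs (?body ;; ?inc) v1 a1 ?T (\<lambda>v' a'. I v' a' \<and> \<phi> v' a' + ?T + 1 \<le> \<phi> v1 a1)"
        by (rule runs_Seq) simp
      then show ?thesis by blast
    qed
  qed
  moreover have "\<phi> v a = 3 * n + (67 * n + 40) * mult cs"
    using v by (simp add: \<phi>_def hi_def mult_def atLeast0LessThan)
  ultimately show ?thesis unfolding Roots_def For_def by simp
qed

definition solvable :: bool where
  "solvable \<longleftrightarrow> (\<exists>S\<subseteq>{..<n}. S \<noteq> {} \<and> (\<forall>u\<in>S. \<forall>v\<in>S. (u, v) \<in> ((set es \<union> (set es)\<inverse>) \<inter> S \<times> S)\<^sup>*) \<and>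
     inj_on col S \<and> col ` S = set ms)"

text \<open>Every solution contains a vertex of the motif color \<open>cs\<close>, so it is enough
  to try these as roots.\<close>

lemma solvable_msol: "cs \<in> set ms \<Longrightarrow> solvable \<longleftrightarrow> (\<exists>x<n. col x = cs \<and> msol x)"
proof
  assume cs: "cs \<in> set ms" and solvable
  then obtain S where S: "S \<subseteq> {..<n}" "\<forall>u\<in>S. \<forall>v\<in>S. (u, v) \<in> ((set es \<union> (set es)\<inverse>) \<inter> S \<times> S)\<^sup>*"
    "inj_on col S" "col ` S = set ms" by (auto simp: solvable_def)
  then obtain x where "x \<in> S" "col x = cs" using cs by (metis imageE)
  then show "\<exists>x<n. col x = cs \<and> msol x" using S unfolding msol_def by blast
qed (auto simp: solvable_def msol_def)

text \<open>\<open>u\<close> is the multiplicity of the chosen motif color. If it exceeds 1, no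
  motif color is unique, so each occurs at least twice and \<open>2 * length ms <= n\<close>. Exits
  for an empty motif or a missing color are booked under \<open>u = 0\<close>.\<close>

lemma main_runs:
  "\<exists>T. (n < length ms \<and> T = 20 \<or> length ms \<le> n \<and>
      (\<exists>u. T = run_time n (n - length ms) u \<and> u \<le> n \<and> (u \<le> 1 \<or> 2 * length ms \<le> n))) \<and>
    runs Main ((\<lambda>_. 0)(0 := length xs)) (\<lambda>_ _. 0) T (\<lambda>v a. v 0 = (if solvable then 1 else 0))"
proof -
  let ?Q = "\<lambda>(v :: vars) (a :: arrs). v 0 = (if solvable then 1 else 0)"
  let ?v = "((\<lambda>_. 0)(0 := 0, 2 := n, 3 := length es, 4 := length ms, 7 := off, 8 := off + n, 6 := Suc n)) :: vars"
  let ?a = "(\<lambda>_ _. 0) :: arrs"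
  have start: "runs Main ((\<lambda>_. 0)(0 := length xs)) ?a (T + 7) Q" if "runs Decide ?v ?a T Q" for T Q
  proof -
    have eq: "((\<lambda>_. 0)(0 := length xs, 2 := n, 3 := length es, 4 := length ms, 7 := 4 + (length es + length es),
        8 := 4 + (length es + length es) + n, 6 := Suc n, 0 := 0)) = ?v" by (rule ext) simp
    have b: "0 < length xs" "Suc 0 < length xs" "3 < length xs" "4 + (length es + length es) + n < B"
      using length_xs small_bounds(8) by simp_all
    show ?thesis unfolding Main_def using that[folded eq] b small_bounds xs_head by simp
  qed
  have no: "\<not> solvable" if "ms = [] \<or> n < length ms"
  proof
    assume solvable
    then obtain S where S: "S \<subseteq> {..<n}" "S \<noteq> {}" "inj_on col S" "col ` S = set ms" by (auto simp: solvable_def)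
    have "length ms = card S" using card_image[OF S(3)] S(4) distinct_card[OF ms_distinct] by simp
    also have "\<dots> \<le> n" using card_mono[OF _ S(1)] by simp
    finally show False using that S(2,4) by auto
  qed
  consider "ms = []" | "ms \<noteq> []" "n < length ms" | "ms \<noteq> []" "length ms \<le> n" by linarith
  then show ?thesis
  proof cases
    case 1
    then have "runs Main ((\<lambda>_. 0)(0 := length xs)) ?a (1 + 7) ?Q" using no by (intro start) (simp add: Decide_def)
    then have "runs Main ((\<lambda>_. 0)(0 := length xs)) ?a (run_time n (n - length ms) 0) ?Q"
      by (rule runs_weaken) (simp_all add: run_time_def)
    then show ?thesis using 1 by (intro exI[of _ "run_time n (n - length ms) 0"]) auto
  next
    case 2
    then have "runs Main ((\<lambda>_. 0)(0 := length xs)) ?a (2 + 7) ?Q" using no by (intro start) (simp add: Decide_def)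
    then have "runs Main ((\<lambda>_. 0)(0 := length xs)) ?a 20 ?Q" by (rule runs_weaken) simp_all
    then show ?thesis using 2 by blast
  next
    case 3
    define l where "l = n - length ms"
    let ?d = "Cond (Vr 28) Skip (Roots ;; Search)"
    let ?P = "\<lambda>T. \<exists>u. T = 3 + 3 * n + (67 * n + 40) * u + 51 * (u * ((2 * l + 1)\<^sup>2 + hpot (l - (u - 1)))) \<and>
      u \<le> n \<and> (u \<le> 1 \<or> 2 * length ms \<le> n)"
    have finish: "\<exists>T. ?P T \<and> runs ?d v' a' T ?Q"
      if fr: "\<forall>x. x \<notin> {9, 26, 27, 28, 29} \<longrightarrow> v' x = ?v x" "\<forall>r. r \<notin> {17, 18} \<longrightarrow> a' r = ?a r"
        and mem: "\<forall>x. a' 17 x \<noteq> 0 \<longleftrightarrow> x \<in> set ms" "\<forall>x. a' 18 x = mult x"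
        and v28: "v' 28 = 0 \<longleftrightarrow> (\<forall>x\<in>set ms. 1 \<le> mult x)" and cs: "v' 27 \<in> set ms"
        and uq: "mult (v' 27) = 1 \<or> (\<forall>x\<in>set ms. mult x \<noteq> 1)" for v' a'
    proof (cases "v' 28 = 0")
      case False
      then obtain y where y: "y \<in> set ms" "mult y = 0" using v28 by (auto simp: Suc_le_eq)
      then have "\<not> solvable" unfolding solvable_msol[OF y(1)] by (auto simp: mult_def)
      then have "runs ?d v' a' (3 + 3 * n) ?Q" using False fr by simp
      then show ?thesis by (intro exI[of _ "3 + 3 * n"] conjI exI[of _ 0]) simp_all
    next
      case True
      then have pos: "\<And>x. x \<in> set ms \<Longrightarrow> 1 \<le> mult x" using v28 by blast
      define u where "u = mult (v' 27)"
      have un: "u \<le> n"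
      proof -
        have "u \<le> card {..<n}" unfolding u_def mult_def by (intro card_mono) auto
        then show ?thesis by simp
      qed
      have two: "u \<le> 1 \<or> 2 * length ms \<le> n"
      proof (cases "u = 1")
        case False
        then have "2 \<le> mult x" if "x \<in> set ms" for x using uq pos[OF that] that unfolding u_def by (auto simp: le_Suc_eq numeral_2_eq_2)
        then have "(\<Sum>x\<in>set ms. 2) \<le> (\<Sum>x\<in>set ms. mult x)" by (rule sum_mono)
        also have "\<dots> = card (\<Union>x\<in>set ms. {v \<in> {..<n}. col v = x})"
          unfolding mult_def by (rule card_UN_disjoint[symmetric]) auto
        also have "\<dots> \<le> card {..<n}" by (intro card_mono) auto
        finally show ?thesis using distinct_card[OF ms_distinct] by simp
      qed simp
      let ?W = "u * ((2 * l + 1)\<^sup>2 + hpot (l - (u - 1)))"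
      have "runs (Roots ;; Search) v' a' (3 * n + (67 * n + 40) * u + 1 + (51 * ?W + 1)) ?Q"
      proof (rule runs_Seq[OF runs_weaken[OF roots[of v' "v' 27" a'] order_refl]])
        show "1 \<le> mult x" if "x \<in> set ms" for x by (rule pos[OF that])
        show "a' 17 x \<noteq> 0 \<longleftrightarrow> x \<in> set ms" for x using mem by blast
        fix v2 :: vars and a2
        assume R: "v2 6 = n + 1 \<and> v2 0 = 0 \<and> v2 5 \<le> mult (v' 27) \<and>
          (\<forall>i<v2 5. fok (n + 1) a2 i \<and> a2 7 i \<le> 2 * (n - length ms) \<and> a2 7 i - a2 8 i \<le> n - length ms - (mult (v' 27) - 1)) \<and>
          ((\<exists>i<v2 5. fsol (n + 1) a2 i) \<longleftrightarrow> (\<exists>x<n. col x = v' 27 \<and> msol x))"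
        have fp: "fpot a2 i \<le> (2 * l + 1)\<^sup>2 + hpot (l - (u - 1))" if "i < v2 5" for i
          unfolding fpot_def pot_def
        proof (rule add_mono)
          have "a2 7 i \<le> 2 * l" "a2 7 i - a2 8 i \<le> l - (u - 1)" unfolding l_def u_def using R that by blast+
          then show "(a2 7 i + 1)\<^sup>2 \<le> (2 * l + 1)\<^sup>2" "hpot (a2 7 i - a2 8 i) \<le> hpot (l - (u - 1))"
            by (auto intro: power_mono hpot_mono)
        qed
        have "(\<Sum>i<v2 5. fpot a2 i) \<le> (\<Sum>i<v2 5. (2 * l + 1)\<^sup>2 + hpot (l - (u - 1)))" using fp by (intro sum_mono) simp
        also have "\<dots> = v2 5 * ((2 * l + 1)\<^sup>2 + hpot (l - (u - 1)))" by simp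
        also have "\<dots> \<le> ?W" using R by (intro mult_le_mono1) (simp add: u_def)
        finally have W: "(\<Sum>i<v2 5. fpot a2 i) \<le> ?W" .
        show "runs Search v2 a2 (51 * ?W + 1) ?Q"
        proof (rule runs_weaken[OF search[of v2 "n + 1" a2]])
          show "v2 6 = n + 1" "v2 0 = 0" using R by blast+
          show "fok (n + 1) a2 i" if "i < v2 5" for i using R that by blast
          show "(2 * (n + 1) + 2) * (n + 1) < B" by (rule B_bounds)
          show "4 < B" using B_bounds by simp
          show "51 * (\<Sum>i<v2 5. fpot a2 i) + 1 \<le> 51 * ?W + 1" using W by simp
          show "?Q v3 a3" if "v3 0 = (if \<exists>i<v2 5. fsol (n + 1) a2 i then 1 else 0)" for v3 and a3 :: arrs
            using R that solvable_msol[OF cs] by simp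
        qed
      qed (use fr cs 3 mem in \<open>simp_all add: u_def\<close>)
      then have "runs ?d v' a' (3 + 3 * n + (67 * n + 40) * u + 51 * ?W) ?Q"
        unfolding runs_Cond using True by (simp add: algebra_simps)
      with un two show ?thesis by blast
    qed
    have "runs (Count ;; 9 ::= Cn 0 ;; Scan) ?v ?a (4 * n + 1 + (9 * length ms + 2)) (\<lambda>v' a'. \<exists>T. ?P T \<and> runs ?d v' a' T ?Q)"
    proof (rule runs_Seq[OF runs_weaken[OF count[of ?v ?a] order_refl]])
      fix v1 a1
      assume 1: "(\<forall>x. x \<notin> {9, 26} \<longrightarrow> v1 x = ?v x) \<and> (\<forall>r. r \<noteq> 18 \<longrightarrow> a1 r = ?a r) \<and> (\<forall>x. a1 18 x = mult x)"
      have "runs Scan (v1(9 := 0)) a1 (9 * length ms + 1) (\<lambda>v' a'. \<exists>T. ?P T \<and> runs ?d v' a' T ?Q)"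
      proof (rule runs_weaken[OF scan[of "v1(9 := 0)" a1] order_refl])
        fix v2 a2
        assume 2: "(\<forall>x. x \<notin> {9, 26, 27, 28, 29} \<longrightarrow> v2 x = (v1(9 := 0)) x) \<and>
          (\<forall>r. r \<noteq> 17 \<longrightarrow> a2 r = a1 r) \<and> (\<forall>x. a2 17 x \<noteq> 0 \<longleftrightarrow> x \<in> set ms) \<and>
          (v2 28 = 0 \<longleftrightarrow> (\<forall>x\<in>set ms. 1 \<le> mult x)) \<and> v2 27 \<in> set ms \<and>
          (mult (v2 27) = 1 \<or> (\<forall>x\<in>set ms. mult x \<noteq> 1))"
        show "\<exists>T. ?P T \<and> runs ?d v2 a2 T ?Q"
        proof (rule finish[of v2 a2])
          show "\<forall>x. a2 17 x \<noteq> 0 \<longleftrightarrow> x \<in> set ms" "v2 28 = 0 \<longleftrightarrow> (\<forall>x\<in>set ms. 1 \<le> mult x)" "v2 27 \<in> set ms"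
            "mult (v2 27) = 1 \<or> (\<forall>x\<in>set ms. mult x \<noteq> 1)" using 2 by blast+
          show "\<forall>x. x \<notin> {9, 26, 27, 28, 29} \<longrightarrow> v2 x = ?v x" using 1 2 by simp
          show "\<forall>r. r \<notin> {17, 18} \<longrightarrow> a2 r = ?a r" using 1 2 by simp
          show "\<forall>x. a2 18 x = mult x" using 1 2 by simp
        qed
      qed (use 1 3 in simp_all)
      then show "runs (9 ::= Cn 0 ;; Scan) v1 a1 (9 * length ms + 2) (\<lambda>v' a'. \<exists>T. ?P T \<and> runs ?d v' a' T ?Q)"
        using small_bounds by simp
    qed simp_all
    from runs_Seq_ex[OF this] obtain T where T: "?P T"
      "runs ((Count ;; 9 ::= Cn 0 ;; Scan) ;; ?d) ?v ?a (4 * n + 1 + (9 * length ms + 2) + T) ?Q"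
      by (erule_tac exE, erule_tac conjE) (rule that)
    let ?T = "4 * n + 1 + (9 * length ms + 2) + T"
    have "runs Decide ?v ?a (T' + 2) Q"
      if "runs ((Count ;; 9 ::= Cn 0 ;; Scan) ;; ?d) ?v ?a T' Q" for T' Q
      using that 3 unfolding Decide_def runs_Cond by simp
    from this[OF T(2)] have "runs Decide ?v ?a (?T + 2) ?Q" .
    from start[OF this] have run: "runs Main ((\<lambda>_. 0)(0 := length xs)) ?a (?T + 2 + 7) ?Q" .
    obtain u where u: "T = 3 + 3 * n + (67 * n + 40) * u + 51 * (u * ((2 * l + 1)\<^sup>2 + hpot (l - (u - 1))))"
      "u \<le> n" "u \<le> 1 \<or> 2 * length ms \<le> n" using T(1) by blast
    have "?T + 2 + 7 \<le> run_time n l u" using 3(2) unfolding run_time_def u(1) by linarith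
    with run have "runs Main ((\<lambda>_. 0)(0 := length xs)) ?a (run_time n l u) ?Q" by (rule runs_weaken) assumption
    then show ?thesis using u(2,3) 3(2) unfolding l_def by blast
  qed
qed

end


section \<open>The running time\<close>

text \<open>With \<open>q l\<close> for the added quadratic,
  \<open>q (l + 2) + (2 * l + 5)^2 = 2 * q l\<close>: it is the particular solution that turns the
  recurrence into plain doubling. The factor 200 comes from the two base cases, the second with
  \<open>7 / 5 <= sqrt 2\<close>.\<close>

lemma hpot_bound: "real (hpot l) + (4 * real l ^ 2 + 36 * real l + 113) \<le> 200 * sqrt 2 ^ l"
proof (induction l rule: hpot.induct)
  case 2
  have "1 \<le> sqrt 2" by simp
  moreover have "(7 / 5)\<^sup>2 \<le> (2 :: real)" by (simp add: power2_eq_square)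
  then have "7 / 5 \<le> sqrt 2" by (rule real_le_rsqrt)
  ultimately show ?case by simp
next
  case (3 l)
  have eq: "sqrt 2 ^ Suc (Suc l) = 2 * sqrt 2 ^ l" by simp
  have "real (hpot (Suc (Suc l))) = 2 * real (hpot l) + (2 * real l + 5)\<^sup>2" "real (Suc (Suc l)) = real l + 2" by simp_all
  then show ?case using 3 unfolding eq by (simp add: power2_eq_square algebra_simps)
qed simp

text \<open>Used with \<open>k = u - 1\<close>: the number of roots is compensated by the smaller
  exponent that they cause.\<close>

lemma Suc_le_sqrt2_power: "real (Suc k) \<le> 2 * sqrt 2 ^ k"
proof (induction k rule: hpot.induct)
  case (3 k)
  have eq: "sqrt 2 ^ Suc (Suc k) = 2 * sqrt 2 ^ k" by simp
  show ?case
  proof (cases k)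
    case (Suc j)
    then have "real (Suc (Suc (Suc k))) \<le> 2 * real (Suc k)" by simp
    also have "2 * real (Suc k) \<le> 2 * (2 * sqrt 2 ^ k)" using 3 by simp
    finally show ?thesis unfolding eq .
  qed simp
qed auto

text \<open>From \<open>l = 10\<close> on, increasing \<open>l\<close> by 2 at most doubles the
  cube, which is what \<open>sqrt 2 ^ l\<close> does; below 10 the cube is at most
  \<open>19 ^ 3\<close>.\<close>

lemma cube_le_sqrt2_power: "real ((2 * l + 1) ^ 3) \<le> 8000 * sqrt 2 ^ l"
proof (induction l rule: less_induct)
  case (less l)
  show ?case
  proof (cases "l < 10")
    case True
    then have "(2 * l + 1) ^ 3 \<le> 19 ^ 3" by (intro power_mono) auto
    then have "(2 * l + 1) ^ 3 \<le> 8000" by simp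
    then have "real ((2 * l + 1) ^ 3) \<le> real 8000" by (rule of_nat_mono)
    also have "\<dots> = 8000 * 1" by simp
    also have "\<dots> \<le> 8000 * sqrt 2 ^ l" by (intro mult_left_mono one_le_power) auto
    finally show ?thesis .
  next
    case False
    define j where "j = l - 2"
    have j: "l = Suc (Suc j)" "8 \<le> j" using False by (auto simp: j_def)
    have "(2 * l + 1) ^ 3 \<le> 2 * (2 * j + 1) ^ 3"
    proof -
      obtain i where "j = i + 8" using j(2) by (metis le_add_diff_inverse2)
      then show ?thesis unfolding j(1) by (simp add: power3_eq_cube algebra_simps)
    qed
    then have "real ((2 * l + 1) ^ 3) \<le> 2 * real ((2 * j + 1) ^ 3)"
      by (metis of_nat_le_iff of_nat_mult of_nat_numeral)
    also have "\<dots> \<le> 2 * (8000 * sqrt 2 ^ j)" using less.IH[of j] j(1) by simp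
    also have "\<dots> = 8000 * sqrt 2 ^ l" by (simp add: j(1))
    finally show ?thesis .
  qed
qed

text \<open>For one root the preparation is linear in \<open>n\<close>. For several roots
  \<open>n <= 2 * l\<close> and \<open>u <= 2 * l\<close>, so the preparation is bounded by a cube
  in \<open>l\<close>. The search term splits as \<open>sqrt 2 ^ (u - 1)\<close> for the number of
  roots times \<open>sqrt 2 ^ (l - (u - 1))\<close> for each.\<close>

lemma run_time_bound:
  assumes "0 < n" "m \<le> n" "u \<le> n" "u \<le> 1 \<or> 2 * m \<le> n"
  shows "real (run_time n (n - m) u) \<le> 2000000 * (sqrt 2 ^ (n - m) + real n)"
proof -
  define l where "l = n - m"
  let ?A = "sqrt 2 ^ l" and ?C = "(2 * l + 1) ^ 3"
  have C: "(2 * l + 1) * (2 * l + 1)\<^sup>2 = ?C" by (simp only: power3_eq_cube power2_eq_square mult.assoc)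
  have first: "(67 * n + 40) * u + 51 * (u * (2 * l + 1)\<^sup>2) \<le> 107 * n + 158 * ?C"
  proof (cases "u \<le> 1")
    case True
    have "(67 * n + 40) * u \<le> (67 * n + 40) * 1" using True by (intro mult_le_mono2)
    moreover have "u * (2 * l + 1)\<^sup>2 \<le> (2 * l + 1) * (2 * l + 1)\<^sup>2" using True by (intro mult_le_mono1) simp
    moreover have "x + 51 * y \<le> 107 * n + 158 * z" if "x \<le> (67 * n + 40) * 1" "y \<le> z" for x y z :: nat
    proof (rule add_mono)
      show "x \<le> 107 * n" using that(1) assms(1) by simp
      show "51 * y \<le> 158 * z" using that(2) by simp
    qed
    ultimately show ?thesis unfolding C by blast
  next
    case False
    then have nl: "n \<le> 2 * l" "u \<le> 2 * l" using assms by (auto simp: l_def)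
    have "(67 * n + 40) * u \<le> (107 * (2 * l + 1)\<^sup>2) * (2 * l + 1)"
    proof (rule mult_le_mono)
      have "67 * n + 40 \<le> 107 * (2 * l + 1)" using nl by simp
      also have "\<dots> \<le> 107 * (2 * l + 1)\<^sup>2" by (simp add: power2_eq_square)
      finally show "67 * n + 40 \<le> 107 * (2 * l + 1)\<^sup>2" .
    qed (use nl in simp)
    moreover have "u * (2 * l + 1)\<^sup>2 \<le> (2 * l + 1) * (2 * l + 1)\<^sup>2" using nl by (intro mult_le_mono1) simp
    moreover have "(107 * (2 * l + 1)\<^sup>2) * (2 * l + 1) = 107 * ?C" unfolding C[symmetric] by (simp only: mult.assoc mult.commute)
    moreover have "x + 51 * y \<le> 107 * n + 158 * z" if "x \<le> x'" "y \<le> z" "x' = 107 * z" for x x' y z :: nat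
    proof -
      have "x + 51 * y \<le> 107 * z + 51 * z" using that by (intro add_mono) simp_all
      then show ?thesis by simp
    qed
    ultimately show ?thesis unfolding C by blast
  qed
  have second: "real (u * hpot (l - (u - 1))) \<le> 400 * ?A"
  \<comment> \<open>In the excluded case \<open>u\<close> or the truncated difference is 0, and the
    product vanishes because \<open>hpot 0 = 0\<close>.\<close>
  proof (cases "u = 0 \<or> l < u - 1")
    case False
    then obtain j where j: "u = Suc j" "j \<le> l" by (cases u) auto
    have "real (hpot (l - j)) \<le> 200 * sqrt 2 ^ (l - j)" using hpot_bound[of "l - j"] by (smt (verit) of_nat_0_le_iff zero_le_power2)
    then have "real u * real (hpot (l - j)) \<le> (2 * sqrt 2 ^ j) * (200 * sqrt 2 ^ (l - j))"
      using Suc_le_sqrt2_power[of j] j(1) by (intro mult_mono) auto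
    also have "\<dots> = 400 * (sqrt 2 ^ j * sqrt 2 ^ (l - j))" by simp
    also have "sqrt 2 ^ j * sqrt 2 ^ (l - j) = ?A" using j(2) by (simp add: power_add[symmetric])
    finally show ?thesis using j(1) by (simp add: distrib_right)
  qed auto
  have "run_time n l u = 16 * n + 20 + ((67 * n + 40) * u + 51 * (u * (2 * l + 1)\<^sup>2)) + 51 * (u * hpot (l - (u - 1)))"
    by (simp add: run_time_def algebra_simps)
  also have "\<dots> \<le> 16 * n + 20 * n + (107 * n + 158 * ?C) + 51 * (u * hpot (l - (u - 1)))"
    by (rule add_mono[OF add_mono[OF _ first] order_refl]) (use assms(1) in simp)
  finally have "real (run_time n l u) \<le> real (16 * n + 20 * n + (107 * n + 158 * ?C) + 51 * (u * hpot (l - (u - 1))))"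
    by (rule of_nat_mono)
  also have "\<dots> = 143 * real n + 158 * real ?C + 51 * real (u * hpot (l - (u - 1)))"
    by simp
  also have "\<dots> \<le> 143 * real n + 158 * (8000 * ?A) + 51 * (400 * ?A)"
    using second cube_le_sqrt2_power[of l] by (intro add_mono mult_left_mono) auto
  also have "\<dots> \<le> 2000000 * (?A + real n)" by simp
  finally show ?thesis by (simp add: l_def)
qed


section \<open>Instances\<close>

text \<open>Each edge is mapped to its lower end, the one whose parent is the other end. Two edges
  with the same lower end agree up to direction, and each edge is listed in one direction.\<close>

lemma (in rooted_tree) edges_le_card:
  assumes "E = set es \<union> (set es)\<inverse>" "distinct es" "set es \<inter> (set es)\<inverse> = {}"
  shows "length es \<le> card V"
proof -
  define f where "f e = (if fst e \<noteq> r \<and> par (fst e) = snd e then fst e else snd e)" for e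
  have f: "f e \<noteq> r \<and> (e = (f e, par (f e)) \<or> e = (par (f e), f e))" if "e \<in> set es" for e
    using edge_par[of "fst e" "snd e"] that assms(1) by (cases e) (auto simp: f_def)
  have "inj_on f (set es)"
  proof (rule inj_onI, rule ccontr)
    fix d e assume de: "d \<in> set es" "e \<in> set es" "f d = f e" "d \<noteq> e"
    then have "d = (snd e, fst e)" using f[OF de(1)] f[OF de(2)] by (metis fst_conv snd_conv)
    then have "e \<in> (set es)\<inverse>" using de(1) by (cases e) auto
    then show False using de(2) assms(3) by blast
  qed
  moreover have "f ` set es \<subseteq> V" using E_sub assms(1) by (auto simp: f_def)
  ultimately have "card (set es) \<le> card V" by (metis card_image card_mono finite_V)
  then show ?thesis using assms(2) by (simp add: distinct_card)
qed

text \<open>The exponent 6 leaves one factor \<open>X ^ 3\<close> for \<open>B\<close> and another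
  one for the constant 34 of the memory layout, which is below \<open>X ^ 3\<close> because
  \<open>X >= 5\<close>.\<close>

lemma encoding_solved:
  assumes tree: "undirected_tree (mgraph I)"
    and enc: "encodes_motif_instance I xs" and w: "(length xs + Max (set xs)) ^ 6 \<le> 2 ^ w"
  defines "n \<equiv> card (pverts (mgraph I))" and "m \<equiv> card (motif I)"
  shows "\<exists>t. real t \<le> real (length (program Main)) * 2000001 * (sqrt 2 powr (real n - real m) + real n) \<and>
    answers_within w (program Main) xs t (colorful_graph_motif I)"
proof -
  let ?G = "mgraph I" and ?col = "coloring I"
  obtain n' q es ms where e: "pverts ?G = {..<n'}" "palette I = {..<q}" "distinct es" "set es \<inter> (set es)\<inverse> = {}"
    "parcs ?G = set es \<union> (set es)\<inverse>" "distinct ms" "set ms = motif I"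
    "xs = [n', length es, q, length ms] @ concat (map (\<lambda>(u, v). [u, v]) es) @ map ?col [0..<n'] @ ms"
    using enc unfolding encodes_motif_instance_def by blast
  have n: "n' = n" using e(1) by (simp add: n_def)
  have m: "length ms = m" using distinct_card[OF e(6)] e(7) by (simp add: m_def)
  note e = e[unfolded n]
  interpret G: pair_graph ?G using tree by (simp add: undirected_tree_def)
  have "pverts ?G \<noteq> {}"
    using tree G.connected_induce_iff[of "pverts ?G"]
    by (auto simp: undirected_tree_def Digraph_Component.connected_def strongly_connected_def mk_symmetric_def)
  then have n0: "0 < n" using e(1) by auto
  have rooted: "\<exists>par depth. rooted_tree {..<n} (set es \<union> (set es)\<inverse>) r par depth" if "r < n" for r
    using undirected_tree_rooted[OF tree, of r] e(1,5) that by (metis lessThan_iff)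
  define X where "X = length xs + Max (set xs)"
  have le_Max: "x \<le> Max (set xs)" if "x \<in> set xs" for x using that by (intro Max_ge) auto
  have len: "length xs = 4 + 2 * length es + n + length ms" by (simp add: e(8) length_concat_pairs)
  have X5: "5 \<le> X" "n + 4 \<le> X" "length xs \<le> X" using len n0 by (auto simp: X_def)
  have inX: "x \<le> X" if "x \<in> set xs" for x using le_Max[OF that] by (simp add: X_def)
  have cube: "125 \<le> X ^ 3" using power_mono[OF X5(1), of 3] by simp
  have X3: "X < X ^ 3"
  proof -
    have "5 * 5 \<le> X * X" using X5(1) by (intro mult_le_mono)
    then have "X * 1 < X * (X * X)" using X5(1) by (intro mult_strict_left_mono) linarith+
    then show ?thesis by (simp add: power3_eq_cube)
  qed
  \<comment> \<open>A cube is enough for \<open>B\<close>: as \<open>n + 4 <= X\<close>, the stack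
    has at most \<open>2 * X * X\<close> cells, less than \<open>X ^ 3\<close>.\<close>
  interpret tree_input xs "X ^ 3" n q es ?col ms
  proof
    show "xs = [n, length es, q, length ms] @ concat (map (\<lambda>(u, v). [u, v]) es) @ map ?col [0..<n] @ ms" by (rule e(8))
    have "(2 * (n + 1) + 2) * (n + 1) \<le> (2 * X) * X" using X5(2) by (intro mult_le_mono) auto
    also have "\<dots> < (X * X) * X" using X5(1) by (intro mult_strict_right_mono) auto
    finally show "(2 * (n + 1) + 2) * (n + 1) < X ^ 3" by (simp add: power3_eq_cube)
    show "5 < X ^ 3" using cube by simp
    show "length xs < X ^ 3" using X5(3) X3 by simp
    show "?col v < X ^ 3" if "v < n" for v using inX[of "?col v"] that X3 by (auto simp: e(8))
    show "x < X ^ 3" if "x \<in> set ms" for x using inX[of x] that X3 by (auto simp: e(8))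
    show "u < n \<and> v < n" if "(u, v) \<in> set es" for u v
      using G.in_arcsD1[of u v] G.in_arcsD2[of u v] that e(1,5) by auto
    obtain par depth where "rooted_tree {..<n} (set es \<union> (set es)\<inverse>) 0 par depth" using rooted[OF n0] by blast
    from rooted_tree.edges_le_card[OF this refl e(3,4)] show "length es \<le> n" by simp
  qed (use rooted e in auto)
  have bw: "34 * X ^ 3 < 2 ^ w"
  proof -
    have "34 * X ^ 3 < X ^ 3 * X ^ 3" using cube X5(1) by (intro mult_strict_right_mono) auto
    also have "\<dots> = X ^ 6" by (simp add: power_add[symmetric])
    finally show ?thesis using w by (simp add: X_def)
  qed
  interpret compiled xs "X ^ 3" w
  proof
    show "x < 2 ^ w" if "x \<in> set xs" for x using inX[OF that] X3 bw by linarith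
    show "length xs + 32 * X ^ 3 + 32 < 2 ^ w" using X5(3) X3 bw cube by linarith
  qed
  have yes: "colorful_graph_motif I \<longleftrightarrow> solvable"
  proof -
    have "(\<exists>f. bij_betw f S (motif I) \<and> (\<forall>v\<in>S. f v = ?col v)) \<longleftrightarrow> inj_on ?col S \<and> ?col ` S = set ms" for S
    proof
      assume "\<exists>f. bij_betw f S (motif I) \<and> (\<forall>v\<in>S. f v = ?col v)"
      then obtain f where "bij_betw f S (motif I)" "\<And>v. v \<in> S \<Longrightarrow> f v = ?col v" by blast
      then have "bij_betw ?col S (motif I)" using bij_betw_cong[of S f ?col "motif I"] by blast
      then show "inj_on ?col S \<and> ?col ` S = set ms" by (simp add: bij_betw_def e(7))
    qed (auto simp: bij_betw_def e(7))
    note bij = this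
    have conn: "Digraph_Component.connected (with_proj ?G \<restriction> S) \<longleftrightarrow>
        S \<noteq> {} \<and> (\<forall>u\<in>S. \<forall>v\<in>S. (u, v) \<in> ((set es \<union> (set es)\<inverse>) \<inter> S \<times> S)\<^sup>*)" if "S \<subseteq> {..<n}" for S
      using G.connected_induce_iff[of S] that unfolding e(1,5) by blast
    show ?thesis
      unfolding colorful_graph_motif_def solvable_def e(1) bij
      by (rule ex_cong1, rule conj_cong[OF refl]) (simp only: conn conj_assoc)
  qed
  obtain T where T: "n < length ms \<and> T = 20 \<or> length ms \<le> n \<and>
      (\<exists>u. T = run_time n (n - length ms) u \<and> u \<le> n \<and> (u \<le> 1 \<or> 2 * length ms \<le> n))"
    "runs Main ((\<lambda>_. 0)(0 := length xs)) (\<lambda>_ _. 0) T (\<lambda>v a. v 0 = (if solvable then 1 else 0))"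
    using main_runs by blast
  have bound: "real T \<le> 2000000 * (sqrt 2 powr (real n - real m) + real n)"
  proof (cases "n < length ms")
    case True
    then have "real T \<le> 20 * real n" using T(1) n0 by simp
    also have "\<dots> \<le> 2000000 * (sqrt 2 powr (real n - real m) + real n)" by (simp add: add_increasing)
    finally show ?thesis .
  next
    case False
    then obtain u where "T = run_time n (n - m) u" "u \<le> n" "u \<le> 1 \<or> 2 * m \<le> n" "m \<le> n" using T(1) m by auto
    moreover from this have "sqrt 2 powr (real n - real m) = sqrt 2 ^ (n - m)"
      by (simp add: powr_realpow[symmetric] of_nat_diff)
    ultimately show ?thesis using run_time_bound[OF n0] by simp
  qed
  obtain t v a where run: "run Main ((\<lambda>_. 0)(0 := length xs)) (\<lambda>_ _. 0) t v a" "t \<le> T" "v 0 = (if solvable then 1 else 0)"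
    using T(2) unfolding runs_def by blast
  obtain t' where t': "t' \<le> length (program Main) * Suc t" "answers_within w (program Main) xs t' solvable"
    using program_answers[OF run(1,3)] by blast
  have "real t' \<le> real (length (program Main)) * real (Suc t)" using t'(1) by (metis of_nat_le_iff of_nat_mult)
  also have "\<dots> \<le> real (length (program Main)) * (2000001 * (sqrt 2 powr (real n - real m) + real n))"
  proof (rule mult_left_mono)
    \<comment> \<open>The unit by which 2000001 exceeds the bound on \<open>T\<close> pays for the
      step that saves the input length.\<close>
    have "1 \<le> sqrt 2 powr (real n - real m) + real n" using n0 by (simp add: add_increasing)
    then show "real (Suc t) \<le> 2000001 * (sqrt 2 powr (real n - real m) + real n)" using run(2) bound by simp
  qed simp
  finally show ?thesis using t'(2) yes by (auto simp: mult.assoc)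
qed

theorem theorem17:
  shows "solvable_in_time encodes_motif_instance
     {I. valid_motif_instance I \<and> undirected_tree (mgraph I)}
     colorful_graph_motif
     (\<lambda>I. sqrt 2 powr (real (card (pverts (mgraph I))) - real (card (motif I)))
           + real (card (pverts (mgraph I))))"
  unfolding solvable_in_time_def
  by (intro exI[of _ "program Main"] exI[of _ "real (length (program Main)) * 2000001"] exI[of _ 6])
    (use encoding_solved in blast)

end
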